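(* For every $p \in [\frac12,1)$ there exists $k_0 \in \mathbb{N}$ such that the following holds for every integer $k \geq k_0$. For every $\theta>0$ there exists $\gamma>0$ such that if a red/blue coloring of the edges of $K_N$ is not $(p,\theta)$-quasirandom, then it contains one of the following: (i) at least $\gamma N^k$ red copies of $K_k$, each with at least $((1-p)^k+\gamma)N$ extensions to a red $K_{k+1}$; or (ii) at least $\gamma N^k$ blue copies of $K_k$, each with at least $(p^k+\gamma)N$ extensions to a blue $K_{k+1}$.
   Context: A red/blue coloring of the edges of $K_N$ is $(p,\theta)$-quasirandom if for every pair of disjoint vertex sets $X,Y$, $|e_B(X,Y)-p|X||Y|| \leq \theta N^2$, where $e_B(X,Y)$ is the number of blue edges between $X$ and $Y$. A red (resp. blue) copy $Q$ of $K_k$ is a set of $k$ vertices all of whose pairs are red (resp. blue). An extension of $Q$ to a red (resp. blue) $K_{k+1}$ is a vertex $u \notin Q$ all of whose edges to $Q$ are red (resp. blue).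
   Formalization: The claim is proved for all N at least some N_0 depending on p, k, θ (γ does not depend on N); without this it fails, e.g. for N=2 with a blue edge, small θ and k≥3, where no K_k exists. *)

theory Defs
  imports Complex_Main
begin

datatype color = Red | Blue

text \<open>
  A coloring of the edges of the complete graph on a vertex set \<open>V\<close> is a function
  \<open>c :: 'a set \<Rightarrow> color\<close>, of which only the values on two-element subsets \<open>{u, v}\<close> of \<open>V\<close>
  are ever used.
\<close>

text \<open>
  Ordered pairs are counted; for disjoint \<open>X\<close> and \<open>Y\<close>, the only case used, each edge
  between \<open>X\<close> and \<open>Y\<close> is thereby counted exactly once.
\<close>
definition blue_edges_between :: "('a set \<Rightarrow> color) \<Rightarrow> 'a set \<Rightarrow> 'a set \<Rightarrow> nat" where
  "blue_edges_between c X Y = card {(x, y). x \<in> X \<and> y \<in> Y \<and> c {x, y} = Blue}"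

definition quasirandom :: "real \<Rightarrow> real \<Rightarrow> 'a set \<Rightarrow> ('a set \<Rightarrow> color) \<Rightarrow> bool" where
  "quasirandom p \<theta> V c \<longleftrightarrow>
     (\<forall>X Y. X \<subseteq> V \<and> Y \<subseteq> V \<and> X \<inter> Y = {} \<longrightarrow>
        \<bar>real (blue_edges_between c X Y) - p * real (card X) * real (card Y)\<bar>
          \<le> \<theta> * real (card V) ^ 2)"

definition mono_copies :: "'a set \<Rightarrow> ('a set \<Rightarrow> color) \<Rightarrow> color \<Rightarrow> nat \<Rightarrow> 'a set set" where
  "mono_copies V c a k =
     {Q. Q \<subseteq> V \<and> card Q = k \<and> (\<forall>u\<in>Q. \<forall>v\<in>Q. u \<noteq> v \<longrightarrow> c {u, v} = a)}"

definition extensions :: "'a set \<Rightarrow> ('a set \<Rightarrow> color) \<Rightarrow> color \<Rightarrow> 'a set \<Rightarrow> 'a set" where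
  "extensions V c a Q = {u \<in> V - Q. \<forall>v\<in>Q. c {u, v} = a}"

end

theory Submission
  imports Defs "HOL-Analysis.Analysis"
begin

text \<open>
  Write \<open>f\<close> for the indicator of one color and \<open>1 - f\<close> for the other. A set \<open>P\<close> is regular when,
  for every \<open>S \<subseteq> P\<close>, the number of neighbours of \<open>y\<close> in \<open>S\<close> is close to \<open>card S * dens f P y\<close> in
  \<open>l\<^sup>1\<close>-average over the vertices \<open>y\<close>. This one-sided condition is obtained by an energy increment, needs no regularity
  lemma, and is enough to evaluate the average number of extensions of any positive proportion of
  the cliques with one vertex in each of \<open>k\<close> regular sets \<open>P\<^sub>i\<close>: it is close to the sum over \<open>y\<close> of
  the products of the \<open>dens f P\<^sub>i y\<close>.

  By Ramsey supersaturation every regular set is rich in cliques of one of the two colors, say \<open>f\<close>,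
  for sets covering a third of the vertices. If (i) and (ii) fail, then the average of
  \<open>dens f P y ^ k\<close> is at most \<open>q ^ k\<close> up to a small error for these sets. As \<open>k\<close> is large, a
  Turan-type argument finds \<open>k\<close> of them spanning many cliques of the other color, so that the average
  of the product of the \<open>1 - dens f P\<^sub>i y\<close> is at most \<open>(1 - q) ^ k\<close> up to a small error. A stable
  inequality between power sum and product then forces the densities to be close to \<open>q\<close>. Hence there
  is a set \<open>A\<close> of at least a sixth of the vertices whose edges to the whole graph are quasirandom.
  Extending single vertices and pairs to \<open>k\<close>-cliques through \<open>A\<close> transfers the bounds on extensions of
  \<open>k\<close>-cliques to degrees and codegrees, which gives quasirandomness.
\<close>

subsection \<open>Cliques, books and regular sets\<close>

text \<open>Regularity serves only to evaluate the extensions of cliques that are already there. The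
  number of cliques is never predicted from densities between sets: it comes from below, by Ramsey
  inside one set or by greedy extension across several. So no pair of sets has to be regular, and an
  average over all vertices \<open>y\<close> is enough. The exponent has to be large for two
  reasons. The function \<open>x ^ (k - 1) * (1 - x)\<close> behind the power-product inequality
  increases only up to \<open>1 - 1 / k\<close>, so larger densities must be excluded by the power
  sum alone. And fewer than \<open>k\<close> sets together may spoil at most half of the vertices,
  so each may spoil only a fraction \<open>1 / (2 * k)\<close>. Nothing is known about the pairs
  outside the set \<open>A\<close>. For these only the book bounds are available, and they are
  one-sided and concern \<open>k\<close>-cliques; \<open>A\<close> is the tool that lowers them to
  single vertices and pairs, where the two complementary kernels supply the two sides.\<close>

definition common :: "('a \<Rightarrow> 'a \<Rightarrow> real) \<Rightarrow> 'a list \<Rightarrow> 'a \<Rightarrow> real" where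
  "common f l y = (\<Prod>u\<leftarrow>l. f u y)"

text \<open>Adjacency is demanded between positions, not between distinct vertices: a tuple with a
  repeated vertex counts when the loop there has value 1.\<close>

primrec clique_wt :: "('a \<Rightarrow> 'a \<Rightarrow> real) \<Rightarrow> 'a list \<Rightarrow> real" where
  "clique_wt f [] = 1"
| "clique_wt f (u # l) = common f l u * clique_wt f l"

text \<open>The analytic form of having few books with too many pages. As the weights are arbitrary,
  the inequality bounds the positive part of the surplus of extensions, and an indicator as weight
  restricts it to any set of tuples.\<close>

definition book_bounded :: "'a set \<Rightarrow> ('a \<Rightarrow> 'a \<Rightarrow> real) \<Rightarrow> real \<Rightarrow> nat \<Rightarrow> real \<Rightarrow> bool" where
  "book_bounded V f q m e \<longleftrightarrow>
     (\<forall>w. (\<forall>l. 0 \<le> w l \<and> w l \<le> 1) \<longrightarrow>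
       (\<Sum>l\<in>listset (replicate m V). w l * clique_wt f l * ((\<Sum>y\<in>V. common f l y) - q ^ m * card V))
         \<le> e * real (card V) ^ (m + 1))"

definition edge_kernel :: "('a \<Rightarrow> 'a \<Rightarrow> real) \<Rightarrow> bool" where
  "edge_kernel f \<longleftrightarrow> (\<forall>u v. f u v = f v u \<and> f u v \<in> {0, 1})"

definition dens :: "('a \<Rightarrow> 'a \<Rightarrow> real) \<Rightarrow> 'a set \<Rightarrow> 'a \<Rightarrow> real" where
  "dens f S y = (\<Sum>u\<in>S. f u y) / card S"

text \<open>The error is measured against \<open>card S\<close>, not \<open>card S'\<close>, so
  subsets with at most \<open>d * card S\<close> elements are harmless and need no
  exception.\<close>

definition regular_set :: "'a set \<Rightarrow> ('a \<Rightarrow> 'a \<Rightarrow> real) \<Rightarrow> real \<Rightarrow> 'a set \<Rightarrow> bool" where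
  "regular_set V f d S \<longleftrightarrow> S \<noteq> {} \<and> S \<subseteq> V \<and>
     (\<forall>S'\<subseteq>S. (\<Sum>y\<in>V. \<bar>\<Sum>u\<in>S'. f u y - dens f S y\<bar>) \<le> d * card S * card V)"

text \<open>A cut norm condition for the kernel between \<open>A\<close> and \<open>V\<close>; the
  absolute value at each \<open>y\<close> absorbs arbitrary signed weights on the side of
  \<open>V\<close>.\<close>

definition cut_uniform :: "'a set \<Rightarrow> ('a \<Rightarrow> 'a \<Rightarrow> real) \<Rightarrow> real \<Rightarrow> real \<Rightarrow> 'a set \<Rightarrow> bool" where
  "cut_uniform V f q c A \<longleftrightarrow> A \<subseteq> V \<and>
     (\<forall>w. (\<forall>u. 0 \<le> w u \<and> w u \<le> 1) \<longrightarrow>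
       (\<Sum>y\<in>V. \<bar>\<Sum>u\<in>A. w u * (f u y - q)\<bar>) \<le> c * real (card V) ^ 2)"

abbreviation co_kernel :: "('a \<Rightarrow> 'a \<Rightarrow> real) \<Rightarrow> 'a \<Rightarrow> 'a \<Rightarrow> real" where
  "co_kernel f \<equiv> \<lambda>u v. 1 - f u v"

section \<open>Elementary bounds for kernels and sums over tuples\<close>

lemma kernel_sym: "edge_kernel f \<Longrightarrow> f u v = f v u"
  by (simp add: edge_kernel_def)

lemma kernel_01: "edge_kernel f \<Longrightarrow> f u v = 0 \<or> f u v = 1"
  by (simp add: edge_kernel_def)

lemma kernel_nonneg: "edge_kernel f \<Longrightarrow> 0 \<le> f u v"
  and kernel_le_1: "edge_kernel f \<Longrightarrow> f u v \<le> 1"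
  using kernel_01[of f u v] by auto

lemma kernel_co: "edge_kernel f \<Longrightarrow> edge_kernel (co_kernel f)"
  unfolding edge_kernel_def by force

lemma common_Nil [simp]: "common f [] y = 1"
  and common_Cons [simp]: "common f (u # l) y = f u y * common f l y"
  by (simp_all add: common_def)

lemma common_bounds:
  assumes "edge_kernel f"
  shows "0 \<le> common f l y" "common f l y \<le> 1"
  by (induction l) (auto intro!: mult_nonneg_nonneg mult_le_one simp: kernel_nonneg[OF assms] kernel_le_1[OF assms])

lemma clique_wt_bounds:
  assumes "edge_kernel f"
  shows "0 \<le> clique_wt f l" "clique_wt f l \<le> 1"
  by (induction l) (auto intro!: mult_nonneg_nonneg mult_le_one simp: common_bounds[OF assms])

lemma listset_Cons_image: "listset (A # As) = (\<lambda>(u, l). u # l) ` (A \<times> listset As)"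
  by (auto simp: set_Cons_def)

lemma finite_listset: "(\<And>A. A \<in> set As \<Longrightarrow> finite A) \<Longrightarrow> finite (listset As)"
  by (induction As) (simp_all add: listset_Cons_image del: listset.simps(2))

lemma sum_listset_Cons:
  "(\<Sum>l\<in>listset (A # As). g l) = (\<Sum>u\<in>A. \<Sum>l\<in>listset As. g (u # l))"
proof -
  have "inj_on (\<lambda>(u, l). u # l) (A \<times> listset As)" by (auto simp: inj_on_def)
  then show ?thesis
    unfolding listset_Cons_image by (simp add: sum.reindex sum.cartesian_product case_prod_unfold)
qed

lemma card_listset: "real (card (listset As)) = (\<Prod>A\<leftarrow>As. real (card A))"
proof (induction As)
  case (Cons A As)
  have "real (card (listset (A # As))) = (\<Sum>l\<in>listset (A # As). 1)" by simp
  also have "\<dots> = real (card A) * real (card (listset As))"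
    unfolding sum_listset_Cons by simp
  finally show ?case using Cons by simp
qed simp

lemma card_tuples: "real (card (listset (replicate m V))) = real (card V) ^ m"
  unfolding card_listset by (induction m) auto

lemma finite_tuples: "finite V \<Longrightarrow> finite (listset (replicate m V))"
  by (rule finite_listset) auto

lemma sum_le_card:
  fixes g :: "'b \<Rightarrow> real"
  assumes "\<And>x. x \<in> A \<Longrightarrow> g x \<le> C"
  shows "sum g A \<le> C * real (card A)"
  using sum_bounded_above[of A g C] assms by (simp add: mult.commute)

text \<open>A linear functional of the weights is largest at an indicator function, so regularity
  against subsets gives regularity against weights.\<close>

lemma weighted_sum_abs_le:
  fixes g :: "'b \<Rightarrow> 'c \<Rightarrow> real"
  assumes fin: "finite S"
    and sub: "\<And>S'. S' \<subseteq> S \<Longrightarrow> (\<Sum>y\<in>V. \<bar>\<Sum>u\<in>S'. g u y\<bar>) \<le> C"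
    and w: "\<And>u. u \<in> S \<Longrightarrow> 0 \<le> w u" "\<And>u. u \<in> S \<Longrightarrow> w u \<le> 1"
  shows "(\<Sum>y\<in>V. \<bar>\<Sum>u\<in>S. w u * g u y\<bar>) \<le> C"
proof -
  define s where "s y = sgn (\<Sum>u\<in>S. w u * g u y)" for y
  define a where "a u = (\<Sum>y\<in>V. s y * g u y)" for u
  define S' where "S' = {u \<in> S. a u > 0}"
  have s: "\<bar>s y\<bar> \<le> 1" for y by (simp add: s_def abs_sgn_eq)
  have "(\<Sum>y\<in>V. \<bar>\<Sum>u\<in>S. w u * g u y\<bar>) = (\<Sum>y\<in>V. \<Sum>u\<in>S. w u * (s y * g u y))"
    unfolding s_def abs_sgn by (intro sum.cong refl) (simp add: sum_distrib_right mult_ac)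
  also have "\<dots> = (\<Sum>u\<in>S. w u * a u)"
    unfolding a_def by (subst sum.swap) (simp add: sum_distrib_left)
  also have "\<dots> \<le> (\<Sum>u\<in>S. if a u > 0 then a u else 0)"
  proof (rule sum_mono)
    fix u assume "u \<in> S"
    then show "w u * a u \<le> (if a u > 0 then a u else 0)"
      using w[of u] mult_right_mono[of "w u" 1 "a u"] mult_nonneg_nonpos[of "w u" "a u"] by auto
  qed
  also have "\<dots> = (\<Sum>u\<in>S'. a u)"
    unfolding S'_def using fin by (simp add: sum.inter_filter)
  also have "\<dots> = (\<Sum>y\<in>V. s y * (\<Sum>u\<in>S'. g u y))"
    unfolding a_def by (subst sum.swap) (simp add: sum_distrib_left)
  also have "\<dots> \<le> (\<Sum>y\<in>V. \<bar>\<Sum>u\<in>S'. g u y\<bar>)"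
  proof (rule sum_mono)
    fix y
    have "s y * (\<Sum>u\<in>S'. g u y) \<le> \<bar>s y\<bar> * \<bar>\<Sum>u\<in>S'. g u y\<bar>"
      by (metis abs_ge_self abs_mult)
    also have "\<dots> \<le> 1 * \<bar>\<Sum>u\<in>S'. g u y\<bar>" by (intro mult_right_mono s) auto
    finally show "s y * (\<Sum>u\<in>S'. g u y) \<le> \<bar>\<Sum>u\<in>S'. g u y\<bar>" by simp
  qed
  also have "\<dots> \<le> C" by (rule sub) (auto simp: S'_def)
  finally show ?thesis .
qed

section \<open>Counting over regular sets, and their existence\<close>

lemma dens_bounds:
  assumes "edge_kernel f"
  shows "0 \<le> dens f S y" "dens f S y \<le> 1"
proof -
  show "0 \<le> dens f S y" by (simp add: dens_def sum_nonneg kernel_nonneg[OF assms])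
  have "(\<Sum>u\<in>S. f u y) \<le> 1 * real (card S)" by (rule sum_le_card) (simp add: kernel_le_1[OF assms])
  then show "dens f S y \<le> 1" by (auto simp: dens_def divide_le_eq)
qed

lemma dens_mult_card: "finite S \<Longrightarrow> dens f S y * card S = (\<Sum>u\<in>S. f u y)"
  by (cases "S = {}") (auto simp: dens_def)

lemma dens_co: "finite S \<Longrightarrow> S \<noteq> {} \<Longrightarrow> dens (co_kernel f) S y = 1 - dens f S y"
  by (simp add: dens_def sum_subtractf field_simps)

lemma regular_set_co:
  assumes "finite V" "regular_set V f d S"
  shows "regular_set V (co_kernel f) d S"
proof -
  have S: "finite S" "S \<noteq> {}" using assms finite_subset by (auto simp: regular_set_def)
  have eq: "\<bar>\<Sum>u\<in>S'. co_kernel f u y - dens (co_kernel f) S y\<bar> = \<bar>\<Sum>u\<in>S'. f u y - dens f S y\<bar>" for S' y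
  proof -
    have "(\<Sum>u\<in>S'. co_kernel f u y - dens (co_kernel f) S y) = - (\<Sum>u\<in>S'. f u y - dens f S y)"
      unfolding dens_co[OF S] sum_negf[symmetric] by simp
    then show ?thesis by simp
  qed
  show ?thesis using assms(2) unfolding regular_set_def eq by blast
qed

text \<open>Telescoping, one vertex at a time. For a fixed tail \<open>l\<close>,
  \<open>w (u # l)\<close> is a weight on \<open>P\<close>, so regularity of \<open>P\<close>
  replaces \<open>f u y\<close> by the density at the cost of a factor \<open>common f l y\<close>
  in the unit interval; for a fixed head the induction hypothesis treats the tail. No structure of
  \<open>w\<close> enters, so it may be the clique indicator.\<close>

lemma regular_set_tuples:
  fixes w :: "'a list \<Rightarrow> real" and d :: real
  assumes fin: "finite V" and f: "edge_kernel f"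
    and Ps: "\<And>P. P \<in> set Ps \<Longrightarrow> regular_set V f d P"
    and w: "\<And>l. 0 \<le> w l \<and> w l \<le> 1"
  shows "(\<Sum>y\<in>V. \<bar>\<Sum>l\<in>listset Ps. w l * (common f l y - (\<Prod>P\<leftarrow>Ps. dens f P y))\<bar>)
    \<le> length Ps * d * card V * (\<Prod>P\<leftarrow>Ps. real (card P))"
  using Ps w
proof (induction Ps arbitrary: w)
  case (Cons P Ps)
  define D where "D y = (\<Prod>P\<leftarrow>Ps. dens f P y)" for y
  have reg: "regular_set V f d P" using Cons.prems by simp
  then have finP: "finite P" using fin finite_subset by (auto simp: regular_set_def)
  have finL: "finite (listset Ps)"
    by (rule finite_listset) (meson Cons.prems(1) fin finite_subset list.set_intros(2) regular_set_def)
  let ?L = "listset Ps"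
  have A: "(\<Sum>y\<in>V. \<bar>\<Sum>u\<in>P. w (u # l) * (f u y - dens f P y)\<bar>) \<le> d * card P * card V" for l
    using reg Cons.prems(2) by (intro weighted_sum_abs_le finP) (auto simp: regular_set_def)
  have IH: "(\<Sum>y\<in>V. \<bar>\<Sum>l\<in>?L. w (u # l) * (common f l y - D y)\<bar>)
      \<le> length Ps * d * card V * (\<Prod>P\<leftarrow>Ps. real (card P))" for u
    unfolding D_def using Cons.prems by (intro Cons.IH) auto
  have split: "\<bar>\<Sum>l\<in>listset (P # Ps). w l * (common f l y - (\<Prod>P\<leftarrow>P # Ps. dens f P y))\<bar>
     \<le> (\<Sum>l\<in>?L. \<bar>\<Sum>u\<in>P. w (u # l) * (f u y - dens f P y)\<bar>)
       + (\<Sum>u\<in>P. \<bar>\<Sum>l\<in>?L. w (u # l) * (common f l y - D y)\<bar>)" for y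
  proof -
    have "(\<Sum>l\<in>listset (P # Ps). w l * (common f l y - (\<Prod>P\<leftarrow>P # Ps. dens f P y)))
       = (\<Sum>u\<in>P. \<Sum>l\<in>?L. w (u # l) * (f u y * common f l y - dens f P y * D y))"
      unfolding sum_listset_Cons D_def by simp
    also have "\<dots> = (\<Sum>u\<in>P. \<Sum>l\<in>?L. common f l y * (w (u # l) * (f u y - dens f P y)))
        + (\<Sum>u\<in>P. \<Sum>l\<in>?L. dens f P y * (w (u # l) * (common f l y - D y)))"
      unfolding sum.distrib[symmetric] by (intro sum.cong refl) (simp add: algebra_simps)
    also have "\<dots> = (\<Sum>l\<in>?L. common f l y * (\<Sum>u\<in>P. w (u # l) * (f u y - dens f P y)))
        + dens f P y * (\<Sum>u\<in>P. \<Sum>l\<in>?L. w (u # l) * (common f l y - D y))"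
      by (subst sum.swap) (simp add: sum_distrib_left)
    finally have eq: "(\<Sum>l\<in>listset (P # Ps). w l * (common f l y - (\<Prod>P\<leftarrow>P # Ps. dens f P y))) = \<dots>" .
    have "\<bar>\<Sum>l\<in>?L. common f l y * (\<Sum>u\<in>P. w (u # l) * (f u y - dens f P y))\<bar>
        \<le> (\<Sum>l\<in>?L. \<bar>\<Sum>u\<in>P. w (u # l) * (f u y - dens f P y)\<bar>)"
      using common_bounds[OF f]
      by (intro order_trans[OF sum_abs] sum_mono) (auto simp: abs_mult intro!: mult_left_le_one_le)
    moreover have "\<bar>dens f P y * (\<Sum>u\<in>P. \<Sum>l\<in>?L. w (u # l) * (common f l y - D y))\<bar>
        \<le> (\<Sum>u\<in>P. \<bar>\<Sum>l\<in>?L. w (u # l) * (common f l y - D y)\<bar>)"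
    proof -
      have "\<bar>dens f P y * (\<Sum>u\<in>P. \<Sum>l\<in>?L. w (u # l) * (common f l y - D y))\<bar>
          \<le> \<bar>\<Sum>u\<in>P. \<Sum>l\<in>?L. w (u # l) * (common f l y - D y)\<bar>"
        using dens_bounds[OF f] by (auto simp: abs_mult intro!: mult_left_le_one_le)
      also have "\<dots> \<le> (\<Sum>u\<in>P. \<bar>\<Sum>l\<in>?L. w (u # l) * (common f l y - D y)\<bar>)" by (rule sum_abs)
      finally show ?thesis .
    qed
    ultimately show ?thesis unfolding eq by linarith
  qed
  have "(\<Sum>y\<in>V. \<bar>\<Sum>l\<in>listset (P # Ps). w l * (common f l y - (\<Prod>P\<leftarrow>P # Ps. dens f P y))\<bar>)
     \<le> (\<Sum>y\<in>V. \<Sum>l\<in>?L. \<bar>\<Sum>u\<in>P. w (u # l) * (f u y - dens f P y)\<bar>)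
       + (\<Sum>y\<in>V. \<Sum>u\<in>P. \<bar>\<Sum>l\<in>?L. w (u # l) * (common f l y - D y)\<bar>)"
    unfolding sum.distrib[symmetric] by (intro sum_mono split)
  also have "\<dots> = (\<Sum>l\<in>?L. \<Sum>y\<in>V. \<bar>\<Sum>u\<in>P. w (u # l) * (f u y - dens f P y)\<bar>)
       + (\<Sum>u\<in>P. \<Sum>y\<in>V. \<bar>\<Sum>l\<in>?L. w (u # l) * (common f l y - D y)\<bar>)"
    by (intro arg_cong2[where f = "(+)"] sum.swap)
  also have "\<dots> \<le> (d * card P * card V) * card ?L
      + (length Ps * d * card V * (\<Prod>P\<leftarrow>Ps. real (card P))) * card P"
    by (intro add_mono sum_le_card A IH)
  also have "\<dots> = length (P # Ps) * d * card V * (\<Prod>P\<leftarrow>P # Ps. real (card P))"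
    unfolding card_listset by (simp add: algebra_simps)
  finally show ?case .
qed simp

text \<open>An irregular \<open>S\<close> is cut into a witness \<open>A\<close> and its complement
  \<open>B\<close>. The size-weighted mean of their energies exceeds that of \<open>S\<close>, so
  one part gains; only this part is kept, and no partition is ever refined.\<close>

lemma energy_increment:
  fixes d :: real
  assumes fin: "finite V" and S: "S \<subseteq> V" "S \<noteq> {}" and f: "edge_kernel f" and d: "0 < d"
    and irr: "\<not> regular_set V f d S"
  obtains T where "T \<subseteq> S" "T \<noteq> {}" "card T \<ge> d * card S"
    "(\<Sum>y\<in>V. (dens f T y)\<^sup>2) \<ge> (\<Sum>y\<in>V. (dens f S y)\<^sup>2) + d\<^sup>2 * card V"
proof -
  have finS: "finite S" using fin S finite_subset by auto
  obtain A where A: "A \<subseteq> S" "(\<Sum>y\<in>V. \<bar>\<Sum>u\<in>A. f u y - dens f S y\<bar>) > d * card S * card V"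
    using irr S unfolding regular_set_def by (auto simp: not_le)
  define B where "B = S - A"
  have finA: "finite A" and finB: "finite B" using A finS finite_subset by (auto simp: B_def)
  define D where "D y = (\<Sum>u\<in>A. f u y - dens f S y)" for y
  have SAB: "(\<Sum>u\<in>S. g u) = (\<Sum>u\<in>A. g u) + (\<Sum>u\<in>B. g u)" for g :: "'a \<Rightarrow> real"
    unfolding B_def using sum.subset_diff[OF A(1) finS, of g] by simp
  have DB: "(\<Sum>u\<in>B. f u y - dens f S y) = - D y" for y
  proof -
    have "(\<Sum>u\<in>S. f u y - dens f S y) = 0"
      using dens_mult_card[OF finS, of f y] by (simp add: sum_subtractf mult.commute)
    then show ?thesis unfolding D_def SAB by linarith
  qed
  have V0: "card V > 0" using S fin by (metis card_gt_0_iff subset_empty)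
  have dev: "\<bar>f u y - dens f S y\<bar> \<le> 1" for u y
    using kernel_nonneg[OF f, of u y] kernel_le_1[OF f, of u y] dens_bounds[OF f, of S y] by linarith
  have Dle: "\<bar>D y\<bar> \<le> real (card A)" "\<bar>D y\<bar> \<le> real (card B)" for y
  proof -
    have "\<bar>D y\<bar> \<le> 1 * real (card A)"
      unfolding D_def by (intro order_trans[OF sum_abs] sum_le_card dev)
    then show "\<bar>D y\<bar> \<le> real (card A)" by simp
    have "\<bar>\<Sum>u\<in>B. f u y - dens f S y\<bar> \<le> 1 * real (card B)"
      by (intro order_trans[OF sum_abs] sum_le_card dev)
    then show "\<bar>D y\<bar> \<le> real (card B)" unfolding DB by simp
  qed
  have Dsum: "d * card S * card V < (\<Sum>y\<in>V. \<bar>D y\<bar>)" using A(2) by (simp add: D_def)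
  \<comment> \<open>The deviations over \<open>A\<close> and \<open>B\<close> cancel, so
    \<open>\<bar>D y\<bar>\<close> is at most the size of either part. Irregularity then makes both
    parts proportional to \<open>S\<close>, whichever of them gains.\<close>
  have card_gt: "d * card S < real (card X)" if "\<And>y. \<bar>D y\<bar> \<le> real (card X)" for X :: "'a set"
  proof -
    have "(\<Sum>y\<in>V. \<bar>D y\<bar>) \<le> card X * real (card V)" by (rule sum_le_card) (rule that)
    then have "(d * card S) * card V < card X * real (card V)" using Dsum by linarith
    then show ?thesis using V0 by simp
  qed
  have cA: "d * card S < card A" and cB: "d * card S < card B" by (intro card_gt Dle)+
  have S0: "card S > 0" using S finS by (simp add: card_gt_0_iff)
  then have "0 < d * card S" using d by simp
  then have A0: "card A > 0" "card B > 0" using cA cB by linarith+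
  have dA: "dens f A y = dens f S y + D y / card A" for y
    using A0 by (simp add: D_def dens_def[of f A] sum_subtractf field_simps)
  have dB: "dens f B y = dens f S y - D y / card B" for y
  proof -
    have "D y = - (\<Sum>u\<in>B. f u y - dens f S y)" using DB by simp
    then show ?thesis using A0 by (simp add: dens_def[of f B] sum_subtractf field_simps)
  qed
  have cS: "real (card S) = card A + card B" using SAB[of "\<lambda>_. 1"] by simp
  define E where "E T = (\<Sum>y\<in>V. (dens f T y)\<^sup>2)" for T
  have "(\<Sum>y\<in>V. \<bar>D y\<bar>)\<^sup>2 \<le> (\<Sum>y\<in>V. (D y)\<^sup>2) * card V"
    using sum_squared_le_sum_of_squares[of "\<lambda>y. \<bar>D y\<bar>" V] by simp
  moreover have "(d * card S * card V)\<^sup>2 \<le> (\<Sum>y\<in>V. \<bar>D y\<bar>)\<^sup>2"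
    using Dsum d by (intro power_mono) auto
  ultimately have "((d * card S)\<^sup>2 * card V) * card V \<le> (\<Sum>y\<in>V. (D y)\<^sup>2) * card V"
    by (simp add: power2_eq_square mult_ac)
  then have D2: "(d * card S)\<^sup>2 * card V \<le> (\<Sum>y\<in>V. (D y)\<^sup>2)" using V0 by simp
  \<comment> \<open>The variance identity of the split. The gain is at least
    \<open>(D y)\<^sup>2 / card S\<close>, and Cauchy-Schwarz has bounded the sum of the squares
    from below.\<close>
  have pt: "card A * (dens f A y)\<^sup>2 + card B * (dens f B y)\<^sup>2
     = card S * (dens f S y)\<^sup>2 + (D y)\<^sup>2 * (1 / card A + 1 / card B)" for y
    unfolding dA dB cS using A0 by (simp add: power2_eq_square field_simps)
  have "card A * E A + card B * E B = card S * E S + (\<Sum>y\<in>V. (D y)\<^sup>2) * (1 / card A + 1 / card B)"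
    unfolding E_def sum_distrib_left sum_distrib_right sum.distrib[symmetric] pt ..
  moreover have "(\<Sum>y\<in>V. (D y)\<^sup>2) * (1 / card A + 1 / card B) \<ge> d\<^sup>2 * card V * card S"
  proof -
    have "1 / real (card S) \<le> 1 / card A"
      using A0 cS by (intro divide_left_mono) auto
    then have "1 / real (card S) \<le> 1 / card A + 1 / card B"
      using add_increasing2[of "1 / real (card B)"] by simp
    then have "((d * card S)\<^sup>2 * card V) * (1 / card S) \<le> (\<Sum>y\<in>V. (D y)\<^sup>2) * (1 / card A + 1 / card B)"
      by (intro mult_mono D2) (auto intro: sum_nonneg)
    then show ?thesis using S0 by (simp add: power2_eq_square mult_ac)
  qed
  ultimately have key: "card A * E A + card B * E B \<ge> (card A + card B) * (E S + d\<^sup>2 * card V)"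
    unfolding cS[symmetric] by (simp add: algebra_simps)
  have "E A \<ge> E S + d\<^sup>2 * card V \<or> E B \<ge> E S + d\<^sup>2 * card V"
  proof (rule ccontr)
    assume "\<not> ?thesis"
    then have "card A * E A < card A * (E S + d\<^sup>2 * card V)" "card B * E B < card B * (E S + d\<^sup>2 * card V)"
      using A0 by auto
    then show False using key by (simp add: algebra_simps)
  qed
  then show ?thesis
  proof
    assume "E A \<ge> E S + d\<^sup>2 * card V"
    moreover have "A \<noteq> {}" using A0 by auto
    ultimately show ?thesis using A(1) cA by (intro that[of A]) (simp_all add: E_def)
  next
    assume "E B \<ge> E S + d\<^sup>2 * card V"
    moreover have "B \<noteq> {}" using A0 by auto
    moreover have "B \<subseteq> S" by (auto simp: B_def)
    ultimately show ?thesis using cB by (intro that[of B]) (simp_all add: E_def)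
  qed
qed

text \<open>Each increment costs a factor \<open>d\<close> in size and adds
  \<open>d\<^sup>2 * card V\<close> to an energy that is at most \<open>card V\<close>. So fewer
  than \<open>n\<close> of them can occur for \<open>n * d\<^sup>2 > 1\<close>, and
  \<open>\<eta> = d ^ n\<close> depends on \<open>d\<close> alone.\<close>

lemma regular_subset:
  fixes d :: real
  assumes d: "0 < d" "d \<le> 1"
  obtains \<eta> :: real where "0 < \<eta>"
    "\<And>(V :: 'a set) (f :: 'a \<Rightarrow> 'a \<Rightarrow> real) T. finite V \<Longrightarrow> edge_kernel f \<Longrightarrow> T \<subseteq> V \<Longrightarrow> T \<noteq> {} \<Longrightarrow>
      \<exists>S\<subseteq>T. regular_set V f d S \<and> card S \<ge> \<eta> * card T"
proof -
  obtain n :: nat where n: "1 < n * d\<^sup>2"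
    using reals_Archimedean3[of "d\<^sup>2"] d by auto
  \<comment> \<open>\<open>m\<close> counts the increments still possible; for \<open>m = 0\<close>
    the assumed energy would exceed its maximum.\<close>
  have main: "\<exists>S\<subseteq>T. regular_set V f d S \<and> card S \<ge> d ^ m * card T"
    if V: "finite V" "edge_kernel f" and T: "T \<subseteq> V" "T \<noteq> {}"
      and en: "(\<Sum>y\<in>V. (dens f T y)\<^sup>2) > card V - m * d\<^sup>2 * card V" for V :: "'a set" and f :: "'a \<Rightarrow> 'a \<Rightarrow> real" and T m
    using T en
  proof (induction m arbitrary: T)
    case 0
    have "(\<Sum>y\<in>V. (dens f T y)\<^sup>2) \<le> 1 * real (card V)"
      using dens_bounds[OF V(2)] by (intro sum_le_card) (simp add: power_le_one)
    with 0 show ?case by simp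
  next
    case (Suc m)
    show ?case
    proof (cases "regular_set V f d T")
      case True
      have "d ^ Suc m * card T \<le> 1 * real (card T)"
        using d by (intro mult_right_mono power_le_one) auto
      with True show ?thesis by (intro exI[of _ T]) auto
    next
      case False
      obtain T' where T': "T' \<subseteq> T" "T' \<noteq> {}" "card T' \<ge> d * card T"
        "(\<Sum>y\<in>V. (dens f T' y)\<^sup>2) \<ge> (\<Sum>y\<in>V. (dens f T y)\<^sup>2) + d\<^sup>2 * card V"
        using energy_increment[OF V(1) Suc.prems(1,2) V(2) d(1) False] by blast
      have "\<exists>S\<subseteq>T'. regular_set V f d S \<and> card S \<ge> d ^ m * card T'"
        using T' Suc.prems by (intro Suc.IH) (auto simp: algebra_simps)
      then obtain S where S: "S \<subseteq> T'" "regular_set V f d S" "card S \<ge> d ^ m * card T'" by blast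
      have "d ^ Suc m * card T = d ^ m * (d * card T)" by simp
      also have "\<dots> \<le> d ^ m * card T'" using T'(3) d by (intro mult_left_mono) auto
      finally show ?thesis using S T'(1) by (intro exI[of _ S]) auto
    qed
  qed
  show ?thesis
  proof (rule that[of "d ^ n"])
    fix V :: "'a set" and f :: "'a \<Rightarrow> 'a \<Rightarrow> real" and T
    assume *: "finite V" "edge_kernel f" "T \<subseteq> V" "T \<noteq> {}"
    then have V0: "card V > 0" by (metis card_gt_0_iff subset_empty)
    have "real (card V) < n * d\<^sup>2 * card V" using n V0 by simp
    moreover have "0 \<le> (\<Sum>y\<in>V. (dens f T y)\<^sup>2)" by (intro sum_nonneg) auto
    ultimately show "\<exists>S\<subseteq>T. regular_set V f d S \<and> card S \<ge> d ^ n * card T"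
      using * by (intro main) linarith+
  qed (use d in auto)
qed

text \<open>Greedy removal: a set with \<open>G\<close> is split off as long as more than
  \<open>t\<close> vertices remain.\<close>

lemma exhaust_by_disjoint:
  assumes fin: "finite V"
    and ex: "\<And>T. T \<subseteq> V \<Longrightarrow> t < real (card T) \<Longrightarrow> \<exists>S\<subseteq>T. S \<noteq> {} \<and> G S"
  obtains F where "finite F" "pairwise disjnt F" "\<And>S. S \<in> F \<Longrightarrow> S \<subseteq> V \<and> G S"
    "real (card (V - \<Union>F)) \<le> t"
proof -
  have "\<exists>F. finite F \<and> pairwise disjnt F \<and> (\<forall>S\<in>F. S \<subseteq> T \<and> G S) \<and> real (card (T - \<Union>F)) \<le> t"
    if "T \<subseteq> V" for T
    using finite_subset[OF that fin] that
  proof (induction T rule: finite_psubset_induct)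
    case (psubset T)
    show ?case
    proof (cases "real (card T) \<le> t")
      case True
      then show ?thesis by (intro exI[of _ "{}::'a set set"] conjI) simp_all
    next
      case False
      then have "t < real (card T)" by simp
      from ex[OF psubset.prems this] obtain S where S: "S \<subseteq> T" "S \<noteq> {}" "G S" by blast
      have TS: "T - S \<subset> T" "T - S \<subseteq> V" using S psubset.prems by blast+
      from psubset.IH[OF TS] obtain F where F: "finite F" "pairwise disjnt F" "\<forall>R\<in>F. R \<subseteq> T - S \<and> G R"
        "real (card (T - S - \<Union>F)) \<le> t" by blast
      have "T - S - \<Union>F = T - \<Union>(insert S F)" by auto
      then have "real (card (T - \<Union>(insert S F))) \<le> t" using F(4) by simp
      moreover have "pairwise disjnt (insert S F)"
        using F(2,3) unfolding pairwise_insert disjnt_def by blast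
      moreover have "\<forall>R\<in>insert S F. R \<subseteq> T \<and> G R" using F(3) S by blast
      moreover have "finite (insert S F)" using F(1) by simp
      ultimately show ?thesis by (intro exI[of _ "insert S F"] conjI)
    qed
  qed
  from this[OF subset_refl] show ?thesis using that by (elim exE conjE) auto
qed

text \<open>Supersaturated form of the Erdos-Szekeres recursion. The kernel may have loops, so neighbourhoods
  need not be shrunk by the vertex itself and no lower bound on \<open>card S\<close> is required.\<close>

lemma clique_supersaturation:
  obtains \<mu> :: real where "0 < \<mu>"
    "\<And>(S :: 'a set) (f :: 'a \<Rightarrow> 'a \<Rightarrow> real). finite S \<Longrightarrow> edge_kernel f \<Longrightarrow>
      (\<Sum>l\<in>listset (replicate a S). clique_wt f l) \<ge> \<mu> * real (card S) ^ a
      \<or> (\<Sum>l\<in>listset (replicate b S). clique_wt (co_kernel f) l) \<ge> \<mu> * real (card S) ^ b"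
proof -
  define W where "W g m S = (\<Sum>l\<in>listset (replicate m S). clique_wt g l)"
    for g :: "'a \<Rightarrow> 'a \<Rightarrow> real" and m S
  have W_mono: "W g m T \<le> W g m S" if "edge_kernel g" "finite S" "T \<subseteq> S" for g m T and S :: "'a set"
  proof -
    have "listset (replicate m T) \<subseteq> listset (replicate m S)"
      by (induction m) (use that in \<open>auto simp: set_Cons_def\<close>)
    then show ?thesis unfolding W_def
      using that by (intro sum_mono2 finite_tuples) (auto simp: clique_wt_bounds)
  qed
  have W_step: "W g (Suc m) S \<ge> (\<Sum>v\<in>X. W g m {u \<in> S. g u v = 1})"
    if "edge_kernel g" "finite S" "X \<subseteq> S" for g m X and S :: "'a set"
  proof -
    have common1: "common g l v = 1" if "l \<in> listset (replicate m {u \<in> S. g u v = 1})" for l v m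
      using that by (induction m arbitrary: l) (auto simp: set_Cons_def)
    have sub: "listset (replicate m {u \<in> S. g u v = 1}) \<subseteq> listset (replicate m S)" for v
      by (induction m) (auto simp: set_Cons_def)
    have "W g m {u \<in> S. g u v = 1} \<le> (\<Sum>l\<in>listset (replicate m S). common g l v * clique_wt g l)" for v
    proof -
      have "W g m {u \<in> S. g u v = 1}
          = (\<Sum>l\<in>listset (replicate m {u \<in> S. g u v = 1}). common g l v * clique_wt g l)"
        unfolding W_def by (intro sum.cong refl) (simp add: common1)
      also have "\<dots> \<le> (\<Sum>l\<in>listset (replicate m S). common g l v * clique_wt g l)"
        using \<open>edge_kernel g\<close> \<open>finite S\<close> sub by (intro sum_mono2 finite_tuples) (auto simp: common_bounds clique_wt_bounds)
      finally show ?thesis .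
    qed
    then have "(\<Sum>v\<in>X. W g m {u \<in> S. g u v = 1})
        \<le> (\<Sum>v\<in>X. \<Sum>l\<in>listset (replicate m S). common g l v * clique_wt g l)"
      by (intro sum_mono)
    also have "\<dots> \<le> (\<Sum>v\<in>S. \<Sum>l\<in>listset (replicate m S). common g l v * clique_wt g l)"
      using that by (intro sum_mono2) (auto intro!: sum_nonneg simp: common_bounds clique_wt_bounds)
    also have "\<dots> = W g (Suc m) S"
      unfolding W_def replicate_Suc sum_listset_Cons by simp
    finally show ?thesis .
  qed
  have "\<exists>\<mu>::real. \<mu> > 0 \<and> \<mu> \<le> 1 \<and> (\<forall>(S :: 'a set) (f :: 'a \<Rightarrow> 'a \<Rightarrow> real). finite S \<longrightarrow> edge_kernel f \<longrightarrow>
      W f a S \<ge> \<mu> * real (card S) ^ a \<or> W (co_kernel f) b S \<ge> \<mu> * real (card S) ^ b)" for a b :: nat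
  proof (induction "a + b" arbitrary: a b)
    case 0
    then show ?case by (intro exI[of _ 1]) (auto simp: W_def)
  next
    case (Suc n)
    show ?case
    proof (cases "a = 0 \<or> b = 0")
      case True
      then show ?thesis by (intro exI[of _ 1]) (auto simp: W_def)
    next
      case False
      then obtain a' b' where ab: "a = Suc a'" "b = Suc b'" by (meson not0_implies_Suc)
      obtain \<mu>1 :: real where \<mu>1: "\<mu>1 > 0" "\<mu>1 \<le> 1" "\<And>(S :: 'a set) (f :: 'a \<Rightarrow> 'a \<Rightarrow> real). finite S \<Longrightarrow> edge_kernel f \<Longrightarrow>
          W f a' S \<ge> \<mu>1 * real (card S) ^ a' \<or> W (co_kernel f) b S \<ge> \<mu>1 * real (card S) ^ b"
        using Suc.hyps(1)[of a' b] Suc.hyps(2) ab by auto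
      obtain \<mu>2 :: real where \<mu>2: "\<mu>2 > 0" "\<mu>2 \<le> 1" "\<And>(S :: 'a set) (f :: 'a \<Rightarrow> 'a \<Rightarrow> real). finite S \<Longrightarrow> edge_kernel f \<Longrightarrow>
          W f a S \<ge> \<mu>2 * real (card S) ^ a \<or> W (co_kernel f) b' S \<ge> \<mu>2 * real (card S) ^ b'"
        using Suc.hyps(1)[of a b'] Suc.hyps(2) ab by auto
      \<comment> \<open>Passing to a majority neighbourhood halves the vertex set, which costs at
        most \<open>2 ^ (a + b)\<close> in a count of cliques with at most \<open>a + b\<close>
        vertices. The smaller of the two constants serves both branches.\<close>
      define \<mu> where "\<mu> = min \<mu>1 \<mu>2 / 2 ^ (a + b)"
      have \<mu>le: "\<mu> \<le> \<mu>1 / 2 ^ m" "\<mu> \<le> \<mu>2 / 2 ^ m" if "m \<le> a + b" for m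
        unfolding \<mu>_def using that \<mu>1 \<mu>2 by (auto intro!: frac_le)
      have half: "W g (Suc m) S \<ge> \<mu> * real (card S) ^ Suc m"
        if g: "edge_kernel g" "finite S" and X: "X \<subseteq> S" "2 * card X \<ge> card S"
          and m: "Suc m \<le> a + b" and \<nu>: "\<mu> \<le> \<nu> / 2 ^ Suc m"
          and W: "\<And>v. v \<in> X \<Longrightarrow> W g m {u \<in> S. g u v = 1} \<ge> \<nu> * (card S / 2) ^ m"
        for g m X and \<nu> :: real and S :: "'a set"
      proof -
        have "\<mu> * real (card S) ^ Suc m \<le> \<nu> / 2 ^ Suc m * real (card S) ^ Suc m"
          by (intro mult_right_mono \<nu>) auto
        also have "\<dots> = (card S / 2) * (\<nu> * (card S / 2) ^ m)"
          by (simp add: power_divide)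
        also have "\<dots> \<le> card X * (\<nu> * (card S / 2) ^ m)"
        proof (rule mult_right_mono)
          have "0 < \<mu>" unfolding \<mu>_def using \<mu>1 \<mu>2 by simp
          with \<nu> have "0 < \<nu> / 2 ^ Suc m" by linarith
          then have "0 < \<nu>" by (simp add: zero_less_divide_iff)
          then show "0 \<le> \<nu> * (card S / 2) ^ m" by simp
        qed (use X in simp)
        also have "\<dots> \<le> (\<Sum>v\<in>X. W g m {u \<in> S. g u v = 1})"
          using W by (intro sum_bounded_below)
        also have "\<dots> \<le> W g (Suc m) S" by (rule W_step[OF g X(1)])
        finally show ?thesis .
      qed
      have "W f a S \<ge> \<mu> * real (card S) ^ a \<or> W (co_kernel f) b S \<ge> \<mu> * real (card S) ^ b"
        if S: "finite S" "edge_kernel f" for S :: "'a set" and f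
      proof (rule ccontr)
        assume contra: "\<not> ?thesis"
        define X where "X = {v \<in> S. 2 * card {u \<in> S. f u v = 1} \<ge> card S}"
        define Y where "Y = {v \<in> S. 2 * card {u \<in> S. co_kernel f u v = 1} \<ge> card S}"
        have co: "edge_kernel (co_kernel f)" by (rule kernel_co[OF S(2)])
        \<comment> \<open>Every vertex has a majority color towards \<open>S\<close>, so one of the
          two classes contains half of \<open>S\<close>.\<close>
        have "S = X \<union> Y"
        proof -
          have "card S = card {u \<in> S. f u v = 1} + card {u \<in> S. co_kernel f u v = 1}" for v
          proof -
            have eq: "{u \<in> S. f u v = 1} \<union> {u \<in> S. co_kernel f u v = 1} = S"
              using kernel_01[OF S(2)] by auto
            have "card ({u \<in> S. f u v = 1} \<union> {u \<in> S. co_kernel f u v = 1})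
                = card {u \<in> S. f u v = 1} + card {u \<in> S. co_kernel f u v = 1}"
              using S(1) by (intro card_Un_disjoint) auto
            then show ?thesis unfolding eq .
          qed
          note split = this
          have "v \<in> X \<or> v \<in> Y" if "v \<in> S" for v
            unfolding X_def Y_def mem_Collect_eq using split[of v] that by linarith
          then show ?thesis unfolding X_def Y_def by blast
        qed
        then have "card S \<le> card X + card Y" by (metis card_Un_le)
        then consider "2 * card X \<ge> card S" | "2 * card Y \<ge> card S" by linarith
        then show False
        proof cases
          case 1
          have "W f a' {u \<in> S. f u v = 1} \<ge> \<mu>1 * (card S / 2) ^ a'" if "v \<in> X" for v
          proof -
            let ?T = "{u \<in> S. f u v = 1}"
            have T: "card S / 2 \<le> card ?T" using that unfolding X_def by simp
            \<comment> \<open>Enough \<open>b\<close>-cliques of the other kernel inside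
              \<open>?T\<close> would be enough for \<open>S\<close> too, because \<open>?T\<close>
              has at least half its size. The induction hypothesis is thus forced into its first
              alternative.\<close>
            have "\<not> W (co_kernel f) b ?T \<ge> \<mu>1 * real (card ?T) ^ b"
            proof
              assume *: "W (co_kernel f) b ?T \<ge> \<mu>1 * real (card ?T) ^ b"
              have "\<mu> * real (card S) ^ b \<le> \<mu>1 / 2 ^ b * real (card S) ^ b"
                by (intro mult_right_mono \<mu>le) auto
              also have "\<dots> = \<mu>1 * (card S / 2) ^ b" by (simp add: power_divide)
              also have "\<dots> \<le> \<mu>1 * real (card ?T) ^ b"
                using \<mu>1 T power_mono[OF T, of b] by (intro mult_left_mono) auto
              also have "\<dots> \<le> W (co_kernel f) b S"
                using * W_mono[OF co S(1), of ?T b] by auto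
              finally show False using contra by simp
            qed
            then have "\<mu>1 * real (card ?T) ^ a' \<le> W f a' ?T" using \<mu>1(3)[of ?T f] S by auto
            moreover have "\<mu>1 * (card S / 2) ^ a' \<le> \<mu>1 * real (card ?T) ^ a'"
              using \<mu>1 T power_mono[OF T, of a'] by (intro mult_left_mono) auto
            ultimately show ?thesis by linarith
          qed
          then have "W f (Suc a') S \<ge> \<mu> * real (card S) ^ Suc a'"
            using 1 \<mu>le(1)[of "Suc a'"] ab by (intro half[of f S X a' \<mu>1] S) (auto simp: X_def)
          then show False using contra ab by simp
        next
          case 2
          have "W (co_kernel f) b' {u \<in> S. co_kernel f u v = 1} \<ge> \<mu>2 * (card S / 2) ^ b'" if "v \<in> Y" for v
          proof -
            let ?T = "{u \<in> S. co_kernel f u v = 1}"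
            have T: "card S / 2 \<le> card ?T" using that unfolding Y_def by simp
            have "\<not> W f a ?T \<ge> \<mu>2 * real (card ?T) ^ a"
            proof
              assume *: "W f a ?T \<ge> \<mu>2 * real (card ?T) ^ a"
              have "\<mu> * real (card S) ^ a \<le> \<mu>2 / 2 ^ a * real (card S) ^ a"
                by (intro mult_right_mono \<mu>le) auto
              also have "\<dots> = \<mu>2 * (card S / 2) ^ a" by (simp add: power_divide)
              also have "\<dots> \<le> \<mu>2 * real (card ?T) ^ a"
                using \<mu>2 T power_mono[OF T, of a] by (intro mult_left_mono) auto
              also have "\<dots> \<le> W f a S"
                using * W_mono[OF S(2,1), of ?T a] by auto
              finally show False using contra by simp
            qed
            then have "\<mu>2 * real (card ?T) ^ b' \<le> W (co_kernel f) b' ?T" using \<mu>2(3)[of ?T f] S by auto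
            moreover have "\<mu>2 * (card S / 2) ^ b' \<le> \<mu>2 * real (card ?T) ^ b'"
              using \<mu>2 T power_mono[OF T, of b'] by (intro mult_left_mono) auto
            ultimately show ?thesis by linarith
          qed
          then have "W (co_kernel f) (Suc b') S \<ge> \<mu> * real (card S) ^ Suc b'"
            using 2 \<mu>le(2)[of "Suc b'"] ab by (intro half[of "co_kernel f" S Y b' \<mu>2] co S(1)) (auto simp: Y_def)
          then show False using contra ab by simp
        qed
      qed
      moreover have "\<mu> > 0" using \<mu>1(1) \<mu>2(1) by (simp add: \<mu>_def)
      moreover have "\<mu> \<le> 1" using \<mu>1(2) \<mu>le(1)[of 0] by simp
      ultimately show ?thesis by blast
    qed
  qed
  from this[of a b] obtain \<mu> :: real where \<mu>: "\<mu> > 0 \<and> \<mu> \<le> 1 \<and> (\<forall>(S :: 'a set) (f :: 'a \<Rightarrow> 'a \<Rightarrow> real). finite S \<longrightarrow> edge_kernel f \<longrightarrow>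
      W f a S \<ge> \<mu> * real (card S) ^ a \<or> W (co_kernel f) b S \<ge> \<mu> * real (card S) ^ b)" ..
  show ?thesis
  proof (rule that[of \<mu>])
    show "0 < \<mu>" using \<mu> by simp
    show "(\<Sum>l\<in>listset (replicate a S). clique_wt f l) \<ge> \<mu> * real (card S) ^ a
      \<or> (\<Sum>l\<in>listset (replicate b S). clique_wt (co_kernel f) l) \<ge> \<mu> * real (card S) ^ b"
      if "finite S" "edge_kernel f" for S :: "'a set" and f :: "'a \<Rightarrow> 'a \<Rightarrow> real"
      using conjunct2[OF conjunct2[OF \<mu>], rule_format, OF that] unfolding W_def by simp
  qed
qed

subsection \<open>The inequality between power sum and product\<close>

text \<open>The bound on \<open>q\<close> puts it to the left of the maximum of
  \<open>x ^ (k - 1) * (1 - x)\<close>. The 48 comes from the greedy clique step, which needs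
  \<open>q ^ k\<close> and an error of at most \<open>1 / (48 * k)\<close> each; it also lets one
  entry above \<open>1 - 1 / k\<close> dominate the power sum.\<close>

definition large_exponent :: "real \<Rightarrow> nat \<Rightarrow> bool" where
  "large_exponent q k \<longleftrightarrow> 2 \<le> k \<and> q < 1 - 1 / k \<and> 48 * k * q ^ (k - 1) \<le> 1"

text \<open>The share of one entry in \<open>book_sum\<close> after the product has been linearised.
  It vanishes to first order at \<open>q\<close>, falls before \<open>q\<close> and rises from
  \<open>q\<close> to \<open>1 - 1 / k\<close>, whence the name.\<close>

definition well :: "real \<Rightarrow> nat \<Rightarrow> real \<Rightarrow> real" where
  "well q k x = (q / k) * ((x / q) ^ k - 1) + (1 - q) * ln ((1 - x) / (1 - q))"

lemma eventually_large_exponent: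
  assumes "0 < q" "q < 1"
  shows "eventually (large_exponent q) sequentially"
proof -
  have "(\<lambda>n. 1 / real n) \<longlonglongrightarrow> 0" by (rule lim_1_over_n)
  then have "eventually (\<lambda>n. 1 / real n < 1 - q) sequentially"
    using assms by (intro order_tendstoD(2)) auto
  moreover have "eventually (\<lambda>n. (48 / q) * (of_nat n * q ^ n) < 1) sequentially"
  proof -
    have "(\<lambda>n. (48 / q) * (of_nat n * q ^ n)) \<longlonglongrightarrow> (48 / q) * 0"
      by (intro tendsto_intros powser_times_n_limit_0) (use assms in auto)
    then show ?thesis by (intro order_tendstoD(2)) auto
  qed
  moreover have "eventually (\<lambda>n. n \<ge> (2::nat)) sequentially" by (rule eventually_ge_at_top)
  ultimately show ?thesis
  proof eventually_elim
    case (elim k)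
    have "q ^ k = q * q ^ (k - 1)" using elim(3) by (cases k) auto
    with elim assms show ?case by (auto simp: large_exponent_def)
  qed
qed

section \<open>The shape of the one-variable function\<close>

lemma well_deriv:
  assumes "0 < q" "q < 1" "x < 1" "0 < k"
  shows "(well q k has_real_derivative (x / q) ^ (k - 1) - (1 - q) / (1 - x)) (at x)"
proof -
  have "((\<lambda>x. (q / k) * ((x / q) ^ k - 1) + (1 - q) * ln ((1 - x) / (1 - q)))
     has_real_derivative (q / k) * (k * (x / q) ^ (k - 1) * (1 / q))
        + (1 - q) * (1 / ((1 - x) / (1 - q)) * ((- 1) / (1 - q)))) (at x)"
    using assms by (auto intro!: derivative_eq_intros) (metis minus_diff_eq minus_divide_left)
  moreover have "(q / k) * (k * (x / q) ^ (k - 1) * (1 / q))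
        + (1 - q) * (1 / ((1 - x) / (1 - q)) * ((- 1) / (1 - q))) = (x / q) ^ (k - 1) - (1 - q) / (1 - x)"
  proof -
    have "(q / k) * (k * (x / q) ^ (k - 1) * (1 / q)) = (x / q) ^ (k - 1)" using assms by simp
    moreover have "(1 - q) * (1 / ((1 - x) / (1 - q)) * ((- 1) / (1 - q))) = - ((1 - q) / (1 - x))"
      using assms by (simp add: divide_simps)
    ultimately show ?thesis by linarith
  qed
  ultimately show ?thesis unfolding well_def by simp
qed

lemma le_one_minus_inverse_imp_less_1: 
  assumes "x \<le> 1 - 1 / real k" "2 \<le> k"
  shows "x < 1"
proof -
  have "0 < 1 / real k" using assms(2) by simp
  then show ?thesis using assms(1) by linarith
qed

text \<open>The maximum of \<open>x ^ (k - 1) * (1 - x)\<close> lies at \<open>1 - 1 / k\<close>.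
  Strict growth up to there follows without calculus, from Bernoulli's inequality for
  \<open>b / a = 1 + (b - a) / a\<close>.\<close>

lemma power_hump_less:
  fixes a b :: real
  assumes k: "2 \<le> k" and a: "0 \<le> a" "a < b" and b: "b \<le> 1 - 1 / real k"
  shows "a ^ (k - 1) * (1 - a) < b ^ (k - 1) * (1 - b)"
proof -
  have k0: "real k > 0" using k by simp
  have b1: "1 - b > 0" using le_one_minus_inverse_imp_less_1[OF b k] by simp
  show ?thesis
  proof (cases "a = 0")
    case True
    moreover have "0 < b ^ (k - 1) * (1 - b)" using a b1 by simp
    ultimately show ?thesis using k by (simp add: zero_power)
  next
    case False
    with a have a0: "a > 0" by simp
    have "real (k - 1) * (1 - b) \<ge> (real k - 1) * (1 / k)"
      using b k by (intro mult_mono) (auto simp: of_nat_diff)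
    also have "(real k - 1) * (1 / k) = 1 - 1 / k" using k0 by (simp add: field_simps)
    finally have "a < real (k - 1) * (1 - b)" using a b by linarith
    moreover have k1: "real (k - 1) = real k - 1" using k by (simp add: of_nat_diff)
    ultimately have *: "a < (real k - 1) * (1 - b)" by simp
    have "1 - a < (1 + (real k - 1) * ((b - a) / a)) * (1 - b)"
    proof -
      have "a * (b - a) < ((real k - 1) * (1 - b)) * (b - a)" using * a by (intro mult_strict_right_mono) auto
      then have "(b - a) < (real k - 1) * ((b - a) / a) * (1 - b)" using a0 by (simp add: field_simps)
      then show ?thesis by (simp add: algebra_simps)
    qed
    also have "\<dots> \<le> (1 + (b - a) / a) ^ (k - 1) * (1 - b)"
      unfolding k1[symmetric] using a a0 b1
      by (intro mult_right_mono Bernoulli_inequality) (auto simp: field_simps)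
    also have "(1 + (b - a) / a) = b / a" using a0 by (simp add: field_simps)
    finally have "a ^ (k - 1) * (1 - a) < a ^ (k - 1) * ((b / a) ^ (k - 1) * (1 - b))"
      using a0 by (intro mult_strict_left_mono) auto
    then show ?thesis using a0 by (simp add: power_divide)
  qed
qed

text \<open>Clearing denominators turns the sign of the derivative into a comparison of
  \<open>x ^ (k - 1) * (1 - x)\<close> at \<open>x\<close> and at \<open>q\<close>.\<close>

lemma well_slope:
  assumes q: "0 < q" "q \<le> 1 - 1 / real k" and k: "2 \<le> k" and x: "0 \<le> x" "x \<le> 1 - 1 / real k"
  shows "x < q \<Longrightarrow> (x / q) ^ (k - 1) - (1 - q) / (1 - x) < 0"
    and "q < x \<Longrightarrow> (x / q) ^ (k - 1) - (1 - q) / (1 - x) > 0"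
proof -
  have x1: "1 - x > 0" using le_one_minus_inverse_imp_less_1[OF x(2) k] by simp
  show "(x / q) ^ (k - 1) - (1 - q) / (1 - x) < 0" if "x < q"
    using power_hump_less[OF k x(1) that q(2)] x1 q by (simp add: power_divide field_simps)
  show "(x / q) ^ (k - 1) - (1 - q) / (1 - x) > 0" if "q < x"
    using power_hump_less[OF k _ that x(2)] x1 q by (simp add: power_divide field_simps)
qed

lemma well_at: "0 < q \<Longrightarrow> q < 1 \<Longrightarrow> well q k q = 0"
  by (simp add: well_def)

lemma well_strict_antimono:
  assumes q: "0 < q" "q \<le> 1 - 1 / real k" and k: "2 \<le> k" and x: "0 \<le> x" "x < y" "y \<le> q"
  shows "well q k y < well q k x"
proof (rule DERIV_neg_imp_decreasing_open[OF x(2)])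
  have q1: "q < 1" by (rule le_one_minus_inverse_imp_less_1[OF q(2) k])
  show "\<exists>D. (well q k has_real_derivative D) (at t) \<and> D < 0" if "x < t" "t < y" for t
  proof (intro exI conjI)
    show "(well q k has_real_derivative (t / q) ^ (k - 1) - (1 - q) / (1 - t)) (at t)"
      using that x q q1 k by (intro well_deriv) auto
    show "(t / q) ^ (k - 1) - (1 - q) / (1 - t) < 0"
      using that x q by (intro well_slope(1)[OF q k]) auto
  qed
  show "continuous_on {x..y} (well q k)"
    by (intro continuous_at_imp_continuous_on ballI DERIV_isCont[OF well_deriv]) (use x q1 q k in auto)
qed

lemma well_strict_mono:
  assumes q: "0 < q" "q \<le> 1 - 1 / real k" and k: "2 \<le> k" and x: "q \<le> x" "x < y" "y \<le> 1 - 1 / real k"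
  shows "well q k x < well q k y"
proof (rule DERIV_pos_imp_increasing_open[OF x(2)])
  have k1: "y < 1" "q < 1" using le_one_minus_inverse_imp_less_1[OF x(3) k] le_one_minus_inverse_imp_less_1[OF q(2) k] .
  show "\<exists>D. (well q k has_real_derivative D) (at t) \<and> D > 0" if "x < t" "t < y" for t
  proof (intro exI conjI)
    show "(well q k has_real_derivative (t / q) ^ (k - 1) - (1 - q) / (1 - t)) (at t)"
      using that x q k1 k by (intro well_deriv) auto
    show "(t / q) ^ (k - 1) - (1 - q) / (1 - t) > 0"
      using that x q by (intro well_slope(2)[OF q k]) auto
  qed
  show "continuous_on {x..y} (well q k)"
    by (intro continuous_at_imp_continuous_on ballI DERIV_isCont[OF well_deriv]) (use x k1 q k in auto)
qed

lemma well_nonneg: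
  assumes q: "0 < q" "q \<le> 1 - 1 / real k" and k: "2 \<le> k" and x: "0 \<le> x" "x \<le> 1 - 1 / real k"
  shows "well q k x \<ge> 0"
proof -
  have q1: "q < 1" by (rule le_one_minus_inverse_imp_less_1[OF q(2) k])
  consider "x < q" | "x = q" | "q < x" by linarith
  then show ?thesis
    using well_strict_antimono[OF q k x(1), of q] well_strict_mono[OF q k, of q x] x well_at[OF q(1) q1, of k]
    by cases auto
qed

lemma well_away:
  assumes q: "0 < q" "q \<le> 1 - 1 / real k" and k: "2 \<le> k" and \<rho>: "0 < \<rho>"
  obtains \<kappa> where "0 < \<kappa>"
    "\<And>x. 0 \<le> x \<Longrightarrow> x \<le> 1 - 1 / real k \<Longrightarrow> \<rho> \<le> \<bar>x - q\<bar> \<Longrightarrow> \<kappa> \<le> well q k x"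
proof -
  have q1: "q < 1" by (rule le_one_minus_inverse_imp_less_1[OF q(2) k])
  \<comment> \<open>When a point at distance \<open>\<rho>\<close> leaves the range, no
    \<open>x\<close> has to be treated on that side, and the positive default 1 is harmless.\<close>
  define lo where "lo = (if 0 \<le> q - \<rho> then well q k (q - \<rho>) else 1)"
  define hi where "hi = (if q + \<rho> \<le> 1 - 1 / real k then well q k (q + \<rho>) else 1)"
  have "lo > 0"
    using well_strict_antimono[OF q k, of "q - \<rho>" q] well_at[OF q(1) q1, of k] \<rho> by (auto simp: lo_def)
  moreover have "hi > 0"
    using well_strict_mono[OF q k, of q "q + \<rho>"] well_at[OF q(1) q1, of k] \<rho> by (auto simp: hi_def)
  moreover have "min lo hi \<le> well q k x"
    if x: "0 \<le> x" "x \<le> 1 - 1 / real k" "\<rho> \<le> \<bar>x - q\<bar>" for x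
  proof (cases "x \<le> q - \<rho>")
    case True
    then have "well q k (q - \<rho>) \<le> well q k x"
      using well_strict_antimono[OF q k x(1), of "q - \<rho>"] \<rho> by (cases "x = q - \<rho>") auto
    then show ?thesis using True x by (auto simp: lo_def)
  next
    case False
    then have xq: "x \<ge> q + \<rho>" using x(3) by linarith
    then have "well q k (q + \<rho>) \<le> well q k x"
      using well_strict_mono[OF q k, of "q + \<rho>" x] \<rho> x by (cases "x = q + \<rho>") auto
    then show ?thesis using xq x by (auto simp: hi_def)
  qed
  ultimately show ?thesis using that[of "min lo hi"] by (simp add: min_less_iff_conj)
qed

text \<open>For \<open>k\<close> entries equal to \<open>q\<close> the value is
  \<open>q + (1 - q) = 1\<close>, and the coefficients make this point critical in every coordinate.
  On average over \<open>y\<close>, the first part is controlled by the books of one color and the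
  second by those of the other.\<close>

definition book_sum :: "real \<Rightarrow> nat \<Rightarrow> real list \<Rightarrow> real" where
  "book_sum q k xs = (q / k) * (\<Sum>x\<leftarrow>xs. (x / q) ^ k) + (1 - q) * (\<Prod>x\<leftarrow>xs. (1 - x) / (1 - q))"

text \<open>On the range where all entries are at most \<open>1 - 1 / k\<close>, the bound \<open>exp t \<ge> 1 + t\<close> turns the
  product into a sum of logarithms and decouples the entries. An entry beyond that range makes the
  power sum exceed 2 on its own.\<close>

lemma book_sum_ge:
  assumes q: "0 < q" "q < 1" and k: "large_exponent q k" and len: "length xs = k"
    and xs: "\<And>x. x \<in> set xs \<Longrightarrow> 0 \<le> x \<and> x \<le> 1"
  shows "(\<exists>x\<in>set xs. x > 1 - 1 / k) \<Longrightarrow> book_sum q k xs \<ge> 2"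
    and "(\<And>x. x \<in> set xs \<Longrightarrow> x \<le> 1 - 1 / k) \<Longrightarrow> book_sum q k xs \<ge> 1 + (\<Sum>x\<leftarrow>xs. well q k x)"
proof -
  have k2: "2 \<le> k" and kq: "48 * k * q ^ (k - 1) \<le> 1" using k by (auto simp: large_exponent_def)
  show "book_sum q k xs \<ge> 2" if "\<exists>x\<in>set xs. x > 1 - 1 / k"
  proof -
    obtain x where x: "x \<in> set xs" "x > 1 - 1 / k" using \<open>\<exists>x\<in>set xs. x > 1 - 1 / k\<close> by blast
    have "(1 / 8 :: real) \<le> (1 - 1 / k) ^ k"
    proof -
      \<comment> \<open>Bernoulli's inequality with the full exponent \<open>k\<close> would only
        give 0. Each half of the exponent gives \<open>1 / 2\<close>, and a further
        \<open>1 / 2\<close> covers odd \<open>k\<close>.\<close>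
      define n where "n = k div 2"
      have "k \<le> 2 * n + 1" "2 * n \<le> k" by (auto simp: n_def)
      have h: "(1 / 2 :: real) \<le> 1 - 1 / k" using k2 by (simp add: field_simps)
      have "1 + n * (- (1 / real k)) \<le> (1 + - (1 / real k)) ^ n"
        using k2 by (intro Bernoulli_inequality) (simp add: field_simps)
      moreover have "n * (1 / real k) \<le> 1 / 2"
        using \<open>2 * n \<le> k\<close> k2 by (simp add: field_simps flip: of_nat_mult)
      ultimately have "1 / 2 \<le> (1 - 1 / real k) ^ n" by simp
      then have "(1 / 2) * ((1 / 2) * (1 / 2)) \<le> (1 - 1 / real k) ^ n * ((1 - 1 / real k) ^ n * (1 - 1 / real k))"
        using h by (intro mult_mono) auto
      also have "\<dots> = (1 - 1 / real k) ^ (2 * n + 1)" by (simp add: power_even_eq power2_eq_square)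
      also have "\<dots> \<le> (1 - 1 / real k) ^ k"
        using h \<open>k \<le> 2 * n + 1\<close> by (intro power_decreasing) auto
      finally show ?thesis by simp
    qed
    also have "\<dots> \<le> x ^ k" using x k2 by (intro power_mono) auto
    finally have x8: "1 / 8 \<le> x ^ k" .
    have "(x / q) ^ k \<le> (\<Sum>x\<leftarrow>xs. (x / q) ^ k)"
      using x(1) xs q by (intro member_le_sum_list) auto
    then have "(q / k) * (x / q) ^ k \<le> (q / k) * (\<Sum>x\<leftarrow>xs. (x / q) ^ k)"
      using q by (intro mult_left_mono) auto
    moreover have "(q / k) * (x / q) ^ k \<ge> 2"
    proof -
      have qk: "q ^ k = q * q ^ (k - 1)" using k2 by (cases k) auto
      have "2 * k * q ^ (k - 1) \<le> x ^ k" using kq x8 by linarith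
      then show ?thesis using q k2 by (simp add: power_divide qk field_simps)
    qed
    moreover have "0 \<le> (1 - q) * (\<Prod>x\<leftarrow>xs. (1 - x) / (1 - q))"
      using xs q by (intro mult_nonneg_nonneg prod_list_nonneg) auto
    ultimately show ?thesis unfolding book_sum_def by linarith
  qed
  show "book_sum q k xs \<ge> 1 + (\<Sum>x\<leftarrow>xs. well q k x)" if le: "\<And>x. x \<in> set xs \<Longrightarrow> x \<le> 1 - 1 / k"
  proof -
    define L where "L x = ln ((1 - x) / (1 - q))" for x
    have lt: "x < 1" if "x \<in> set xs" for x
      by (rule le_one_minus_inverse_imp_less_1[OF le[OF that] k2])
    have "(\<Prod>x\<leftarrow>ys. (1 - x) / (1 - q)) = exp (\<Sum>x\<leftarrow>ys. L x)" if "\<And>x. x \<in> set ys \<Longrightarrow> x < 1" for ys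
      using that q by (induction ys) (auto simp: L_def exp_add)
    then have "(\<Prod>x\<leftarrow>xs. (1 - x) / (1 - q)) \<ge> 1 + (\<Sum>x\<leftarrow>xs. L x)"
      using lt exp_ge_add_one_self by simp
    then have "(1 - q) * (\<Prod>x\<leftarrow>xs. (1 - x) / (1 - q)) \<ge> (1 - q) * (1 + (\<Sum>x\<leftarrow>xs. L x))"
      using q by (intro mult_left_mono) auto
    moreover have sums: "(\<Sum>x\<leftarrow>ys. well q k x)
        = (q / k) * (\<Sum>x\<leftarrow>ys. (x / q) ^ k) - (q / k) * length ys + (1 - q) * (\<Sum>x\<leftarrow>ys. L x)" for ys
      by (induction ys) (simp_all add: well_def L_def algebra_simps)
    moreover have "(q / k) * length xs = q" using len k2 by simp
    moreover have "1 + (A - D + (1 - q) * B) \<le> A + (1 - q) * C"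
      if "(1 - q) * C \<ge> (1 - q) * (1 + B)" "D = q" for A B C D :: real
      using that by (simp add: algebra_simps)
    ultimately show ?thesis
      unfolding book_sum_def sums[of xs] by blast
  qed
qed

lemma book_sum_ge_1:
  assumes q: "0 < q" "q < 1" and k: "large_exponent q k" and len: "length xs = k"
    and xs: "\<And>x. x \<in> set xs \<Longrightarrow> 0 \<le> x \<and> x \<le> 1"
  shows "book_sum q k xs \<ge> 1"
proof (cases "\<exists>x\<in>set xs. x > 1 - 1 / k")
  case True
  then show ?thesis using book_sum_ge(1)[OF q k len xs] by linarith
next
  case False
  then have "0 \<le> (\<Sum>x\<leftarrow>xs. well q k x)"
    using xs q k by (intro sum_list_nonneg) (auto simp: large_exponent_def not_less intro!: well_nonneg)
  moreover have "book_sum q k xs \<ge> 1 + (\<Sum>x\<leftarrow>xs. well q k x)"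
    using False by (intro book_sum_ge(2)[OF q k len xs]) (auto simp: not_less)
  ultimately show ?thesis by linarith
qed

text \<open>All values of \<open>well\<close> in the range are nonnegative, so one atypical entry is
  paid in full. If some entry exceeds \<open>1 - 1 / k\<close>, the value is at least 2; hence the
  gain \<open>min 1 \<kappa>\<close>.\<close>

lemma book_sum_away:
  assumes q: "0 < q" "q < 1" and k: "large_exponent q k" and \<rho>: "0 < \<rho>"
  obtains \<kappa> where "0 < \<kappa>"
    "\<And>xs x. length xs = k \<Longrightarrow> (\<And>x. x \<in> set xs \<Longrightarrow> 0 \<le> x \<and> x \<le> 1) \<Longrightarrow>
       x \<in> set xs \<Longrightarrow> \<rho> \<le> \<bar>x - q\<bar> \<Longrightarrow> 1 + \<kappa> \<le> book_sum q k xs"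
proof -
  have k': "2 \<le> k" "q \<le> 1 - 1 / real k" using k by (auto simp: large_exponent_def)
  obtain \<kappa> where \<kappa>: "0 < \<kappa>"
    "\<And>x. 0 \<le> x \<Longrightarrow> x \<le> 1 - 1 / real k \<Longrightarrow> \<rho> \<le> \<bar>x - q\<bar> \<Longrightarrow> \<kappa> \<le> well q k x"
    using well_away[OF q(1) k'(2,1) \<rho>] by blast
  have "1 + min 1 \<kappa> \<le> book_sum q k xs"
    if len: "length xs = k" and xs: "\<And>x. x \<in> set xs \<Longrightarrow> 0 \<le> x \<and> x \<le> 1"
      and x: "x \<in> set xs" "\<rho> \<le> \<bar>x - q\<bar>" for xs x
  proof (cases "\<exists>x\<in>set xs. x > 1 - 1 / k")
    case True
    then show ?thesis using book_sum_ge(1)[OF q k len xs] by linarith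
  next
    case False
    then have "well q k x \<le> (\<Sum>x\<leftarrow>xs. well q k x)"
      using x xs q k' by (intro member_le_sum_list) (auto simp: not_less intro!: well_nonneg)
    moreover have "\<kappa> \<le> well q k x" using False x xs by (intro \<kappa>(2)) (auto simp: not_less)
    moreover have "book_sum q k xs \<ge> 1 + (\<Sum>x\<leftarrow>xs. well q k x)"
      using False by (intro book_sum_ge(2)[OF q k len xs]) (auto simp: not_less)
    ultimately show ?thesis by linarith
  qed
  then show ?thesis using that[of "min 1 \<kappa>"] \<kappa>(1) by auto
qed

subsection \<open>A large set of typical density\<close>

definition clique_rich :: "('a \<Rightarrow> 'a \<Rightarrow> real) \<Rightarrow> nat \<Rightarrow> real \<Rightarrow> 'a set \<Rightarrow> bool" where
  "clique_rich f k \<mu> P \<longleftrightarrow> (\<Sum>l\<in>listset (replicate k P). clique_wt f l) \<ge> \<mu> * card P ^ k"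

section \<open>Book bounds evaluated on regular sets\<close>

lemma prod_list_card_ge:
  assumes "\<And>P. P \<in> set Ps \<Longrightarrow> real (card P) \<ge> c" "0 \<le> c"
  shows "(\<Prod>P\<leftarrow>Ps. real (card P)) \<ge> c ^ length Ps"
  using assms(1)
proof (induction Ps)
  case (Cons P Ps)
  have "c * c ^ length Ps \<le> real (card P) * (\<Prod>P\<leftarrow>Ps. real (card P))"
    using Cons assms(2) by (intro mult_mono) auto
  then show ?case by simp
qed simp

lemma listset_mono: "(\<And>P. P \<in> set Ps \<Longrightarrow> P \<subseteq> V) \<Longrightarrow> listset Ps \<subseteq> listset (replicate (length Ps) V)"
proof (induction Ps)
  case (Cons P Ps)
  then have "P \<subseteq> V" "listset Ps \<subseteq> listset (replicate (length Ps) V)" by simp_all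
  then show ?case by (auto simp: set_Cons_def)
qed simp

text \<open>The surplus summed over the cliques across \<open>Ps\<close> is bounded by the book
  bound, and regularity identifies it with \<open>M * (X - q ^ k * N)\<close> up to
  \<open>k * d * N * K\<close>. Division by the clique count \<open>M \<ge> \<mu> * K\<close> yields
  both error terms; the first also uses that \<open>K\<close> is at least
  \<open>(\<eta> * N) ^ k\<close>.\<close>

lemma book_bounded_regular_sets:
  fixes e d \<mu> \<eta> q :: real
  assumes fin: "finite V" and f: "edge_kernel f" and bb: "book_bounded V f q k e"
    and reg: "\<And>P. P \<in> set Ps \<Longrightarrow> regular_set V f d P"
    and len: "length Ps = k"
    and card: "\<And>P. P \<in> set Ps \<Longrightarrow> real (card P) \<ge> \<eta> * card V"
    and pos: "0 < \<mu>" "0 < \<eta>" "0 \<le> e" "0 \<le> d"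
    and rich: "(\<Sum>l\<in>listset Ps. clique_wt f l) \<ge> \<mu> * (\<Prod>P\<leftarrow>Ps. real (card P))"
  shows "(\<Sum>y\<in>V. \<Prod>P\<leftarrow>Ps. dens f P y) \<le> q ^ k * card V + (e / (\<mu> * \<eta> ^ k) + k * d / \<mu>) * card V"
proof (cases "V = {}")
  case False
  define N where "N = real (card V)"
  define L where "L = listset Ps"
  define K where "K = (\<Prod>P\<leftarrow>Ps. real (card P))"
  define M where "M = (\<Sum>l\<in>L. clique_wt f l)"
  define X where "X = (\<Sum>y\<in>V. \<Prod>P\<leftarrow>Ps. dens f P y)"
  have N: "N > 0" using False fin by (simp add: N_def card_gt_0_iff)
  have LV: "L \<subseteq> listset (replicate k V)"
    unfolding L_def len[symmetric] using reg by (intro listset_mono) (auto simp: regular_set_def)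
  have finL: "finite L" by (rule finite_subset[OF LV finite_tuples[OF fin]])
  have K: "(\<eta> * N) ^ k \<le> K"
    unfolding K_def len[symmetric] N_def using card pos by (intro prod_list_card_ge) auto
  have "0 < (\<eta> * N) ^ k" using pos N by simp
  with K have Kpos: "0 < K" by linarith
  have M: "\<mu> * K \<le> M" using rich by (simp add: M_def K_def L_def)
  have "0 < \<mu> * K" using Kpos pos by simp
  with M have Mpos: "0 < M" by linarith
  have A: "(\<Sum>l\<in>L. clique_wt f l * ((\<Sum>y\<in>V. common f l y) - q ^ k * N)) \<le> e * N ^ (k + 1)"
  proof -
    have "(\<Sum>l\<in>listset (replicate k V). (if l \<in> L then 1 else 0) * clique_wt f l *
        ((\<Sum>y\<in>V. common f l y) - q ^ k * card V)) \<le> e * real (card V) ^ (k + 1)"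
      using bb[unfolded book_bounded_def, rule_format, of "\<lambda>l. if l \<in> L then 1 else 0"] by simp
    also have "(\<Sum>l\<in>listset (replicate k V). (if l \<in> L then 1 else 0) * clique_wt f l *
        ((\<Sum>y\<in>V. common f l y) - q ^ k * card V))
        = (\<Sum>l\<in>L. clique_wt f l * ((\<Sum>y\<in>V. common f l y) - q ^ k * N))"
      using LV fin by (intro sum.mono_neutral_cong_right) (auto simp: finite_tuples N_def)
    finally show ?thesis by (simp add: N_def)
  qed
  have B: "\<bar>\<Sum>y\<in>V. \<Sum>l\<in>L. clique_wt f l * (common f l y - (\<Prod>P\<leftarrow>Ps. dens f P y))\<bar> \<le> k * d * N * K"
    using regular_set_tuples[OF fin f reg, of Ps "clique_wt f"] clique_wt_bounds[OF f]
    unfolding len L_def[symmetric] K_def N_def by (intro order_trans[OF sum_abs]) auto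
  have "M * (X - q ^ k * N) = (\<Sum>l\<in>L. clique_wt f l * ((\<Sum>y\<in>V. common f l y) - q ^ k * N))
      - (\<Sum>y\<in>V. \<Sum>l\<in>L. clique_wt f l * (common f l y - (\<Prod>P\<leftarrow>Ps. dens f P y)))"
  proof -
    have "(\<Sum>y\<in>V. \<Sum>l\<in>L. clique_wt f l * (common f l y - (\<Prod>P\<leftarrow>Ps. dens f P y)))
        = (\<Sum>l\<in>L. clique_wt f l * ((\<Sum>y\<in>V. common f l y) - X))"
      unfolding X_def sum_subtractf[symmetric] sum_distrib_left by (rule sum.swap)
    then show ?thesis
      unfolding M_def by (simp add: sum_subtractf sum_distrib_right right_diff_distrib)
  qed
  then have MX: "M * (X - q ^ k * N) \<le> e * N ^ (k + 1) + k * d * N * K" using A B by linarith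
  have "e * N ^ (k + 1) = e / \<eta> ^ k * (\<eta> * N) ^ k * N"
    using pos by (simp add: power_mult_distrib)
  also have "\<dots> \<le> e / \<eta> ^ k * K * N"
    using pos K N by (intro mult_right_mono mult_left_mono) auto
  finally have "e * N ^ (k + 1) + k * d * N * K \<le> e / \<eta> ^ k * K * N + k * d * N * K" by simp
  also have "\<dots> = (\<mu> * K) * ((e / (\<mu> * \<eta> ^ k) + k * d / \<mu>) * N)"
    using pos by (simp add: field_simps)
  also have "\<dots> \<le> M * ((e / (\<mu> * \<eta> ^ k) + k * d / \<mu>) * N)"
    using pos M N by (intro mult_right_mono) auto
  finally have "M * (X - q ^ k * N) \<le> M * ((e / (\<mu> * \<eta> ^ k) + k * d / \<mu>) * N)" using MX by linarith
  then have "X - q ^ k * N \<le> (e / (\<mu> * \<eta> ^ k) + k * d / \<mu>) * N" using Mpos by simp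
  then show ?thesis by (simp add: X_def N_def)
qed simp

text \<open>The case of \<open>k\<close> equal sets: cliques inside \<open>P\<close> bound the
  \<open>k\<close>-th moment of its density.\<close>

lemma book_bounded_rich_set:
  fixes e d \<mu> \<eta> q :: real
  assumes "finite V" "edge_kernel f" "book_bounded V f q k e"
    and "regular_set V f d P" "real (card P) \<ge> \<eta> * card V"
    and "0 < \<mu>" "0 < \<eta>" "0 \<le> e" "0 \<le> d" "clique_rich f k \<mu> P"
  shows "(\<Sum>y\<in>V. dens f P y ^ k) \<le> q ^ k * card V + (e / (\<mu> * \<eta> ^ k) + k * d / \<mu>) * card V"
proof -
  have "(\<Sum>y\<in>V. \<Prod>P\<leftarrow>replicate k P. dens f P y)
      \<le> q ^ k * card V + (e / (\<mu> * \<eta> ^ k) + k * d / \<mu>) * card V"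
    by (rule book_bounded_regular_sets[where \<eta> = \<eta> and \<mu> = \<mu> and f = f and d = d])
      (use assms in \<open>auto simp: clique_rich_def prod_list_replicate simp del: listset.simps\<close>)
  then show ?thesis by (simp add: prod_list_replicate)
qed

lemma card_Union_sum:
  assumes "finite F" "pairwise disjnt F" "\<And>P. P \<in> F \<Longrightarrow> finite P"
  shows "real (card (\<Union>F)) = (\<Sum>P\<in>F. real (card P))"
  using card_Union_disjoint[of F] assms by simp

text \<open>A Turan-type step: few vertices have \<open>f\<close>-density above \<open>1 - 1 / (2 * k)\<close> to a given member of
  the family, so \<open>co_kernel f\<close>-cliques with one vertex in each of fewer than \<open>k\<close> members extend to
  a further member.\<close>

lemma transversal_cliques:
  fixes d e1 q s :: real
  assumes fin: "finite V" and f: "edge_kernel f"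
    and F: "finite F" "pairwise disjnt F" "\<And>P. P \<in> F \<Longrightarrow> regular_set V f d P"
    and pow: "\<And>P. P \<in> F \<Longrightarrow> (\<Sum>y\<in>V. dens f P y ^ k) \<le> (q ^ k + e1) * card V"
    and U: "0 < card V" "6 * card (\<Union>F) \<ge> card V"
    and k: "1 \<le> k" and small: "48 * real k * q ^ k \<le> 1" "48 * real k * e1 \<le> 1"
    and s: "s = (1 / (2 * real k)) ^ k / 4" and d: "0 \<le> d" "6 * real k * d \<le> s ^ (k + 1)"
    and j: "j \<le> k"
  shows "\<exists>Ps. length Ps = j \<and> set Ps \<subseteq> F \<and>
    (\<Sum>l\<in>listset Ps. clique_wt (co_kernel f) l) \<ge> s ^ j * (\<Prod>P\<leftarrow>Ps. real (card P))"
  using j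
proof (induction j)
  case 0
  then show ?case by (intro exI[of _ "[]"]) simp
next
  case (Suc j)
  then obtain Ps where Ps: "length Ps = j" "set Ps \<subseteq> F"
    "(\<Sum>l\<in>listset Ps. clique_wt (co_kernel f) l) \<ge> s ^ j * (\<Prod>P\<leftarrow>Ps. real (card P))" by auto
  define N where "N = real (card V)"
  define U where "U = \<Union>F"
  define g where "g = co_kernel f"
  have g: "edge_kernel g" unfolding g_def by (rule kernel_co[OF f])
  define L where "L = listset Ps"
  define K where "K = (\<Prod>P\<leftarrow>Ps. real (card P))"
  define M where "M = (\<Sum>l\<in>L. clique_wt g l)"
  define D where "D y = (\<Prod>P\<leftarrow>Ps. dens g P y)" for y
  define t where "t = 1 / (2 * real k)"
  have k0: "real k > 0" using k by simp
  have t: "0 < t" "t \<le> 1" using k by (auto simp: t_def)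
  have s0: "0 < s" using t unfolding s t_def[symmetric] by simp
  have s1: "s \<le> 1" using power_le_one[of t k] t unfolding s t_def[symmetric] by simp
  have finP: "finite P" "P \<noteq> {}" "P \<subseteq> V" if "P \<in> F" for P
    using F(3)[OF that] fin finite_subset unfolding regular_set_def by auto
  have UV: "U \<subseteq> V" using finP(3) by (auto simp: U_def)
  have finU: "finite U" using UV fin finite_subset by blast
  have NU: "N \<le> 6 * card U" "0 < N" using assms by (auto simp: N_def U_def)
  have densg: "dens g P y = 1 - dens f P y" if "P \<in> F" for P y
    unfolding g_def using finP[OF that] by (intro dens_co) auto
  have K0: "0 \<le> K" unfolding K_def by (intro prod_list_nonneg) auto
  define bad where "bad P = {y \<in> U. dens f P y > 1 - t}" for P
  define A where "A = {y \<in> U. \<forall>P\<in>set Ps. dens f P y \<le> 1 - t}"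
  have bad: "real (card (bad P)) \<le> card U / (2 * real k)" if "P \<in> F" for P
  proof -
    \<comment> \<open>At density \<open>1 - t\<close> with \<open>t = 1 / (2 * k)\<close> the
      \<open>k\<close>-th power is still at least \<open>1 / 2\<close>, so Markov's inequality
      applies to the moment bound; the factor 6 is the loss from \<open>V\<close> to
      \<open>U\<close>.\<close>
    have "1 + k * (- t) \<le> (1 + - t) ^ k" using t by (intro Bernoulli_inequality) auto
    then have half: "1 / 2 \<le> (1 - t) ^ k" using k0 by (simp add: t_def)
    have "card (bad P) * (1 / 2) \<le> (\<Sum>y\<in>bad P. dens f P y ^ k)"
    proof (rule sum_bounded_below)
      fix y assume "y \<in> bad P"
      then have "(1 - t) ^ k \<le> dens f P y ^ k" using t by (intro power_mono) (auto simp: bad_def)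
      with half show "1 / 2 \<le> dens f P y ^ k" by linarith
    qed
    also have "\<dots> \<le> (\<Sum>y\<in>V. dens f P y ^ k)"
      using UV fin dens_bounds[OF f] by (intro sum_mono2) (auto simp: bad_def)
    also have "\<dots> \<le> (q ^ k + e1) * N" unfolding N_def by (rule pow[OF that])
    also have "\<dots> \<le> (1 / (24 * real k)) * (6 * card U)"
    proof (rule mult_mono)
      show "q ^ k + e1 \<le> 1 / (24 * real k)" using small k0 by (simp add: field_simps)
    qed (use NU k0 in auto)
    finally show ?thesis using k0 by (simp add: field_simps)
  qed
  have cardA: "real (card A) \<ge> card U / 2"
  proof -
    have "U \<subseteq> A \<union> (\<Union>P\<in>set Ps. bad P)" by (auto simp: A_def bad_def)
    then have "card U \<le> card (A \<union> (\<Union>P\<in>set Ps. bad P))"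
      using finU by (intro card_mono) (auto simp: A_def bad_def)
    also have "\<dots> \<le> card A + card (\<Union>P\<in>set Ps. bad P)" by (rule card_Un_le)
    also have "card (\<Union>P\<in>set Ps. bad P) \<le> (\<Sum>P\<in>set Ps. card (bad P))" by (rule card_UN_le) simp
    finally have "real (card U) \<le> card A + (\<Sum>P\<in>set Ps. real (card (bad P)))"
      by (simp flip: of_nat_sum of_nat_add)
    also have "(\<Sum>P\<in>set Ps. real (card (bad P))) \<le> (card U / (2 * real k)) * card (set Ps)"
      using bad Ps(2) by (intro sum_le_card) auto
    also have "\<dots> \<le> (card U / (2 * real k)) * k"
      using card_length[of Ps] Ps(1) Suc.prems by (intro mult_left_mono) auto
    also have "\<dots> = card U / 2" using k0 by simp
    finally show ?thesis by simp
  qed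
  have D0: "0 \<le> D y" for y
    unfolding D_def using dens_bounds[OF g] by (intro prod_list_nonneg) auto
  have DA: "t ^ k \<le> D y" if "y \<in> A" for y
  proof -
    have "t ^ length Qs \<le> (\<Prod>P\<leftarrow>Qs. dens g P y)" if "set Qs \<subseteq> set Ps" for Qs
      using that
    proof (induction Qs)
      case (Cons Q Qs)
      have Q: "Q \<in> set Ps" "Q \<in> F" using Cons.prems Ps(2) by auto
      then have "dens f Q y \<le> 1 - t" using \<open>y \<in> A\<close> by (simp add: A_def)
      then have "t \<le> dens g Q y" using densg[OF Q(2), of y] by simp
      moreover have "t ^ length Qs \<le> (\<Prod>P\<leftarrow>Qs. dens g P y)" using Cons by simp
      ultimately have "t * t ^ length Qs \<le> dens g Q y * (\<Prod>P\<leftarrow>Qs. dens g P y)"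
        using t dens_bounds[OF g, of Q y] by (intro mult_mono) auto
      then show ?case by simp
    qed simp
    from this[of Ps] have "t ^ j \<le> D y" using Ps(1) by (simp add: D_def)
    moreover have "t ^ k \<le> t ^ j" using t Suc.prems by (intro power_decreasing) auto
    ultimately show ?thesis by linarith
  qed
  \<comment> \<open>Half of \<open>U\<close> contributes \<open>t ^ k = 4 * s\<close> per vertex.
    The resulting \<open>2 * s\<close> is twice what is wanted, and the surplus pays for the
    regularity error below.\<close>
  have sumD: "(\<Sum>y\<in>U. D y) \<ge> card U * (2 * s)"
  proof -
    have "card U * (2 * s) = card U / 2 * t ^ k" by (simp add: s t_def)
    also have "\<dots> \<le> card A * t ^ k" using cardA t by (intro mult_right_mono) auto
    also have "\<dots> \<le> (\<Sum>y\<in>A. D y)" using DA by (intro sum_bounded_below)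
    also have "\<dots> \<le> (\<Sum>y\<in>U. D y)" using finU D0 by (intro sum_mono2) (auto simp: A_def)
    finally show ?thesis .
  qed
  define h where "h y = (\<Sum>l\<in>L. clique_wt g (y # l))" for y
  have M0: "s ^ j * K \<le> M" "0 \<le> M"
    using Ps(3) clique_wt_bounds[OF g] by (auto simp: M_def K_def L_def g_def intro!: sum_nonneg)
  have "(\<Sum>y\<in>U. h y) \<ge> card U * (s ^ Suc j * K)"
  proof -
    have "M * D y - h y = - (\<Sum>l\<in>L. clique_wt g l * (common g l y - D y))" for y
      by (simp add: M_def h_def sum_distrib_right sum_distrib_left sum_subtractf algebra_simps)
    then have "(\<Sum>y\<in>U. M * D y - h y) = - (\<Sum>y\<in>U. \<Sum>l\<in>L. clique_wt g l * (common g l y - D y))"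
      by (simp add: sum_negf)
    also have "\<dots> \<le> (\<Sum>y\<in>U. \<bar>\<Sum>l\<in>L. clique_wt g l * (common g l y - D y)\<bar>)"
      by (subst sum_negf[symmetric]) (intro sum_mono abs_ge_minus_self)
    also have "\<dots> \<le> (\<Sum>y\<in>V. \<bar>\<Sum>l\<in>L. clique_wt g l * (common g l y - D y)\<bar>)"
      using UV fin by (intro sum_mono2) auto
    also have "\<dots> \<le> length Ps * d * N * K"
      unfolding L_def D_def N_def K_def g_def
      using Ps(2) F(3) fin clique_wt_bounds[OF kernel_co[OF f]] f
      by (intro regular_set_tuples kernel_co regular_set_co) auto
    also have "\<dots> \<le> k * d * (6 * card U) * K"
      using Ps(1) Suc.prems d NU K0 by (intro mult_mono mult_right_mono) auto
    also have "\<dots> = (6 * real k * d) * (card U * K)" by simp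
    also have "\<dots> \<le> s ^ Suc j * (card U * K)"
    proof (rule mult_right_mono)
      have "s ^ (k + 1) \<le> s ^ Suc j" using s0 s1 Suc.prems by (intro power_decreasing) auto
      then show "6 * real k * d \<le> s ^ Suc j" using d by linarith
    qed (use K0 in auto)
    finally have "(\<Sum>y\<in>U. M * D y - h y) \<le> s ^ Suc j * (card U * K)" .
    then have "M * (\<Sum>y\<in>U. D y) - (\<Sum>y\<in>U. h y) \<le> s ^ Suc j * (card U * K)"
      by (simp add: sum_subtractf sum_distrib_left)
    moreover have "(s ^ j * K) * (card U * (2 * s)) \<le> M * (\<Sum>y\<in>U. D y)"
      using M0 sumD s0 K0 by (intro mult_mono) auto
    ultimately show ?thesis by (simp add: algebra_simps)
  qed
  moreover have "(\<Sum>y\<in>U. h y) = (\<Sum>P\<in>F. \<Sum>y\<in>P. h y)"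
    unfolding U_def using F(2) finP by (subst sum.Union_disjoint) (auto simp: pairwise_def disjnt_def)
  moreover have "real (card U) = (\<Sum>P\<in>F. real (card P))"
    unfolding U_def using F finP by (intro card_Union_sum) auto
  ultimately have le: "(\<Sum>P\<in>F. card P * (s ^ Suc j * K)) \<le> (\<Sum>P\<in>F. \<Sum>y\<in>P. h y)"
    by (simp add: sum_distrib_right)
  have "F \<noteq> {}" using NU by (auto simp: U_def)
  \<comment> \<open>The members of \<open>F\<close> partition \<open>U\<close>, so one of them
    receives its share of \<open>h\<close>. It may already occur in \<open>Ps\<close>; the list is
    allowed to repeat sets.\<close>
  obtain P where P: "P \<in> F" "card P * (s ^ Suc j * K) \<le> (\<Sum>y\<in>P. h y)"
  proof (rule ccontr)
    assume "\<not> thesis"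
    then have "\<And>P. P \<in> F \<Longrightarrow> (\<Sum>y\<in>P. h y) < card P * (s ^ Suc j * K)" using that by force
    then have "(\<Sum>P\<in>F. \<Sum>y\<in>P. h y) < (\<Sum>P\<in>F. card P * (s ^ Suc j * K))"
      using F(1) \<open>F \<noteq> {}\<close> by (intro sum_strict_mono)
    with le show False by linarith
  qed
  show ?case
  proof (intro exI[of _ "P # Ps"] conjI)
    show "(\<Sum>l\<in>listset (P # Ps). clique_wt (co_kernel f) l) \<ge> s ^ Suc j * (\<Prod>P\<leftarrow>P # Ps. real (card P))"
      using P(2) unfolding sum_listset_Cons h_def L_def K_def g_def by (simp add: mult_ac)
  qed (use Ps P in auto)
qed

lemma prod_list_divide_const:
  fixes b :: real
  shows "(\<Prod>x\<leftarrow>xs. g x / b) = (\<Prod>x\<leftarrow>xs. g x) / b ^ length xs"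
  by (induction xs) simp_all

text \<open>By the stability of \<open>book_sum\<close>, \<open>k\<close> members of the family that span many \<open>co_kernel f\<close>-cliques
  have density close to \<open>q\<close> to almost all vertices. The members of typical density are collected
  in \<open>A\<close>; the others cannot cover a sixth of the vertices, or \<open>transversal_cliques\<close> would apply
  to them.\<close>

lemma uniform_set_aux:
  fixes q \<mu> \<eta> c d e e1 s \<kappa> :: real
  assumes fin: "finite V" and V: "0 < card V" and f: "edge_kernel f"
    and q: "0 < q" "q < 1" and k: "large_exponent q k"
    and F: "finite F" "pairwise disjnt F"
      "\<And>P. P \<in> F \<Longrightarrow> regular_set V f d P \<and> \<eta> * real (card V) \<le> real (card P) \<and> clique_rich f k \<mu> P"
    and cardF: "card V \<le> 3 * card (\<Union>F)"
    and bb: "book_bounded V f q k e" "book_bounded V (co_kernel f) (1 - q) k e"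
    and \<kappa>: "0 < \<kappa>"
      "\<And>xs x. length xs = k \<Longrightarrow> (\<And>x. x \<in> set xs \<Longrightarrow> 0 \<le> x \<and> x \<le> 1) \<Longrightarrow>
         x \<in> set xs \<Longrightarrow> c / 3 \<le> \<bar>x - q\<bar> \<Longrightarrow> 1 + \<kappa> \<le> book_sum q k xs"
    and s: "s = (1 / (2 * real k)) ^ k / 4" and pos: "0 < \<mu>" "0 < \<eta>" "0 \<le> e" "0 \<le> d" "0 < c"
    and e1: "48 * real k * e1 \<le> 1" "(q / q ^ k + (1 - q) / (1 - q) ^ k) * e1 \<le> \<kappa> * (c / 3)"
    and d: "6 * real k * d \<le> s ^ (k + 1)" "d \<le> c / 3"
    and err: "e / (\<mu> * \<eta> ^ k) + k * d / \<mu> \<le> e1" "e / (s ^ k * \<eta> ^ k) + k * d / s ^ k \<le> e1"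
  shows "\<exists>A. cut_uniform V f q c A \<and> card V \<le> 6 * card A"
proof -
  define N where "N = real (card V)"
  have N: "0 < N" using V by (simp add: N_def)
  have k2: "2 \<le> k" and kq: "48 * k * q ^ (k - 1) \<le> 1" using k by (auto simp: large_exponent_def)
  have s0: "0 < s" using k2 by (simp add: s)
  have co: "edge_kernel (co_kernel f)" by (rule kernel_co[OF f])
  have finP: "finite P" "P \<noteq> {}" "P \<subseteq> V" if "P \<in> F" for P
    using F(3)[OF that] fin finite_subset unfolding regular_set_def by auto
  have pow: "(\<Sum>y\<in>V. dens f P y ^ k) \<le> (q ^ k + e1) * card V" if "P \<in> F" for P
  proof -
    have "(\<Sum>y\<in>V. dens f P y ^ k) \<le> q ^ k * card V + (e / (\<mu> * \<eta> ^ k) + k * d / \<mu>) * card V"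
      using F(3)[OF that] by (intro book_bounded_rich_set[OF fin f bb(1)] pos) auto
    also have "\<dots> \<le> q ^ k * card V + e1 * card V" by (intro add_left_mono mult_right_mono err) auto
    finally show ?thesis by (simp add: distrib_right)
  qed
  \<comment> \<open>The allowance \<open>c\<close> is divided into thirds: regularity of the pieces,
    the deviation at typical vertices, and the exceptional set \<open>B\<close>. The last two make
    up \<open>2 * c / 3\<close>.\<close>
  define good where "good P \<longleftrightarrow> (\<Sum>y\<in>V. \<bar>dens f P y - q\<bar>) \<le> (2 * c / 3) * N" for P
  define F1 where "F1 = {P \<in> F. good P}"
  define F2 where "F2 = {P \<in> F. \<not> good P}"
  have F12: "F = F1 \<union> F2" "F1 \<subseteq> F" "F2 \<subseteq> F" "finite F1" "finite F2" "pairwise disjnt F1" "pairwise disjnt F2"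
    using F(1) by (auto simp: F1_def F2_def intro: pairwise_subset[OF F(2)])
  have finUn: "finite (\<Union>F1)" "finite (\<Union>F2)" using F12 finP by auto
  have "\<not> card V \<le> 6 * card (\<Union>F2)"
  proof
    assume big: "card V \<le> 6 * card (\<Union>F2)"
    have "\<exists>Ps. length Ps = k \<and> set Ps \<subseteq> F2 \<and>
      (\<Sum>l\<in>listset Ps. clique_wt (co_kernel f) l) \<ge> s ^ k * (\<Prod>P\<leftarrow>Ps. real (card P))"
    proof (rule transversal_cliques[OF fin f F12(5,7) _ _ V _ _ _ e1(1) s pos(4) d(1)])
      show "regular_set V f d P" if "P \<in> F2" for P using that F12(3) F(3) by blast
      show "(\<Sum>y\<in>V. dens f P y ^ k) \<le> (q ^ k + e1) * card V" if "P \<in> F2" for P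
        using that F12(3) pow by blast
      have "48 * real k * q ^ k \<le> 48 * real k * q ^ (k - 1)"
        using q by (intro mult_left_mono power_decreasing) auto
      then show "48 * real k * q ^ k \<le> 1" using kq by linarith
    qed (use big k2 in auto)
    then obtain Ps where Ps: "length Ps = k" "set Ps \<subseteq> F2"
      "(\<Sum>l\<in>listset Ps. clique_wt (co_kernel f) l) \<ge> s ^ k * (\<Prod>P\<leftarrow>Ps. real (card P))" by blast
    define X where "X y = book_sum q k (map (\<lambda>P. dens f P y) Ps)" for y
    have PsF: "P \<in> F" if "P \<in> set Ps" for P using that Ps(2) F12(3) by blast
    have dens01: "\<And>x. x \<in> set (map (\<lambda>P. dens f P y) Ps) \<Longrightarrow> 0 \<le> x \<and> x \<le> 1" for y
      using dens_bounds[OF f] by auto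
    have prod: "(\<Sum>y\<in>V. \<Prod>P\<leftarrow>Ps. 1 - dens f P y) \<le> ((1 - q) ^ k + e1) * N"
    proof -
      have "dens (co_kernel f) P y = 1 - dens f P y" if "P \<in> set Ps" for P y
        by (rule dens_co[OF finP(1,2)[OF PsF[OF that]]])
      then have "(\<Sum>y\<in>V. \<Prod>P\<leftarrow>Ps. 1 - dens f P y) = (\<Sum>y\<in>V. \<Prod>P\<leftarrow>Ps. dens (co_kernel f) P y)"
        by (intro sum.cong refl arg_cong[where f = prod_list] map_cong) simp_all
      also have "\<dots> \<le> (1 - q) ^ k * card V + (e / (s ^ k * \<eta> ^ k) + k * d / s ^ k) * card V"
        using F(3) PsF s0
        by (intro book_bounded_regular_sets[OF fin co bb(2) _ Ps(1) _ _ pos(2,3,4) Ps(3)] regular_set_co fin) auto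
      also have "\<dots> \<le> (1 - q) ^ k * card V + e1 * card V"
        by (intro add_left_mono mult_right_mono err) auto
      finally show ?thesis by (simp add: distrib_right N_def)
    qed
    have powsum: "(\<Sum>y\<in>V. \<Sum>P\<leftarrow>Ps. dens f P y ^ k) \<le> k * ((q ^ k + e1) * N)"
    proof -
      have "(\<Sum>y\<in>V. \<Sum>P\<leftarrow>Qs. dens f P y ^ k) \<le> length Qs * ((q ^ k + e1) * N)" if "set Qs \<subseteq> F" for Qs
        using that
      proof (induction Qs)
        case (Cons Q Qs)
        then show ?case using pow[of Q] by (simp add: sum.distrib N_def algebra_simps)
      qed simp
      then show ?thesis using Ps(1) PsF by blast
    qed
    \<comment> \<open>The coefficients of \<open>book_sum\<close> turn the main terms into exactly
      \<open>N\<close>; the bound on \<open>e1\<close> was chosen to keep the rescaled errors below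
      \<open>\<kappa> * (c / 3) * N\<close>.\<close>
    have sumX: "(\<Sum>y\<in>V. X y) \<le> N + \<kappa> * (c / 3) * N"
    proof -
      have "X y = (q / k) / q ^ k * (\<Sum>P\<leftarrow>Ps. dens f P y ^ k)
          + (1 - q) / (1 - q) ^ k * (\<Prod>P\<leftarrow>Ps. 1 - dens f P y)" for y
      proof -
        have "(\<Sum>P\<leftarrow>Qs. (dens f P y / q) ^ k) = (\<Sum>P\<leftarrow>Qs. dens f P y ^ k) / q ^ k" for Qs
          by (induction Qs) (simp_all add: power_divide add_divide_distrib)
        then show ?thesis
          unfolding X_def book_sum_def prod_list_divide_const using Ps(1) by (simp add: comp_def)
      qed
      then have "(\<Sum>y\<in>V. X y) = (q / k) / q ^ k * (\<Sum>y\<in>V. \<Sum>P\<leftarrow>Ps. dens f P y ^ k)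
          + (1 - q) / (1 - q) ^ k * (\<Sum>y\<in>V. \<Prod>P\<leftarrow>Ps. 1 - dens f P y)"
        by (simp add: sum.distrib sum_distrib_left)
      also have "\<dots> \<le> (q / k) / q ^ k * (k * ((q ^ k + e1) * N))
          + (1 - q) / (1 - q) ^ k * (((1 - q) ^ k + e1) * N)"
        using q by (intro add_mono mult_left_mono powsum prod) auto
      also have "\<dots> = N + ((q / q ^ k + (1 - q) / (1 - q) ^ k) * e1) * N"
      proof -
        have "(q / k) / q ^ k * (k * ((q ^ k + e1) * N)) = q * N + q / q ^ k * e1 * N"
          using q k2 by (simp add: field_simps)
        moreover have "(1 - q) / (1 - q) ^ k * (((1 - q) ^ k + e1) * N) = (1 - q) * N + (1 - q) / (1 - q) ^ k * e1 * N"
        proof -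
          have "(1 - q) ^ k \<noteq> 0" using q by simp
          then have "a / (1 - q) ^ k * (((1 - q) ^ k + e1) * N) = a * N + a / (1 - q) ^ k * e1 * N" for a
            by (simp add: field_simps)
          then show ?thesis .
        qed
        ultimately show ?thesis by (simp add: algebra_simps)
      qed
      also have "\<dots> \<le> N + (\<kappa> * (c / 3)) * N"
        using N by (intro add_left_mono mult_right_mono e1) auto
      finally show ?thesis .
    qed
    have "Ps \<noteq> []" using Ps(1) k2 by auto
    then obtain P where P: "P \<in> set Ps" by (meson list.set_sel(1))
    \<comment> \<open>\<open>X\<close> is at least 1 everywhere and has a surplus
      \<open>\<kappa>\<close> on \<open>B\<close>, so its average leaves at most
      \<open>(c / 3) * N\<close> vertices for \<open>B\<close>. This makes a member of
      \<open>F2\<close> good, a contradiction.\<close>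
    define B where "B = {y \<in> V. c / 3 \<le> \<bar>dens f P y - q\<bar>}"
    have X1: "1 + \<kappa> * of_bool (y \<in> B) \<le> X y" for y
    proof (cases "y \<in> B")
      case True
      then have "1 + \<kappa> \<le> X y"
        unfolding X_def using P Ps(1) dens01 by (intro \<kappa>(2)[where x = "dens f P y"]) (auto simp: B_def)
      then show ?thesis using True by simp
    next
      case False
      have "1 \<le> X y" unfolding X_def using Ps(1) dens01 by (intro book_sum_ge_1[OF q k]) auto
      then show ?thesis using False by simp
    qed
    have cardB: "(\<Sum>y\<in>V. of_bool (y \<in> B)) = real (card B)"
      using fin by (simp add: B_def sum.If_cases of_bool_def Int_def)
    have "(\<Sum>y\<in>V. 1 + \<kappa> * of_bool (y \<in> B)) \<le> (\<Sum>y\<in>V. X y)" by (intro sum_mono X1)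
    then have "N + \<kappa> * card B \<le> N + \<kappa> * (c / 3) * N"
      using sumX cardB by (simp add: sum.distrib N_def flip: sum_distrib_left)
    then have "\<kappa> * card B \<le> \<kappa> * ((c / 3) * N)" by simp
    then have B: "card B \<le> (c / 3) * N" using \<kappa>(1) by simp
    have "(\<Sum>y\<in>V. \<bar>dens f P y - q\<bar>) \<le> (\<Sum>y\<in>V. c / 3 + of_bool (y \<in> B))"
    proof (rule sum_mono)
      fix y assume "y \<in> V"
      then show "\<bar>dens f P y - q\<bar> \<le> c / 3 + of_bool (y \<in> B)"
        using dens_bounds[OF f, of P y] q pos(5) by (cases "y \<in> B") (auto simp: B_def)
    qed
    also have "\<dots> = (c / 3) * N + card B" using cardB by (simp add: sum.distrib N_def)
    also have "\<dots> \<le> (2 * c / 3) * N" using B by (simp add: algebra_simps)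
    finally have "good P" by (simp add: good_def)
    then show False using P Ps(2) by (auto simp: F2_def)
  qed
  moreover have "card (\<Union>F) \<le> card (\<Union>F1) + card (\<Union>F2)"
    using card_Un_le[of "\<Union>F1" "\<Union>F2"] F12(1) by simp
  ultimately have cardA: "card V \<le> 6 * card (\<Union>F1)" using cardF by linarith
  have UV: "\<Union>F1 \<subseteq> V" using F12(2) finP(3) by blast
  have "cut_uniform V f q c (\<Union>F1)"
    unfolding cut_uniform_def
  proof (intro conjI UV allI impI)
    fix w :: "'a \<Rightarrow> real" assume w: "\<forall>u. 0 \<le> w u \<and> w u \<le> 1"
    have piece: "(\<Sum>y\<in>V. \<bar>\<Sum>u\<in>P. w u * (f u y - q)\<bar>) \<le> c * N * card P" if P: "P \<in> F1" for P
    proof -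
      have PF: "P \<in> F" and goodP: "good P" using P by (auto simp: F1_def)
      have W: "0 \<le> (\<Sum>u\<in>P. w u)" "(\<Sum>u\<in>P. w u) \<le> card P"
        using w sum_le_card[of P w 1] by (auto intro: sum_nonneg)
      have "(\<Sum>u\<in>P. w u * (f u y - q)) = (\<Sum>u\<in>P. w u * (f u y - dens f P y)) + (\<Sum>u\<in>P. w u) * (dens f P y - q)" for y
        unfolding sum_distrib_right sum.distrib[symmetric] by (intro sum.cong refl) (simp add: algebra_simps)
      then have "\<bar>\<Sum>u\<in>P. w u * (f u y - q)\<bar>
          \<le> \<bar>\<Sum>u\<in>P. w u * (f u y - dens f P y)\<bar> + card P * \<bar>dens f P y - q\<bar>" for y
        using W abs_triangle_ineq[of "\<Sum>u\<in>P. w u * (f u y - dens f P y)" "(\<Sum>u\<in>P. w u) * (dens f P y - q)"]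
          mult_right_mono[OF W(2), of "\<bar>dens f P y - q\<bar>"]
        by (simp add: abs_mult)
      then have "(\<Sum>y\<in>V. \<bar>\<Sum>u\<in>P. w u * (f u y - q)\<bar>)
          \<le> (\<Sum>y\<in>V. \<bar>\<Sum>u\<in>P. w u * (f u y - dens f P y)\<bar>) + card P * (\<Sum>y\<in>V. \<bar>dens f P y - q\<bar>)"
        unfolding sum_distrib_left sum.distrib[symmetric] by (intro sum_mono)
      also have "(\<Sum>y\<in>V. \<bar>\<Sum>u\<in>P. w u * (f u y - dens f P y)\<bar>) \<le> d * card P * card V"
        using F(3)[OF PF] w by (intro weighted_sum_abs_le finP(1)[OF PF]) (auto simp: regular_set_def)
      also have "card P * (\<Sum>y\<in>V. \<bar>dens f P y - q\<bar>) \<le> card P * ((2 * c / 3) * N)"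
        using goodP unfolding good_def by (intro mult_left_mono) auto
      also have "d * card P * card V + card P * ((2 * c / 3) * N) = (d + 2 * c / 3) * (card P * N)"
        by (simp add: N_def algebra_simps)
      also have "\<dots> \<le> c * (card P * N)" using d(2) N by (intro mult_right_mono) auto
      finally show ?thesis by (simp add: mult_ac)
    qed
    have "(\<Sum>y\<in>V. \<bar>\<Sum>u\<in>\<Union>F1. w u * (f u y - q)\<bar>) \<le> (\<Sum>y\<in>V. \<Sum>P\<in>F1. \<bar>\<Sum>u\<in>P. w u * (f u y - q)\<bar>)"
    proof (rule sum_mono)
      fix y
      have "(\<Sum>u\<in>\<Union>F1. w u * (f u y - q)) = (\<Sum>P\<in>F1. \<Sum>u\<in>P. w u * (f u y - q))"
        using F12(2,6) finP by (subst sum.Union_disjoint) (auto simp: pairwise_def disjnt_def)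
      then show "\<bar>\<Sum>u\<in>\<Union>F1. w u * (f u y - q)\<bar> \<le> (\<Sum>P\<in>F1. \<bar>\<Sum>u\<in>P. w u * (f u y - q)\<bar>)" by simp
    qed
    also have "\<dots> = (\<Sum>P\<in>F1. \<Sum>y\<in>V. \<bar>\<Sum>u\<in>P. w u * (f u y - q)\<bar>)" by (rule sum.swap)
    also have "\<dots> \<le> (\<Sum>P\<in>F1. c * N * card P)" by (intro sum_mono piece)
    also have "\<dots> = c * N * card (\<Union>F1)"
      using card_Union_sum[OF F12(4,6)] F12(2) finP by (simp add: sum_distrib_left subset_iff)
    also have "\<dots> \<le> c * N * N"
      using pos N card_mono[OF fin UV] by (intro mult_left_mono) (auto simp: N_def)
    finally show "(\<Sum>y\<in>V. \<bar>\<Sum>u\<in>\<Union>F1. w u * (f u y - q)\<bar>) \<le> c * real (card V) ^ 2"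
      by (simp add: N_def power2_eq_square mult_ac)
  qed
  with cardA show ?thesis by blast
qed

text \<open>Fixes the order of the constants: \<open>d0\<close> precedes \<open>\<eta>\<close>,
  since in the application the size \<open>\<eta>\<close> of regular sets is obtained from
  \<open>d\<close>, and \<open>e0\<close> may depend on both.\<close>

lemma uniform_set_of_rich_family:
  fixes q \<mu> c :: real
  assumes q: "0 < q" "q < 1" and k: "large_exponent q k" and \<mu>: "0 < \<mu>" and c: "0 < c"
  obtains d0 :: real where "0 < d0"
    "\<And>(d::real) (\<eta>::real). 0 < d \<Longrightarrow> d \<le> d0 \<Longrightarrow> 0 < \<eta> \<Longrightarrow> \<exists>e0>0. \<forall>(V :: 'a set) f F e.
       finite V \<longrightarrow> 0 < card V \<longrightarrow> edge_kernel f \<longrightarrow> finite F \<longrightarrow> pairwise disjnt F \<longrightarrow>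
       (\<forall>P\<in>F. regular_set V f d P \<and> \<eta> * real (card V) \<le> real (card P) \<and> clique_rich f k \<mu> P) \<longrightarrow>
       card V \<le> 3 * card (\<Union>F) \<longrightarrow> 0 \<le> e \<longrightarrow> e \<le> e0 \<longrightarrow>
       book_bounded V f q k e \<longrightarrow> book_bounded V (co_kernel f) (1 - q) k e \<longrightarrow>
       (\<exists>A. cut_uniform V f q c A \<and> card V \<le> 6 * card A)"
proof -
  have k2: "2 \<le> k" using k by (simp add: large_exponent_def)
  have c3: "0 < c / 3" using c by simp
  obtain \<kappa> where \<kappa>: "0 < \<kappa>"
      "\<And>xs x. length xs = k \<Longrightarrow> (\<And>x. x \<in> set xs \<Longrightarrow> 0 \<le> x \<and> x \<le> 1) \<Longrightarrow>
         x \<in> set xs \<Longrightarrow> c / 3 \<le> \<bar>x - q\<bar> \<Longrightarrow> 1 + \<kappa> \<le> book_sum q k xs"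
    by (rule book_sum_away[OF q k c3]) blast
  define s where "s = (1 / (2 * real k)) ^ k / 4"
  have s: "0 < s" using k2 by (simp add: s_def)
  define C where "C = q / q ^ k + (1 - q) / (1 - q) ^ k"
  have C: "0 < C" unfolding C_def using q by (intro add_pos_pos divide_pos_pos) auto
  define e1 where "e1 = min (1 / (48 * real k)) (\<kappa> * (c / 3) / C)"
  have e1: "0 < e1" using k2 \<kappa>(1) c C by (simp add: e1_def)
  have e1': "48 * real k * e1 \<le> 1" "C * e1 \<le> \<kappa> * (c / 3)"
  proof -
    have "e1 \<le> 1 / (48 * real k)" by (simp add: e1_def)
    then show "48 * real k * e1 \<le> 1" using k2 by (simp add: field_simps)
    have "e1 \<le> \<kappa> * (c / 3) / C" by (simp add: e1_def)
    then show "C * e1 \<le> \<kappa> * (c / 3)" unfolding pos_le_divide_eq[OF C] by (subst mult.commute)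
  qed
  \<comment> \<open>The clique densities of the two applications of the book bounds are
    \<open>\<mu>\<close> inside one set and \<open>s ^ k\<close> across \<open>k\<close> sets; the
    smaller one yields a single error estimate.\<close>
  define m where "m = min \<mu> (s ^ k)"
  have m: "0 < m" "m \<le> \<mu>" "m \<le> s ^ k" using \<mu> s by (auto simp: m_def)
  define d0 where "d0 = min (c / 3) (min (s ^ (k + 1) / (6 * real k)) (e1 * m / (2 * real k)))"
  have d0: "0 < d0" using c s e1 m k2 by (simp add: d0_def)
  show ?thesis
  proof (rule that[OF d0])
    fix d \<eta> :: real assume d: "0 < d" "d \<le> d0" and \<eta>: "0 < \<eta>"
    have dc: "d \<le> c / 3" using d(2) by (simp add: d0_def)
    have "d \<le> s ^ (k + 1) / (6 * real k)" using d(2) by (simp add: d0_def)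
    then have ds: "6 * real k * d \<le> s ^ (k + 1)" using k2 by (simp add: pos_le_divide_eq mult_ac)
    have "d \<le> e1 * m / (2 * real k)" using d(2) by (simp add: d0_def)
    then have dm: "real k * d \<le> e1 * m / 2" using k2 by (simp add: field_simps)
    define e0 where "e0 = e1 * m * \<eta> ^ k / 2"
    have e0: "0 < e0" using e1 m \<eta> by (simp add: e0_def)
    have err: "e / (\<nu> * \<eta> ^ k) + real k * d / \<nu> \<le> e1" if e: "e \<le> e0" and \<nu>: "m \<le> \<nu>" for e \<nu>
    proof -
      have \<nu>0: "0 < \<nu>" using m \<nu> by linarith
      have "e1 * m \<le> e1 * \<nu>" using e1 \<nu> by (intro mult_left_mono) auto
      then have "real k * d \<le> e1 * \<nu> / 2" using dm by linarith
      then have 1: "real k * d / \<nu> \<le> e1 / 2" using \<nu>0 by (simp add: field_simps)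
      have "e1 * m * \<eta> ^ k / 2 \<le> e1 * \<nu> * \<eta> ^ k / 2"
        using \<open>e1 * m \<le> e1 * \<nu>\<close> \<eta> by (intro divide_right_mono mult_right_mono) auto
      then have "e \<le> (e1 / 2) * (\<nu> * \<eta> ^ k)" using e by (simp add: e0_def)
      then have 2: "e / (\<nu> * \<eta> ^ k) \<le> e1 / 2" using \<nu>0 \<eta> by (simp add: pos_divide_le_eq)
      show ?thesis using 1 2 by linarith
    qed
    show "\<exists>e0>0. \<forall>(V :: 'a set) f F e.
       finite V \<longrightarrow> 0 < card V \<longrightarrow> edge_kernel f \<longrightarrow> finite F \<longrightarrow> pairwise disjnt F \<longrightarrow>
       (\<forall>P\<in>F. regular_set V f d P \<and> \<eta> * real (card V) \<le> real (card P) \<and> clique_rich f k \<mu> P) \<longrightarrow>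
       card V \<le> 3 * card (\<Union>F) \<longrightarrow> 0 \<le> e \<longrightarrow> e \<le> e0 \<longrightarrow>
       book_bounded V f q k e \<longrightarrow> book_bounded V (co_kernel f) (1 - q) k e \<longrightarrow>
       (\<exists>A. cut_uniform V f q c A \<and> card V \<le> 6 * card A)"
    proof (intro exI[of _ e0] conjI e0 allI impI)
      fix V :: "'a set" and f F e
      assume *: "finite V" "0 < card V" "edge_kernel f" "finite F" "pairwise disjnt F"
        "\<forall>P\<in>F. regular_set V f d P \<and> \<eta> * real (card V) \<le> real (card P) \<and> clique_rich f k \<mu> P"
        "card V \<le> 3 * card (\<Union>F)" "0 \<le> e" "e \<le> e0"
        "book_bounded V f q k e" "book_bounded V (co_kernel f) (1 - q) k e"
      show "\<exists>A. cut_uniform V f q c A \<and> card V \<le> 6 * card A"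
        by (rule uniform_set_aux[OF *(1,2,3) q k *(4,5) _ *(7,10,11) \<kappa> s_def \<mu> \<eta> *(8) _ c e1'(1)
              e1'(2)[unfolded C_def] ds dc err[OF *(9) m(2)] err[OF *(9) m(3)]])
          (use *(6) d in auto)
    qed
  qed
qed

subsection \<open>From the typical set to quasirandomness\<close>

lemma cut_uniform_co:
  assumes "cut_uniform V f q c A"
  shows "cut_uniform V (co_kernel f) (1 - q) c A"
proof -
  have "\<bar>\<Sum>u\<in>A. w u * (co_kernel f u y - (1 - q))\<bar> = \<bar>\<Sum>u\<in>A. w u * (f u y - q)\<bar>" for w y
  proof -
    have "(\<Sum>u\<in>A. w u * (co_kernel f u y - (1 - q))) = - (\<Sum>u\<in>A. w u * (f u y - q))"
      unfolding sum_negf[symmetric] by (intro sum.cong refl) (simp add: algebra_simps)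
    then show ?thesis by simp
  qed
  then show ?thesis using assms unfolding cut_uniform_def by simp
qed

text \<open>Common neighbours in \<open>A\<close> are counted for tuples from all of
  \<open>V\<close>. For a fixed tail \<open>l\<close>, \<open>common f l\<close> is itself a weight
  on \<open>A\<close>, so uniformity yields the factor \<open>q\<close> for the next vertex. The
  weights \<open>w\<close> are signed because surpluses will be inserted.\<close>

lemma cut_uniform_tuples:
  fixes c q :: real
  assumes fin: "finite V" and f: "edge_kernel f" and A: "cut_uniform V f q c A"
    and q: "0 \<le> q" "q \<le> 1" and w: "\<And>l. \<bar>w l\<bar> \<le> 1"
  shows "\<bar>\<Sum>l\<in>listset (replicate m V). w l * (\<Sum>a\<in>A. common f l a - q ^ m)\<bar>
    \<le> m * c * real (card V) ^ (m + 1)"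
  using w
proof (induction m arbitrary: w)
  case (Suc m)
  let ?L = "listset (replicate m V)" and ?N = "real (card V)"
  have A1: "(\<Sum>y\<in>V. \<bar>\<Sum>a\<in>A. common f l a * (f a y - q)\<bar>) \<le> c * ?N ^ 2" for l
    using A common_bounds[OF f] unfolding cut_uniform_def by blast
  have IH: "\<bar>\<Sum>l\<in>?L. w (u # l) * (\<Sum>a\<in>A. common f l a - q ^ m)\<bar> \<le> m * c * ?N ^ (m + 1)" for u
    by (intro Suc.IH Suc.prems)
  have "(\<Sum>l\<in>listset (replicate (Suc m) V). w l * (\<Sum>a\<in>A. common f l a - q ^ Suc m))
      = (\<Sum>u\<in>V. \<Sum>l\<in>?L. w (u # l) * (\<Sum>a\<in>A. f u a * common f l a - q * q ^ m))"
    unfolding replicate_Suc sum_listset_Cons by simp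
  also have "\<dots> = (\<Sum>u\<in>V. \<Sum>l\<in>?L. w (u # l) * (\<Sum>a\<in>A. common f l a * (f a u - q)))
      + (\<Sum>u\<in>V. q * (\<Sum>l\<in>?L. w (u # l) * (\<Sum>a\<in>A. common f l a - q ^ m)))"
    unfolding sum_distrib_left sum.distrib[symmetric]
    by (intro sum.cong refl) (simp add: algebra_simps kernel_sym[OF f])
  finally have eq: "(\<Sum>l\<in>listset (replicate (Suc m) V). w l * (\<Sum>a\<in>A. common f l a - q ^ Suc m)) = \<dots>" .
  have "\<bar>\<Sum>u\<in>V. \<Sum>l\<in>?L. w (u # l) * (\<Sum>a\<in>A. common f l a * (f a u - q))\<bar>
      \<le> (\<Sum>u\<in>V. \<Sum>l\<in>?L. \<bar>\<Sum>a\<in>A. common f l a * (f a u - q)\<bar>)"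
  proof -
    have "\<bar>w (u # l) * (\<Sum>a\<in>A. common f l a * (f a u - q))\<bar> \<le> \<bar>\<Sum>a\<in>A. common f l a * (f a u - q)\<bar>" for u l
      using Suc.prems[of "u # l"] unfolding abs_mult by (intro mult_left_le_one_le) auto
    then show ?thesis by (intro order_trans[OF sum_abs] sum_mono) auto
  qed
  also have "\<dots> = (\<Sum>l\<in>?L. \<Sum>u\<in>V. \<bar>\<Sum>a\<in>A. common f l a * (f a u - q)\<bar>)" by (rule sum.swap)
  also have "\<dots> \<le> (c * ?N ^ 2) * real (card ?L)" by (intro sum_le_card A1)
  also have "\<dots> = c * ?N ^ (m + 2)" by (simp add: card_tuples power_add power2_eq_square)
  finally have b1: "\<bar>\<Sum>u\<in>V. \<Sum>l\<in>?L. w (u # l) * (\<Sum>a\<in>A. common f l a * (f a u - q))\<bar> \<le> c * ?N ^ (m + 2)" .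
  have "\<bar>\<Sum>u\<in>V. q * (\<Sum>l\<in>?L. w (u # l) * (\<Sum>a\<in>A. common f l a - q ^ m))\<bar>
      \<le> (\<Sum>u\<in>V. m * c * ?N ^ (m + 1))"
  proof (intro order_trans[OF sum_abs] sum_mono)
    fix u
    have "\<bar>q * (\<Sum>l\<in>?L. w (u # l) * (\<Sum>a\<in>A. common f l a - q ^ m))\<bar>
        \<le> \<bar>\<Sum>l\<in>?L. w (u # l) * (\<Sum>a\<in>A. common f l a - q ^ m)\<bar>"
      using q unfolding abs_mult by (intro mult_left_le_one_le) auto
    with IH[of u] show "\<bar>q * (\<Sum>l\<in>?L. w (u # l) * (\<Sum>a\<in>A. common f l a - q ^ m))\<bar> \<le> m * c * ?N ^ (m + 1)"
      by linarith
  qed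
  also have "\<dots> = m * c * ?N ^ (m + 2)" by simp
  finally have "\<bar>\<Sum>u\<in>V. q * (\<Sum>l\<in>?L. w (u # l) * (\<Sum>a\<in>A. common f l a - q ^ m))\<bar> \<le> m * c * ?N ^ (m + 2)" .
  with b1 have "\<bar>\<Sum>l\<in>listset (replicate (Suc m) V). w l * (\<Sum>a\<in>A. common f l a - q ^ Suc m)\<bar>
      \<le> c * ?N ^ (m + 2) + m * c * ?N ^ (m + 2)"
    unfolding eq by linarith
  then show ?case by (simp add: algebra_simps)
qed simp

text \<open>A tuple \<open>l\<close> is prolonged by a common neighbour \<open>a\<close> in
  \<open>A\<close>. There are about \<open>q ^ m * card A\<close> of these, and on average
  \<open>a\<close> keeps a fraction \<open>q\<close> of the extensions, so a surplus of
  \<open>l\<close> survives with factor \<open>q ^ Suc m * card A\<close>. The error is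
  \<open>e\<close> from the longer books, \<open>c\<close> from the edges at \<open>a\<close> and at
  most \<open>m * c\<close> from counting \<open>a\<close>; the 6 comes from dividing by
  \<open>card A\<close>.\<close>

lemma book_bounded_decrease:
  fixes c q e :: real
  assumes fin: "finite V" and f: "edge_kernel f" and A: "cut_uniform V f q c A"
    and cardA: "card V \<le> 6 * card A" and q: "0 < q" "q \<le> 1"
    and bb: "book_bounded V f q (Suc m) e" and pos: "0 \<le> e" "0 \<le> c"
  shows "book_bounded V f q m (6 * (e + real (m + 1) * c) / q ^ Suc m)"
  unfolding book_bounded_def
proof (intro allI impI)
  fix w :: "'a list \<Rightarrow> real" assume w: "\<forall>l. 0 \<le> w l \<and> w l \<le> 1"
  let ?L = "listset (replicate m V)" and ?N = "real (card V)"
  define W where "W l = w l * clique_wt f l" for l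
  define E where "E l = (\<Sum>y\<in>V. common f l y) - q ^ m * ?N" for l
  define X where "X = (\<Sum>l\<in>?L. W l * E l)"
  have W: "0 \<le> W l" "W l \<le> 1" for l
    unfolding W_def using w clique_wt_bounds[OF f, of l] by (auto intro: mult_le_one)
  have E: "\<bar>E l\<bar> \<le> ?N" for l
  proof -
    have "0 \<le> (\<Sum>y\<in>V. common f l y)" using common_bounds[OF f] by (intro sum_nonneg)
    moreover have "(\<Sum>y\<in>V. common f l y) \<le> 1 * ?N" using common_bounds[OF f] by (intro sum_le_card)
    moreover have "q ^ m * ?N \<le> 1 * ?N"
      using q by (intro mult_right_mono power_le_one) auto
    moreover have "0 \<le> q ^ m * ?N" using q by simp
    ultimately show ?thesis unfolding E_def by linarith
  qed
  have AV: "A \<subseteq> V" using A by (simp add: cut_uniform_def)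
  have X: "X \<le> (6 * (e + real (m + 1) * c) / q ^ Suc m) * ?N ^ (m + 1)"
  proof (cases "V = {}")
    case True
    then have "\<And>l. E l = 0" using E by simp
    then show ?thesis using True by (simp add: X_def)
  next
    case False
    then have N: "0 < ?N" using fin by (simp add: card_gt_0_iff)
    \<comment> \<open>The weight forces the head into \<open>A\<close> and passes the given weight
      to the tail.\<close>
    have "(\<Sum>l\<in>listset (replicate (Suc m) V). (if hd l \<in> A then w (tl l) else 0) * clique_wt f l *
        ((\<Sum>y\<in>V. common f l y) - q ^ Suc m * ?N)) \<le> e * ?N ^ (Suc m + 1)"
      using bb[unfolded book_bounded_def, rule_format, of "\<lambda>l. if hd l \<in> A then w (tl l) else 0"] w by simp
    also have "(\<Sum>l\<in>listset (replicate (Suc m) V). (if hd l \<in> A then w (tl l) else 0) * clique_wt f l *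
        ((\<Sum>y\<in>V. common f l y) - q ^ Suc m * ?N))
      = (\<Sum>a\<in>A. \<Sum>l\<in>?L. W l * common f l a * ((\<Sum>y\<in>V. f a y * common f l y) - q ^ Suc m * ?N))"
      unfolding replicate_Suc sum_listset_Cons W_def
      by (rule sum.mono_neutral_cong_right) (use AV fin in \<open>auto simp: mult_ac\<close>)
    also have "\<dots> = (\<Sum>l\<in>?L. \<Sum>a\<in>A. W l * common f l a * ((\<Sum>y\<in>V. f a y * common f l y) - q ^ Suc m * ?N))"
      by (rule sum.swap)
    also have "\<dots> = (\<Sum>l\<in>?L. W l * (\<Sum>y\<in>V. common f l y * (\<Sum>a\<in>A. common f l a * (f a y - q)))
        + q * (W l * E l * (\<Sum>a\<in>A. common f l a)))"
    proof (rule sum.cong[OF refl])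
      fix l
      have "(\<Sum>a\<in>A. common f l a * ((\<Sum>y\<in>V. f a y * common f l y) - q ^ Suc m * ?N))
         = (\<Sum>a\<in>A. (\<Sum>y\<in>V. common f l y * (common f l a * (f a y - q))) + common f l a * (q * E l))"
        unfolding E_def
        by (intro sum.cong refl) (simp add: algebra_simps sum_subtractf sum_distrib_left)
      also have "\<dots> = (\<Sum>y\<in>V. common f l y * (\<Sum>a\<in>A. common f l a * (f a y - q)))
          + (\<Sum>a\<in>A. common f l a) * (q * E l)"
        unfolding sum.distrib sum_distrib_right sum_distrib_left by (subst sum.swap) (rule refl)
      finally have "W l * (\<Sum>a\<in>A. common f l a * ((\<Sum>y\<in>V. f a y * common f l y) - q ^ Suc m * ?N))
         = W l * \<dots>" by simp
      then show "(\<Sum>a\<in>A. W l * common f l a * ((\<Sum>y\<in>V. f a y * common f l y) - q ^ Suc m * ?N))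
         = W l * (\<Sum>y\<in>V. common f l y * (\<Sum>a\<in>A. common f l a * (f a y - q)))
           + q * (W l * E l * (\<Sum>a\<in>A. common f l a))"
        by (simp add: sum_distrib_left mult.assoc distrib_left mult_ac)
    qed
    also have "\<dots> = (\<Sum>l\<in>?L. W l * (\<Sum>y\<in>V. common f l y * (\<Sum>a\<in>A. common f l a * (f a y - q))))
        + q * (\<Sum>l\<in>?L. W l * E l * (\<Sum>a\<in>A. common f l a))"
      by (simp add: sum.distrib sum_distrib_left)
    finally have 1: "(\<Sum>l\<in>?L. W l * (\<Sum>y\<in>V. common f l y * (\<Sum>a\<in>A. common f l a * (f a y - q))))
        + q * (\<Sum>l\<in>?L. W l * E l * (\<Sum>a\<in>A. common f l a)) \<le> e * ?N ^ (m + 2)" by simp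
    have 2: "\<bar>\<Sum>l\<in>?L. W l * (\<Sum>y\<in>V. common f l y * (\<Sum>a\<in>A. common f l a * (f a y - q)))\<bar>
        \<le> c * ?N ^ (m + 2)"
    proof -
      have "\<bar>W l * (\<Sum>y\<in>V. common f l y * (\<Sum>a\<in>A. common f l a * (f a y - q)))\<bar> \<le> c * ?N ^ 2" for l
      proof -
        have "\<bar>W l * (\<Sum>y\<in>V. common f l y * (\<Sum>a\<in>A. common f l a * (f a y - q)))\<bar>
            \<le> \<bar>\<Sum>y\<in>V. common f l y * (\<Sum>a\<in>A. common f l a * (f a y - q))\<bar>"
          using W[of l] unfolding abs_mult by (intro mult_left_le_one_le) auto
        also have "\<dots> \<le> (\<Sum>y\<in>V. \<bar>\<Sum>a\<in>A. common f l a * (f a y - q)\<bar>)"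
          using common_bounds[OF f]
          by (intro order_trans[OF sum_abs] sum_mono) (auto simp: abs_mult intro!: mult_left_le_one_le)
        also have "\<dots> \<le> c * ?N ^ 2"
          using A common_bounds[OF f] unfolding cut_uniform_def by blast
        finally show ?thesis .
      qed
      then have "\<bar>\<Sum>l\<in>?L. W l * (\<Sum>y\<in>V. common f l y * (\<Sum>a\<in>A. common f l a * (f a y - q)))\<bar>
          \<le> (c * ?N ^ 2) * real (card ?L)"
        by (intro order_trans[OF sum_abs] sum_le_card)
      also have "\<dots> = c * ?N ^ (m + 2)" by (simp add: card_tuples power_add power2_eq_square)
      finally show ?thesis .
    qed
    \<comment> \<open>The surplus \<open>E l\<close> can be negative; divided by \<open>?N\<close>
      it becomes an admissible signed weight.\<close>
    have 3: "\<bar>(\<Sum>l\<in>?L. W l * E l * (\<Sum>a\<in>A. common f l a)) - q ^ m * card A * X\<bar> \<le> m * c * ?N ^ (m + 2)"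
    proof -
      have "\<bar>W l * (E l / ?N)\<bar> \<le> 1" for l
        using W[of l] E[of l] N unfolding abs_mult by (intro mult_le_one) (auto simp: divide_le_eq)
      then have "\<bar>\<Sum>l\<in>?L. (W l * (E l / ?N)) * (\<Sum>a\<in>A. common f l a - q ^ m)\<bar> \<le> m * c * ?N ^ (m + 1)"
        using q by (intro cut_uniform_tuples[OF fin f A]) auto
      then have "?N * \<bar>\<Sum>l\<in>?L. (W l * (E l / ?N)) * (\<Sum>a\<in>A. common f l a - q ^ m)\<bar> \<le> ?N * (m * c * ?N ^ (m + 1))"
        using N by (intro mult_left_mono) auto
      moreover have "?N * \<bar>\<Sum>l\<in>?L. (W l * (E l / ?N)) * (\<Sum>a\<in>A. common f l a - q ^ m)\<bar>
          = \<bar>?N * (\<Sum>l\<in>?L. (W l * (E l / ?N)) * (\<Sum>a\<in>A. common f l a - q ^ m))\<bar>"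
        by (simp add: abs_mult)
      moreover have "?N * (\<Sum>l\<in>?L. (W l * (E l / ?N)) * (\<Sum>a\<in>A. common f l a - q ^ m))
          = (\<Sum>l\<in>?L. W l * E l * (\<Sum>a\<in>A. common f l a)) - q ^ m * card A * X"
      proof -
        have "?N * ((W l * (E l / ?N)) * (\<Sum>a\<in>A. common f l a - q ^ m))
            = W l * E l * (\<Sum>a\<in>A. common f l a) - q ^ m * card A * (W l * E l)" for l
          using N by (simp add: sum_subtractf algebra_simps)
        then show ?thesis unfolding X_def sum_distrib_left by (simp add: sum_subtractf)
      qed
      ultimately show ?thesis by (simp add: mult_ac)
    qed
    have "q * (q ^ m * card A * X) \<le> q * ((\<Sum>l\<in>?L. W l * E l * (\<Sum>a\<in>A. common f l a)) + m * c * ?N ^ (m + 2))"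
      using 3 q by (intro mult_left_mono) linarith+
    also have "\<dots> \<le> e * ?N ^ (m + 2) + c * ?N ^ (m + 2) + q * (m * c * ?N ^ (m + 2))"
      using 1 2 unfolding distrib_left by linarith
    also have "\<dots> \<le> e * ?N ^ (m + 2) + c * ?N ^ (m + 2) + 1 * (m * c * ?N ^ (m + 2))"
      using q pos by (intro add_left_mono mult_right_mono) auto
    also have "\<dots> = (e + real (m + 1) * c) * ?N ^ (m + 1) * ?N" by (simp add: algebra_simps)
    also have "\<dots> \<le> (e + real (m + 1) * c) * ?N ^ (m + 1) * (6 * card A)"
      using cardA pos by (intro mult_left_mono) auto
    finally have "card A * (q ^ Suc m * X) \<le> card A * (6 * (e + real (m + 1) * c) * ?N ^ (m + 1))"
      by (simp add: mult_ac)
    moreover have "0 < real (card A)" using cardA N by linarith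
    ultimately have "q ^ Suc m * X \<le> 6 * (e + real (m + 1) * c) * ?N ^ (m + 1)" by (rule mult_left_le_imp_le)
    then have "X \<le> 6 * (e + real (m + 1) * c) * ?N ^ (m + 1) / q ^ Suc m"
      using q by (simp add: pos_le_divide_eq mult.commute)
    then show ?thesis by simp
  qed
  show "(\<Sum>l\<in>?L. w l * clique_wt f l * ((\<Sum>y\<in>V. common f l y) - q ^ m * ?N))
      \<le> (6 * (e + real (m + 1) * c) / q ^ Suc m) * ?N ^ (m + 1)"
    using X unfolding X_def W_def E_def .
qed

lemma book_bounded_mono: "book_bounded V f q m e \<Longrightarrow> e \<le> e' \<Longrightarrow> book_bounded V f q m e'"
  unfolding book_bounded_def by (meson mult_right_mono of_nat_0_le_iff order_trans zero_le_power)

lemma book_bounded_descend: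
  fixes q \<epsilon> :: real
  assumes q: "0 < q" "q \<le> 1" and \<epsilon>: "0 < \<epsilon>"
  obtains c :: real where "0 < c"
    "\<And>(V :: 'a set) (f :: 'a \<Rightarrow> 'a \<Rightarrow> real) A. finite V \<Longrightarrow> edge_kernel f \<Longrightarrow> cut_uniform V f q c A \<Longrightarrow> card V \<le> 6 * card A \<Longrightarrow>
       book_bounded V f q (m + r) c \<Longrightarrow> book_bounded V f q m \<epsilon>"
proof -
  have "\<exists>c::real. 0 < c \<and> (\<forall>(V :: 'a set) (f :: 'a \<Rightarrow> 'a \<Rightarrow> real) A. finite V \<longrightarrow> edge_kernel f \<longrightarrow> cut_uniform V f q c A \<longrightarrow>
      card V \<le> 6 * card A \<longrightarrow> book_bounded V f q (m + r) c \<longrightarrow> book_bounded V f q m \<epsilon>)"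
  proof (induction r)
    case 0
    then show ?case using \<epsilon> by auto
  next
    case (Suc r)
    then obtain c where c: "0 < c" "\<And>(V :: 'a set) (f :: 'a \<Rightarrow> 'a \<Rightarrow> real) A. finite V \<Longrightarrow> edge_kernel f \<Longrightarrow>
      cut_uniform V f q c A \<Longrightarrow> card V \<le> 6 * card A \<Longrightarrow> book_bounded V f q (m + r) c \<Longrightarrow> book_bounded V f q m \<epsilon>"
      by blast
    \<comment> \<open>Chosen so that one lowering step turns \<open>c'\<close>, as book error and as
      uniformity error, into exactly \<open>c\<close>.\<close>
    define c' where "c' = c * q ^ Suc (m + r) / (6 * (real (m + r) + 2))"
    have c': "0 < c'" using c(1) q by (simp add: c'_def)
    have "c' \<le> c"
    proof -
      have "q ^ Suc (m + r) \<le> 1" using q by (intro power_le_one) auto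
      then have "c * q ^ Suc (m + r) \<le> c * (6 * (real (m + r) + 2))"
        using c(1) by (intro mult_left_mono) auto
      then show ?thesis by (simp add: c'_def divide_le_eq)
    qed
    have eq: "6 * (c' + (real (m + r) + 1) * c') / q ^ Suc (m + r) = c"
    proof -
      have "6 * (c' + (real (m + r) + 1) * c') = c' * (6 * (real (m + r) + 2))" by (simp add: algebra_simps)
      also have "\<dots> = c * q ^ Suc (m + r)" unfolding c'_def by simp
      finally show ?thesis using q by simp
    qed
    show ?case
    proof (intro exI[of _ c'] conjI allI impI c')
      fix V :: "'a set" and f :: "'a \<Rightarrow> 'a \<Rightarrow> real" and A
      assume *: "finite V" "edge_kernel f" "cut_uniform V f q c' A" "card V \<le> 6 * card A"
        "book_bounded V f q (m + Suc r) c'"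
      have "book_bounded V f q (m + r) c"
        using book_bounded_decrease[OF *(1,2,3,4) q, of "m + r" c'] *(5) c' eq by (simp add: add_ac)
      moreover have "cut_uniform V f q c A"
        using *(3) \<open>c' \<le> c\<close> unfolding cut_uniform_def
        by (meson mult_right_mono order_trans zero_le_power of_nat_0_le_iff)
      ultimately show "book_bounded V f q m \<epsilon>" using * by (intro c(2)) auto
    qed
  qed
  then obtain c :: real where c: "0 < c" "\<forall>(V :: 'a set) (f :: 'a \<Rightarrow> 'a \<Rightarrow> real) A. finite V \<longrightarrow> edge_kernel f \<longrightarrow>
      cut_uniform V f q c A \<longrightarrow> card V \<le> 6 * card A \<longrightarrow> book_bounded V f q (m + r) c \<longrightarrow> book_bounded V f q m \<epsilon>"
    by blast
  show ?thesis by (rule that[OF c(1)]) (rule c(2)[rule_format])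
qed

section \<open>Degrees and codegrees\<close>

lemma sum_tuples_1:
  fixes g :: "'a list \<Rightarrow> 'b :: comm_monoid_add"
  shows "(\<Sum>l\<in>listset (replicate 1 V). g l) = (\<Sum>u\<in>V. g [u])"
  and sum_tuples_2: "(\<Sum>l\<in>listset (replicate 2 V). g l) = (\<Sum>u\<in>V. \<Sum>v\<in>V. g [u, v])"
proof -
  have nil: "(\<Sum>l\<in>listset []. h l) = h []" for h :: "'a list \<Rightarrow> 'b :: comm_monoid_add" by simp
  show "(\<Sum>l\<in>listset (replicate 1 V). g l) = (\<Sum>u\<in>V. g [u])"
    unfolding One_nat_def replicate_Suc replicate_0 sum_listset_Cons nil ..
  show "(\<Sum>l\<in>listset (replicate 2 V). g l) = (\<Sum>u\<in>V. \<Sum>v\<in>V. g [u, v])"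
    unfolding numeral_2_eq_2 replicate_Suc replicate_0 sum_listset_Cons nil ..
qed

text \<open>The codegree count of Chung, Graham and Wilson, with the codegree bounds over the edges and
  over the non-edges coming from the two book bounds on pairs.\<close>

lemma book_bounded_imp_uniform:
  fixes q e :: real
  assumes fin: "finite V" and f: "edge_kernel f" and q: "0 \<le> q" "q \<le> 1" and e: "0 \<le> e"
    and b1: "book_bounded V f q 1 e" "book_bounded V (co_kernel f) (1 - q) 1 e"
    and b2: "book_bounded V f q 2 e" "book_bounded V (co_kernel f) (1 - q) 2 e"
    and XY: "X \<subseteq> V" "Y \<subseteq> V"
  shows "(\<Sum>x\<in>X. \<Sum>y\<in>Y. f x y - q)\<^sup>2 \<le> 10 * e * real (card V) ^ 4"
proof -
  define N where "N = real (card V)"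
  define D where "D u = (\<Sum>y\<in>V. f u y) - q * N" for u
  define E where "E u v = (\<Sum>y\<in>V. f u y * f v y) - q\<^sup>2 * N" for u v
  have N0: "0 \<le> N" by (simp add: N_def)
  have finXY: "finite X" "finite Y" using XY fin finite_subset by auto
  have co_deg: "(\<Sum>y\<in>V. 1 - f u y) - (1 - q) * N = - D u" for u
    by (simp add: D_def N_def sum_subtractf algebra_simps)
  have co_codeg: "(\<Sum>y\<in>V. (1 - f u y) * (1 - f v y)) - (1 - q)\<^sup>2 * N = E u v - D u - D v" for u v
    by (simp add: D_def E_def N_def sum_subtractf sum.distrib power2_eq_square algebra_simps)
  have deg1: "(\<Sum>u\<in>V. w u * D u) \<le> e * N\<^sup>2" if "\<And>u. 0 \<le> w u \<and> w u \<le> 1" for w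
    using b1(1)[unfolded book_bounded_def sum_tuples_1, rule_format, of "\<lambda>l. w (hd l)"] that
    by (simp add: D_def N_def numeral_2_eq_2)
  have deg2: "(\<Sum>u\<in>V. w u * - D u) \<le> e * N\<^sup>2" if "\<And>u. 0 \<le> w u \<and> w u \<le> 1" for w
    using b1(2)[unfolded book_bounded_def sum_tuples_1, rule_format, of "\<lambda>l. w (hd l)"] that
    unfolding co_deg[symmetric] by (simp add: N_def numeral_2_eq_2)
  \<comment> \<open>A single vertex is a clique of both kernels, so the two one-sided bounds concern
    the same \<open>D u\<close> with opposite signs and combine to an \<open>l1\<close>
    bound.\<close>
  have deg: "(\<Sum>u\<in>V. \<bar>D u\<bar>) \<le> 2 * e * N\<^sup>2"
  proof -
    have "(\<Sum>u\<in>V. \<bar>D u\<bar>) = (\<Sum>u\<in>V. of_bool (D u > 0) * D u) + (\<Sum>u\<in>V. of_bool (D u < 0) * - D u)"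
      unfolding sum.distrib[symmetric] by (intro sum.cong refl) auto
    also have "\<dots> \<le> e * N\<^sup>2 + e * N\<^sup>2" by (intro add_mono deg1 deg2) auto
    finally show ?thesis by simp
  qed
  define I where "I u v = (of_bool (u \<in> X \<and> v \<in> X) :: real)" for u v
  have I: "0 \<le> I u v" "I u v \<le> 1" for u v by (auto simp: I_def)
  have codeg1: "(\<Sum>u\<in>V. \<Sum>v\<in>V. I u v * f v u * E u v) \<le> e * N ^ 3"
    using b2(1)[unfolded book_bounded_def sum_tuples_2, rule_format, of "\<lambda>l. I (l ! 0) (l ! 1)"] I
    by (simp add: E_def N_def power2_eq_square numeral_3_eq_3)
  have codeg2: "(\<Sum>u\<in>V. \<Sum>v\<in>V. I u v * (1 - f v u) * (E u v - D u - D v)) \<le> e * N ^ 3"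
    using b2(2)[unfolded book_bounded_def sum_tuples_2, rule_format, of "\<lambda>l. I (l ! 0) (l ! 1)"] I
    unfolding co_codeg[symmetric] by (simp add: N_def power2_eq_square numeral_3_eq_3)
  have "N * (\<Sum>u\<in>V. \<bar>D u\<bar>) \<le> N * (2 * e * N\<^sup>2)" by (intro mult_left_mono deg N0)
  also have "\<dots> = 2 * e * N ^ 3" by (simp add: power2_eq_square numeral_3_eq_3)
  finally have ND: "N * (\<Sum>u\<in>V. \<bar>D u\<bar>) \<le> 2 * e * N ^ 3" .
  have sumD: "(\<Sum>u\<in>V. \<Sum>v\<in>V. \<bar>D u\<bar>) \<le> 2 * e * N ^ 3" "(\<Sum>u\<in>V. \<Sum>v\<in>V. \<bar>D v\<bar>) \<le> 2 * e * N ^ 3"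
    using ND by (simp_all add: N_def flip: sum_distrib_left)
  \<comment> \<open>Edges use the first book bound on pairs, non-edges the second, whose surplus is
    \<open>E u v - D u - D v\<close>; the degree terms are added back. The constant is 1 + 1 + 2 + 2
    = 6. Only an upper bound is sought, as a second moment is to be bounded.\<close>
  have "(\<Sum>u\<in>V. \<Sum>v\<in>V. I u v * E u v)
      = (\<Sum>u\<in>V. \<Sum>v\<in>V. I u v * f v u * E u v)
        + (\<Sum>u\<in>V. \<Sum>v\<in>V. I u v * (1 - f v u) * (E u v - D u - D v))
        + (\<Sum>u\<in>V. \<Sum>v\<in>V. I u v * (1 - f v u) * (D u + D v))"
    unfolding sum.distrib[symmetric] by (intro sum.cong refl) (simp add: algebra_simps)
  also have "(\<Sum>u\<in>V. \<Sum>v\<in>V. I u v * (1 - f v u) * (D u + D v)) \<le> (\<Sum>u\<in>V. \<Sum>v\<in>V. \<bar>D u\<bar> + \<bar>D v\<bar>)"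
  proof (intro sum_mono)
    fix u v
    have c: "0 \<le> I u v * (1 - f v u)" "I u v * (1 - f v u) \<le> 1"
      using I[of u v] kernel_nonneg[OF f, of v u] kernel_le_1[OF f, of v u]
      by (auto intro: mult_le_one)
    have "I u v * (1 - f v u) * (D u + D v) \<le> (I u v * (1 - f v u)) * \<bar>D u + D v\<bar>"
      using c by (intro mult_left_mono) auto
    also have "\<dots> \<le> \<bar>D u + D v\<bar>" using c by (intro mult_left_le_one_le) auto
    finally show "I u v * (1 - f v u) * (D u + D v) \<le> \<bar>D u\<bar> + \<bar>D v\<bar>" by linarith
  qed
  also have "\<dots> = (\<Sum>u\<in>V. \<Sum>v\<in>V. \<bar>D u\<bar>) + (\<Sum>u\<in>V. \<Sum>v\<in>V. \<bar>D v\<bar>)" by (simp add: sum.distrib)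
  finally have sumE: "(\<Sum>u\<in>V. \<Sum>v\<in>V. I u v * E u v) \<le> 6 * e * N ^ 3"
    using codeg1 codeg2 sumD by linarith
  have XE: "(\<Sum>u\<in>X. \<Sum>v\<in>X. E u v) = (\<Sum>u\<in>V. \<Sum>v\<in>V. I u v * E u v)"
  proof -
    have "(\<Sum>u\<in>V. \<Sum>v\<in>V. I u v * E u v) = (\<Sum>u\<in>X. \<Sum>v\<in>V. I u v * E u v)"
      by (rule sum.mono_neutral_right) (use XY fin in \<open>auto simp: I_def\<close>)
    also have "\<dots> = (\<Sum>u\<in>X. \<Sum>v\<in>X. E u v)"
    proof (rule sum.cong[OF refl])
      fix u assume "u \<in> X"
      then show "(\<Sum>v\<in>V. I u v * E u v) = (\<Sum>v\<in>X. E u v)"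
        by (intro sum.mono_neutral_cong_right) (use XY fin in \<open>auto simp: I_def\<close>)
    qed
    finally show ?thesis ..
  qed
  \<comment> \<open>Expanding the square leaves the codegree surplus and degree terms of total size
    at most 4, so that 6 becomes 10.\<close>
  have "(\<Sum>y\<in>V. (\<Sum>x\<in>X. f x y - q)\<^sup>2) = (\<Sum>y\<in>V. \<Sum>u\<in>X. \<Sum>v\<in>X. (f u y - q) * (f v y - q))"
    by (simp add: power2_eq_square sum_product)
  also have "\<dots> = (\<Sum>u\<in>X. \<Sum>v\<in>X. \<Sum>y\<in>V. (f u y - q) * (f v y - q))"
    by (subst sum.swap) (intro sum.cong refl sum.swap)
  also have "\<dots> = (\<Sum>u\<in>X. \<Sum>v\<in>X. E u v - q * (D u + D v))"
    by (intro sum.cong refl)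
      (simp add: D_def E_def N_def sum_subtractf sum.distrib sum_distrib_left power2_eq_square algebra_simps)
  also have "\<dots> \<le> (\<Sum>u\<in>X. \<Sum>v\<in>X. E u v) + (\<Sum>u\<in>X. \<Sum>v\<in>X. \<bar>D u\<bar> + \<bar>D v\<bar>)"
    unfolding sum.distrib[symmetric]
  proof (intro sum_mono)
    fix u v
    have "- (q * (D u + D v)) \<le> \<bar>q * (D u + D v)\<bar>" by (rule abs_ge_minus_self)
    also have "\<dots> \<le> \<bar>D u + D v\<bar>" using q unfolding abs_mult by (intro mult_left_le_one_le) auto
    finally show "E u v - q * (D u + D v) \<le> E u v + (\<bar>D u\<bar> + \<bar>D v\<bar>)" by linarith
  qed
  also have "(\<Sum>u\<in>X. \<Sum>v\<in>X. \<bar>D u\<bar> + \<bar>D v\<bar>) \<le> (\<Sum>u\<in>V. \<Sum>v\<in>V. \<bar>D u\<bar> + \<bar>D v\<bar>)"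
  proof -
    have "(\<Sum>u\<in>X. \<Sum>v\<in>X. \<bar>D u\<bar> + \<bar>D v\<bar>) \<le> (\<Sum>u\<in>X. \<Sum>v\<in>V. \<bar>D u\<bar> + \<bar>D v\<bar>)"
      using XY fin by (intro sum_mono sum_mono2) auto
    also have "\<dots> \<le> (\<Sum>u\<in>V. \<Sum>v\<in>V. \<bar>D u\<bar> + \<bar>D v\<bar>)"
      using XY fin by (intro sum_mono2 sum_nonneg) auto
    finally show ?thesis .
  qed
  also have "\<dots> = (\<Sum>u\<in>V. \<Sum>v\<in>V. \<bar>D u\<bar>) + (\<Sum>u\<in>V. \<Sum>v\<in>V. \<bar>D v\<bar>)" by (simp add: sum.distrib)
  finally have sq: "(\<Sum>y\<in>V. (\<Sum>x\<in>X. f x y - q)\<^sup>2) \<le> 10 * e * N ^ 3"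
    using XE sumE sumD by linarith
  have "(\<Sum>x\<in>X. \<Sum>y\<in>Y. f x y - q)\<^sup>2 = (\<Sum>y\<in>Y. \<Sum>x\<in>X. f x y - q)\<^sup>2" by (subst sum.swap) (rule refl)
  also have "\<dots> \<le> (\<Sum>y\<in>Y. (\<Sum>x\<in>X. f x y - q)\<^sup>2) * card Y" by (rule sum_squared_le_sum_of_squares)
  also have "\<dots> \<le> (\<Sum>y\<in>V. (\<Sum>x\<in>X. f x y - q)\<^sup>2) * N"
  proof (rule mult_mono)
    show "real (card Y) \<le> N" unfolding N_def using card_mono[OF fin XY(2)] by simp
    show "(\<Sum>y\<in>Y. (\<Sum>x\<in>X. f x y - q)\<^sup>2) \<le> (\<Sum>y\<in>V. (\<Sum>x\<in>X. f x y - q)\<^sup>2)"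
      by (rule sum_mono2[OF fin XY(2)]) simp
  qed (auto intro: sum_nonneg)
  also have "\<dots> \<le> (10 * e * N ^ 3) * N" using N0 by (intro mult_right_mono sq)
  also have "\<dots> = 10 * e * N ^ 4" by (simp add: numeral_3_eq_3 power4_eq_xxxx)
  finally show ?thesis by (simp add: N_def)
qed

subsection \<open>Colorings\<close>

text \<open>Loops get the color of the singleton \<open>{u}\<close>. This makes the kernels of the two colors exactly
  complementary, at the price of counting up to \<open>k\<close> vertices of a clique as extensions of it.\<close>

definition color_kernel :: "('a set \<Rightarrow> color) \<Rightarrow> color \<Rightarrow> 'a \<Rightarrow> 'a \<Rightarrow> real" where
  "color_kernel c a u v = of_bool (c {u, v} = a)"

lemma color_kernel_edge_kernel: "edge_kernel (color_kernel c a)"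
  unfolding edge_kernel_def color_kernel_def by (simp add: insert_commute)

lemma color_kernel_Red: "color_kernel c Red = co_kernel (color_kernel c Blue)"
proof (intro ext)
  show "color_kernel c Red u v = co_kernel (color_kernel c Blue) u v" for u v
    by (cases "c {u, v}") (simp_all add: color_kernel_def)
qed

lemma mem_tuples_iff: "l \<in> listset (replicate m V) \<longleftrightarrow> set l \<subseteq> V \<and> length l = m"
proof (induction m arbitrary: l)
  case (Suc m)
  then show ?case by (cases l) (auto simp: set_Cons_def)
qed auto

lemma common_color_kernel: "common (color_kernel c a) l y = of_bool (\<forall>u\<in>set l. c {u, y} = a)"
  by (induction l) (auto simp: color_kernel_def)

lemma clique_wt_color_kernel:
  assumes "clique_wt (color_kernel c a) l \<noteq> 0" "u \<in> set l" "v \<in> set l" "u \<noteq> v"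
  shows "c {u, v} = a"
  using assms
proof (induction l)
  case (Cons x l)
  then show ?case by (auto simp: common_color_kernel insert_commute split: if_splits)
qed simp

text \<open>Either the head is one of at most \<open>m\<close> vertices of the tail or the tail
  repeats, and \<open>m + m\<^sup>2\<close> is at most \<open>(m + 1)\<^sup>2\<close>.\<close>

lemma count_repeating_tuples:
  assumes "finite V"
  shows "real (card V) * (\<Sum>l\<in>listset (replicate m V). of_bool (\<not> distinct l)) \<le> real (m\<^sup>2) * real (card V) ^ m"
proof (induction m)
  case (Suc m)
  let ?L = "listset (replicate m V)" and ?N = "real (card V)"
  have "(\<Sum>l\<in>listset (replicate (Suc m) V). of_bool (\<not> distinct l) :: real)
      \<le> (\<Sum>u\<in>V. \<Sum>l\<in>?L. of_bool (u \<in> set l) + of_bool (\<not> distinct l))"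
    unfolding replicate_Suc sum_listset_Cons by (intro sum_mono) auto
  also have "\<dots> = (\<Sum>l\<in>?L. \<Sum>u\<in>V. of_bool (u \<in> set l)) + ?N * (\<Sum>l\<in>?L. of_bool (\<not> distinct l))"
    unfolding sum.distrib by (subst sum.swap) simp
  also have "(\<Sum>l\<in>?L. \<Sum>u\<in>V. of_bool (u \<in> set l) :: real) \<le> real m * real (card ?L)"
  proof (rule sum_le_card)
    fix l assume l: "l \<in> ?L"
    have "(\<Sum>u\<in>V. of_bool (u \<in> set l) :: real) = card (V \<inter> set l)"
      using assms by (simp add: of_bool_def sum.If_cases)
    also have "\<dots> \<le> card (set l)" by (simp add: card_mono)
    also have "\<dots> \<le> m" using l card_length[of l] by (simp add: mem_tuples_iff)
    finally show "(\<Sum>u\<in>V. of_bool (u \<in> set l) :: real) \<le> real m" by simp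
  qed
  finally have "(\<Sum>l\<in>listset (replicate (Suc m) V). of_bool (\<not> distinct l) :: real)
      \<le> m * ?N ^ m + real (m\<^sup>2) * ?N ^ m"
    using Suc by (simp add: card_tuples)
  then have "?N * (\<Sum>l\<in>listset (replicate (Suc m) V). of_bool (\<not> distinct l) :: real)
      \<le> ?N * (m * ?N ^ m + real (m\<^sup>2) * ?N ^ m)"
    by (intro mult_left_mono) auto
  also have "\<dots> = (real m + real (m\<^sup>2)) * ?N ^ Suc m" by (simp add: algebra_simps)
  also have "\<dots> \<le> real ((Suc m)\<^sup>2) * ?N ^ Suc m"
    by (intro mult_right_mono) (simp_all add: power2_eq_square algebra_simps)
  finally show ?case .
qed simp

text \<open>Tuples with a repetition and tuples enumerating one of the few rich books are rare, and
  their surplus is at most \<open>card V\<close>. Every other clique has surplus at most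
  \<open>\<gamma> * N + k\<close>, where \<open>k\<close> allows for its own vertices being counted
  through loops.\<close>

lemma few_books_imp_book_bounded:
  fixes q \<gamma> e :: real
  defines "B \<equiv> \<lambda>V c a k q \<gamma>. {Q \<in> mono_copies V c a k.
     real (card (extensions V c a Q)) \<ge> (q ^ k + \<gamma>) * real (card V)}"
  assumes fin: "finite V" and q: "0 \<le> q" and \<gamma>: "0 \<le> \<gamma>"
    and few: "real (card (B V c a k q \<gamma>)) < \<gamma> * real (card V) ^ k"
    and e: "\<gamma> * (real (k ^ k) + 1) \<le> e / 2" "real (k\<^sup>2 + k) \<le> e / 2 * card V"
  shows "book_bounded V (color_kernel c a) q k e"
  unfolding book_bounded_def
proof (intro allI impI)
  fix w :: "'a list \<Rightarrow> real" assume w: "\<forall>l. 0 \<le> w l \<and> w l \<le> 1"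
  define f where "f = color_kernel c a"
  define N where "N = real (card V)"
  define L where "L = listset (replicate k V)"
  define Q where "Q = B V c a k q \<gamma>"
  have f: "edge_kernel f" unfolding f_def by (rule color_kernel_edge_kernel)
  have N0: "0 \<le> N" by (simp add: N_def)
  have finL: "finite L" unfolding L_def by (rule finite_tuples[OF fin])
  have QV: "S \<subseteq> V \<and> card S = k" if "S \<in> Q" for S
    using that by (simp add: Q_def B_def mono_copies_def)
  have finQ: "finite Q"
  proof (rule finite_subset)
    show "Q \<subseteq> Pow V" using QV by blast
  qed (use fin in simp)
  have finS: "finite S" if "S \<in> Q" for S
    using QV[OF that] finite_subset[OF _ fin] by simp
  have point: "w l * clique_wt f l * ((\<Sum>y\<in>V. common f l y) - q ^ k * N)
      \<le> N * of_bool (\<not> distinct l) + N * of_bool (set l \<in> Q) + (\<gamma> * N + k)" if l: "l \<in> L" for l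
  proof -
    define x where "x = w l * clique_wt f l"
    define z where "z = (\<Sum>y\<in>V. common f l y) - q ^ k * N"
    have x: "0 \<le> x" "x \<le> 1"
      unfolding x_def using w clique_wt_bounds[OF f, of l] by (auto intro: mult_le_one)
    have xz: "x * z \<le> max 0 z"
      using x mult_right_mono[OF x(2), of z] mult_nonneg_nonpos[OF x(1), of z] by (cases "0 \<le> z") auto
    have zN: "z \<le> N"
    proof -
      have "(\<Sum>y\<in>V. common f l y) \<le> 1 * N"
        unfolding N_def using common_bounds[OF f] by (intro sum_le_card)
      moreover have "0 \<le> q ^ k * N" using q N0 by simp
      ultimately show ?thesis unfolding z_def by linarith
    qed
    have nn: "0 \<le> \<gamma> * N + k" using \<gamma> N0 by simp
    have "x * z \<le> N * of_bool (\<not> distinct l) + N * of_bool (set l \<in> Q) + (\<gamma> * N + k)"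
    proof (cases "clique_wt f l = 0 \<or> \<not> distinct l \<or> set l \<in> Q")
      case True
      then have "x * z \<le> 0 \<or> \<not> distinct l \<or> set l \<in> Q" by (auto simp: x_def)
      then show ?thesis using xz zN N0 nn by (auto simp: max_def split: if_splits)
    next
      case False
      have lV: "set l \<subseteq> V" "length l = k" using l by (auto simp: L_def mem_tuples_iff)
      have copy: "set l \<in> mono_copies V c a k"
        unfolding mono_copies_def
        using False lV distinct_card[of l] clique_wt_color_kernel[of c a l] by (auto simp: f_def)
      then have ext: "real (card (extensions V c a (set l))) < (q ^ k + \<gamma>) * N"
        using False by (simp add: Q_def B_def N_def not_le)
      have "(\<Sum>y\<in>V. common f l y) = real (card {y \<in> V. \<forall>u\<in>set l. c {u, y} = a})"
        unfolding f_def common_color_kernel using fin by (simp add: of_bool_def sum.If_cases Int_def)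
      also have "\<dots> \<le> card (extensions V c a (set l) \<union> set l)"
        using fin lV by (intro of_nat_mono card_mono) (auto simp: extensions_def insert_commute)
      also have "\<dots> \<le> card (extensions V c a (set l)) + card (set l)" by (intro of_nat_mono card_Un_le)
      also have "\<dots> \<le> real (card (extensions V c a (set l))) + k" using card_length[of l] lV by simp
      finally have "z \<le> \<gamma> * N + k" using ext unfolding z_def distrib_right by linarith
      then show ?thesis using xz nn N0 by (auto simp: max_def split: if_splits)
    qed
    then show ?thesis by (simp add: x_def z_def)
  qed
  \<comment> \<open>A set of size \<open>k\<close> underlies at most \<open>k ^ k\<close> tuples of
    length \<open>k\<close>, a bound that avoids factorials.\<close>
  have cQ: "(\<Sum>l\<in>L. of_bool (set l \<in> Q)) \<le> \<gamma> * N ^ k * real (k ^ k)"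
  proof -
    have "{l \<in> L. set l \<in> Q} \<subseteq> (\<Union>S\<in>Q. {l. set l \<subseteq> S \<and> length l = k})"
      by (auto simp: L_def mem_tuples_iff)
    then have "card {l \<in> L. set l \<in> Q} \<le> card (\<Union>S\<in>Q. {l. set l \<subseteq> S \<and> length l = k})"
      by (intro card_mono finite_UN_I[OF finQ] finite_lists_length_eq finS)
    also have "\<dots> \<le> (\<Sum>S\<in>Q. card {l. set l \<subseteq> S \<and> length l = k})" by (rule card_UN_le[OF finQ])
    also have "\<dots> = (\<Sum>S\<in>Q. k ^ k)"
    proof (rule sum.cong[OF refl])
      fix S assume "S \<in> Q"
      then have "finite S" "card S = k" using QV finS by auto
      then show "card {l. set l \<subseteq> S \<and> length l = k} = k ^ k" by (simp add: card_lists_length_eq)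
    qed
    finally have "card {l \<in> L. set l \<in> Q} \<le> card Q * k ^ k" by simp
    then have "real (card {l \<in> L. set l \<in> Q}) \<le> card Q * real (k ^ k)"
      by (simp only: of_nat_le_iff flip: of_nat_mult)
    also have "\<dots> \<le> \<gamma> * N ^ k * real (k ^ k)"
      using few by (intro mult_right_mono) (auto simp: Q_def N_def)
    finally show ?thesis using finL by (simp add: of_bool_def sum.If_cases Int_def)
  qed
  have "(\<Sum>l\<in>L. w l * clique_wt f l * ((\<Sum>y\<in>V. common f l y) - q ^ k * N))
      \<le> (\<Sum>l\<in>L. N * of_bool (\<not> distinct l) + N * of_bool (set l \<in> Q) + (\<gamma> * N + k))"
    by (intro sum_mono point)
  also have "\<dots> = N * (\<Sum>l\<in>L. of_bool (\<not> distinct l)) + N * (\<Sum>l\<in>L. of_bool (set l \<in> Q)) + N ^ k * (\<gamma> * N + k)"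
    by (simp add: sum.distrib L_def N_def card_tuples flip: sum_distrib_left)
  also have "\<dots> \<le> real (k\<^sup>2) * N ^ k + N * (\<gamma> * N ^ k * real (k ^ k)) + N ^ k * (\<gamma> * N + k)"
    using count_repeating_tuples[OF fin, of k] cQ N0 \<gamma>
    by (intro add_mono mult_left_mono) (auto simp: L_def N_def)
  also have "\<dots> = (real (k\<^sup>2 + k) + \<gamma> * (real (k ^ k) + 1) * N) * N ^ k"
    by (simp add: algebra_simps)
  also have "\<dots> \<le> (e / 2 * N + e / 2 * N) * N ^ k"
    using e N0 by (intro mult_right_mono add_mono) (auto simp: N_def)
  also have "\<dots> = e * N ^ (k + 1)" by simp
  finally show "(\<Sum>l\<in>listset (replicate k V). w l * clique_wt (color_kernel c a) l *
      ((\<Sum>y\<in>V. common (color_kernel c a) l y) - q ^ k * card V)) \<le> e * real (card V) ^ (k + 1)"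
    by (simp add: L_def N_def f_def)
qed

text \<open>Four descents are needed: from \<open>k\<close> to 1 and to 2, for both kernels. Their
  common constant works because both hypotheses weaken as \<open>c\<close> grows, and
  \<open>\<epsilon>\<close> inverts the bound \<open>10 * e * N ^ 4\<close> on the square.\<close>

lemma cut_uniform_imp_uniform:
  fixes p \<theta> :: real
  assumes p: "0 < p" "p < 1" and k: "2 \<le> k" and \<theta>: "0 < \<theta>"
  obtains c :: real where "0 < c"
    "\<And>(V :: 'a set) f A. finite V \<Longrightarrow> edge_kernel f \<Longrightarrow> cut_uniform V f p c A \<Longrightarrow> card V \<le> 6 * card A \<Longrightarrow>
       book_bounded V f p k c \<Longrightarrow> book_bounded V (co_kernel f) (1 - p) k c \<Longrightarrow>
       (\<forall>X Y. X \<subseteq> V \<longrightarrow> Y \<subseteq> V \<longrightarrow> \<bar>\<Sum>x\<in>X. \<Sum>y\<in>Y. f x y - p\<bar> \<le> \<theta> * real (card V) ^ 2)"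
proof -
  define \<epsilon> where "\<epsilon> = \<theta>\<^sup>2 / 10"
  have \<epsilon>: "0 < \<epsilon>" using \<theta> by (simp add: \<epsilon>_def)
  have p': "0 < p" "p \<le> 1" "0 < 1 - p" "1 - p \<le> 1" using p by auto
  obtain c1 :: real where c1: "0 < c1" "\<And>(V :: 'a set) f A. finite V \<Longrightarrow> edge_kernel f \<Longrightarrow>
      cut_uniform V f p c1 A \<Longrightarrow> card V \<le> 6 * card A \<Longrightarrow>
      book_bounded V f p (1 + (k - 1)) c1 \<Longrightarrow> book_bounded V f p 1 \<epsilon>"
    by (rule book_bounded_descend[OF p'(1,2) \<epsilon>, where m = 1 and r = "k - 1"]) (rule that)
  obtain c2 :: real where c2: "0 < c2" "\<And>(V :: 'a set) f A. finite V \<Longrightarrow> edge_kernel f \<Longrightarrow>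
      cut_uniform V f p c2 A \<Longrightarrow> card V \<le> 6 * card A \<Longrightarrow>
      book_bounded V f p (2 + (k - 2)) c2 \<Longrightarrow> book_bounded V f p 2 \<epsilon>"
    by (rule book_bounded_descend[OF p'(1,2) \<epsilon>, where m = 2 and r = "k - 2"]) (rule that)
  obtain c3 :: real where c3: "0 < c3" "\<And>(V :: 'a set) f A. finite V \<Longrightarrow> edge_kernel f \<Longrightarrow>
      cut_uniform V f (1 - p) c3 A \<Longrightarrow> card V \<le> 6 * card A \<Longrightarrow>
      book_bounded V f (1 - p) (1 + (k - 1)) c3 \<Longrightarrow> book_bounded V f (1 - p) 1 \<epsilon>"
    by (rule book_bounded_descend[OF p'(3,4) \<epsilon>, where m = 1 and r = "k - 1"]) (rule that)
  obtain c4 :: real where c4: "0 < c4" "\<And>(V :: 'a set) f A. finite V \<Longrightarrow> edge_kernel f \<Longrightarrow>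
      cut_uniform V f (1 - p) c4 A \<Longrightarrow> card V \<le> 6 * card A \<Longrightarrow>
      book_bounded V f (1 - p) (2 + (k - 2)) c4 \<Longrightarrow> book_bounded V f (1 - p) 2 \<epsilon>"
    by (rule book_bounded_descend[OF p'(3,4) \<epsilon>, where m = 2 and r = "k - 2"]) (rule that)
  have k12: "1 + (k - 1) = k" "2 + (k - 2) = k" using k by auto
  define c where "c = min (min c1 c2) (min c3 c4)"
  have c: "0 < c" "c \<le> c1" "c \<le> c2" "c \<le> c3" "c \<le> c4"
    using c1(1) c2(1) c3(1) c4(1) by (auto simp: c_def)
  have cut_mono: "cut_uniform V f q c' A" if "cut_uniform V f q c A" "c \<le> c'" for V :: "'a set" and f q c' A
    using that unfolding cut_uniform_def by (meson mult_right_mono order_trans zero_le_power of_nat_0_le_iff)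
  show ?thesis
  proof (rule that[OF c(1)])
    fix V :: "'a set" and f A
    assume V: "finite V" and f: "edge_kernel f" and A: "cut_uniform V f p c A" "card V \<le> 6 * card A"
      and bb: "book_bounded V f p k c" "book_bounded V (co_kernel f) (1 - p) k c"
    note co = kernel_co[OF f] cut_uniform_co[OF A(1)]
    have b1: "book_bounded V f p 1 \<epsilon>"
      using c1(2)[OF V f cut_mono[OF A(1) c(2)] A(2)] book_bounded_mono[OF bb(1) c(2)] k12 by simp
    have b2: "book_bounded V f p 2 \<epsilon>"
      using c2(2)[OF V f cut_mono[OF A(1) c(3)] A(2)] book_bounded_mono[OF bb(1) c(3)] k12 by simp
    have b3: "book_bounded V (co_kernel f) (1 - p) 1 \<epsilon>"
      using c3(2)[OF V co(1) cut_mono[OF co(2) c(4)] A(2)] book_bounded_mono[OF bb(2) c(4)] k12 by simp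
    have b4: "book_bounded V (co_kernel f) (1 - p) 2 \<epsilon>"
      using c4(2)[OF V co(1) cut_mono[OF co(2) c(5)] A(2)] book_bounded_mono[OF bb(2) c(5)] k12 by simp
    show "\<forall>X Y. X \<subseteq> V \<longrightarrow> Y \<subseteq> V \<longrightarrow> \<bar>\<Sum>x\<in>X. \<Sum>y\<in>Y. f x y - p\<bar> \<le> \<theta> * real (card V) ^ 2"
    proof (intro allI impI)
      fix X Y assume "X \<subseteq> V" "Y \<subseteq> V"
      then have "(\<Sum>x\<in>X. \<Sum>y\<in>Y. f x y - p)\<^sup>2 \<le> 10 * \<epsilon> * real (card V) ^ 4"
        using p \<epsilon> by (intro book_bounded_imp_uniform[OF V f _ _ _ b1 b3 b2 b4]) auto
      also have "\<dots> = (\<theta> * real (card V) ^ 2)\<^sup>2" by (simp add: \<epsilon>_def power_mult_distrib)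
      finally have "\<bar>\<Sum>x\<in>X. \<Sum>y\<in>Y. f x y - p\<bar> \<le> \<bar>\<theta> * real (card V) ^ 2\<bar>"
        by (simp only: abs_le_square_iff)
      then show "\<bar>\<Sum>x\<in>X. \<Sum>y\<in>Y. f x y - p\<bar> \<le> \<theta> * real (card V) ^ 2" using \<theta> by simp
    qed
  qed
qed

lemma book_bounded_imp_uniform_pairs:
  fixes p \<theta> :: real
  assumes p: "0 < p" "p < 1" and k: "large_exponent p k" "large_exponent (1 - p) k" and \<theta>: "0 < \<theta>"
  obtains e :: real where "0 < e"
    "\<And>(V :: 'a set) f X Y. finite V \<Longrightarrow> edge_kernel f \<Longrightarrow>
       book_bounded V f p k e \<Longrightarrow> book_bounded V (co_kernel f) (1 - p) k e \<Longrightarrow> X \<subseteq> V \<Longrightarrow> Y \<subseteq> V \<Longrightarrow>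
       \<bar>\<Sum>x\<in>X. \<Sum>y\<in>Y. f x y - p\<bar> \<le> \<theta> * real (card V) ^ 2"
proof -
  have k2: "2 \<le> k" using k by (simp add: large_exponent_def)
  have p': "0 < 1 - p" "1 - p < 1" using p by auto
  obtain c :: real where c: "0 < c"
    "\<And>(V :: 'a set) f A. finite V \<Longrightarrow> edge_kernel f \<Longrightarrow> cut_uniform V f p c A \<Longrightarrow> card V \<le> 6 * card A \<Longrightarrow>
       book_bounded V f p k c \<Longrightarrow> book_bounded V (co_kernel f) (1 - p) k c \<Longrightarrow>
       (\<forall>X Y. X \<subseteq> V \<longrightarrow> Y \<subseteq> V \<longrightarrow> \<bar>\<Sum>x\<in>X. \<Sum>y\<in>Y. f x y - p\<bar> \<le> \<theta> * real (card V) ^ 2)"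
    by (rule cut_uniform_imp_uniform[OF p k2 \<theta>]) (rule that)
  obtain \<mu> :: real where \<mu>: "0 < \<mu>" "\<And>(S :: 'a set) f. finite S \<Longrightarrow> edge_kernel f \<Longrightarrow>
      (\<Sum>l\<in>listset (replicate k S). clique_wt f l) \<ge> \<mu> * real (card S) ^ k
      \<or> (\<Sum>l\<in>listset (replicate k S). clique_wt (co_kernel f) l) \<ge> \<mu> * real (card S) ^ k"
    by (rule clique_supersaturation) (rule that)
  note U = uniform_set_of_rich_family[where ?'a = 'a, OF _ _ _ \<mu>(1) c(1)]
  obtain d1 :: real where d1: "0 < d1"
    "\<And>(d::real) (\<eta>::real). 0 < d \<Longrightarrow> d \<le> d1 \<Longrightarrow> 0 < \<eta> \<Longrightarrow> \<exists>e0>0. \<forall>(V :: 'a set) f F e.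
       finite V \<longrightarrow> 0 < card V \<longrightarrow> edge_kernel f \<longrightarrow> finite F \<longrightarrow> pairwise disjnt F \<longrightarrow>
       (\<forall>P\<in>F. regular_set V f d P \<and> \<eta> * real (card V) \<le> real (card P) \<and> clique_rich f k \<mu> P) \<longrightarrow>
       card V \<le> 3 * card (\<Union>F) \<longrightarrow> 0 \<le> e \<longrightarrow> e \<le> e0 \<longrightarrow>
       book_bounded V f p k e \<longrightarrow> book_bounded V (co_kernel f) (1 - p) k e \<longrightarrow>
       (\<exists>A. cut_uniform V f p c A \<and> card V \<le> 6 * card A)"
    by (rule U[OF p k(1)]) (rule that)
  obtain d2 :: real where d2: "0 < d2"
    "\<And>(d::real) (\<eta>::real). 0 < d \<Longrightarrow> d \<le> d2 \<Longrightarrow> 0 < \<eta> \<Longrightarrow> \<exists>e0>0. \<forall>(V :: 'a set) f F e.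
       finite V \<longrightarrow> 0 < card V \<longrightarrow> edge_kernel f \<longrightarrow> finite F \<longrightarrow> pairwise disjnt F \<longrightarrow>
       (\<forall>P\<in>F. regular_set V f d P \<and> \<eta> * real (card V) \<le> real (card P) \<and> clique_rich f k \<mu> P) \<longrightarrow>
       card V \<le> 3 * card (\<Union>F) \<longrightarrow> 0 \<le> e \<longrightarrow> e \<le> e0 \<longrightarrow>
       book_bounded V f (1 - p) k e \<longrightarrow> book_bounded V (co_kernel f) (1 - (1 - p)) k e \<longrightarrow>
       (\<exists>A. cut_uniform V f (1 - p) c A \<and> card V \<le> 6 * card A)"
    by (rule U[OF p' k(2)]) (rule that)
  define d where "d = min 1 (min d1 d2)"
  have d: "0 < d" "d \<le> 1" "d \<le> d1" "d \<le> d2" using d1(1) d2(1) by (auto simp: d_def)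
  obtain \<eta>0 :: real where \<eta>0: "0 < \<eta>0"
    "\<And>(V :: 'a set) (f :: 'a \<Rightarrow> 'a \<Rightarrow> real) T. finite V \<Longrightarrow> edge_kernel f \<Longrightarrow> T \<subseteq> V \<Longrightarrow> T \<noteq> {} \<Longrightarrow>
      \<exists>S\<subseteq>T. regular_set V f d S \<and> card S \<ge> \<eta>0 * card T"
    by (rule regular_subset[OF d(1,2)]) (rule that)
  \<comment> \<open>Regular sets are sought in remainders that still contain more than a third of
    the vertices.\<close>
  define \<eta> where "\<eta> = \<eta>0 / 3"
  have \<eta>: "0 < \<eta>" using \<eta>0(1) by (simp add: \<eta>_def)
  from d1(2)[OF d(1,3) \<eta>] obtain e1 :: real where e1: "0 < e1" "\<forall>(V :: 'a set) f F e.
       finite V \<longrightarrow> 0 < card V \<longrightarrow> edge_kernel f \<longrightarrow> finite F \<longrightarrow> pairwise disjnt F \<longrightarrow>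
       (\<forall>P\<in>F. regular_set V f d P \<and> \<eta> * real (card V) \<le> real (card P) \<and> clique_rich f k \<mu> P) \<longrightarrow>
       card V \<le> 3 * card (\<Union>F) \<longrightarrow> 0 \<le> e \<longrightarrow> e \<le> e1 \<longrightarrow>
       book_bounded V f p k e \<longrightarrow> book_bounded V (co_kernel f) (1 - p) k e \<longrightarrow>
       (\<exists>A. cut_uniform V f p c A \<and> card V \<le> 6 * card A)" by (elim exE conjE) (rule that)
  from d2(2)[OF d(1,4) \<eta>] obtain e2 :: real where e2: "0 < e2" "\<forall>(V :: 'a set) f F e.
       finite V \<longrightarrow> 0 < card V \<longrightarrow> edge_kernel f \<longrightarrow> finite F \<longrightarrow> pairwise disjnt F \<longrightarrow>
       (\<forall>P\<in>F. regular_set V f d P \<and> \<eta> * real (card V) \<le> real (card P) \<and> clique_rich f k \<mu> P) \<longrightarrow>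
       card V \<le> 3 * card (\<Union>F) \<longrightarrow> 0 \<le> e \<longrightarrow> e \<le> e2 \<longrightarrow>
       book_bounded V f (1 - p) k e \<longrightarrow> book_bounded V (co_kernel f) (1 - (1 - p)) k e \<longrightarrow>
       (\<exists>A. cut_uniform V f (1 - p) c A \<and> card V \<le> 6 * card A)" by (elim exE conjE) (rule that)
  define e where "e = min c (min e1 e2)"
  have e: "0 < e" "e \<le> c" "e \<le> e1" "e \<le> e2" "0 \<le> e" using c(1) e1(1) e2(1) by (auto simp: e_def)
  show ?thesis
  proof (rule that[OF e(1)])
    fix V :: "'a set" and f X Y
    assume V: "finite V" and f: "edge_kernel f" and XY: "X \<subseteq> V" "Y \<subseteq> V"
      and bb: "book_bounded V f p k e" "book_bounded V (co_kernel f) (1 - p) k e"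
    show "\<bar>\<Sum>x\<in>X. \<Sum>y\<in>Y. f x y - p\<bar> \<le> \<theta> * real (card V) ^ 2"
    proof (cases "V = {}")
      case True
      then show ?thesis using XY by simp
    next
      case False
      then have V0: "0 < card V" using V by (simp add: card_gt_0_iff)
      define N where "N = real (card V)"
      define G where "G S \<longleftrightarrow> regular_set V f d S \<and> \<eta> * N \<le> real (card S)" for S
      have exG: "\<exists>S\<subseteq>T. S \<noteq> {} \<and> G S" if T: "T \<subseteq> V" "N / 3 < real (card T)" for T
      proof -
        have "T \<noteq> {}" using T(2) by (auto simp: N_def)
        from \<eta>0(2)[OF V f T(1) this] obtain S where S: "S \<subseteq> T" "regular_set V f d S" "card S \<ge> \<eta>0 * card T"
          by blast
        have "\<eta> * N = \<eta>0 * (N / 3)" by (simp add: \<eta>_def)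
        also have "\<dots> \<le> \<eta>0 * card T" using T(2) \<eta>0(1) by (intro mult_left_mono) auto
        finally have "G S" using S by (simp add: G_def)
        moreover have "S \<noteq> {}" using S(2) by (simp add: regular_set_def)
        ultimately show ?thesis using S(1) by blast
      qed
      obtain F where F: "finite F" "pairwise disjnt F" "\<And>S. S \<in> F \<Longrightarrow> S \<subseteq> V \<and> G S"
        "real (card (V - \<Union>F)) \<le> N / 3"
        by (rule exhaust_by_disjoint[where G = G and t = "N / 3", OF V]) (rule exG, assumption, assumption, rule that)
      define F1 where "F1 = {P \<in> F. clique_rich f k \<mu> P}"
      define F2 where "F2 = {P \<in> F. clique_rich (co_kernel f) k \<mu> P}"
      have F12: "finite F1" "finite F2" "pairwise disjnt F1" "pairwise disjnt F2"
        using F(1) by (auto simp: F1_def F2_def intro: pairwise_subset[OF F(2)])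
      have finP: "finite P" if "P \<in> F" for P
        by (rule finite_subset[OF conjunct1[OF F(3)[OF that]] V])
      have "clique_rich f k \<mu> P \<or> clique_rich (co_kernel f) k \<mu> P" if "P \<in> F" for P
        using \<mu>(2)[OF finP[OF that] f] by (simp add: clique_rich_def)
      then have "F = F1 \<union> F2" by (auto simp: F1_def F2_def)
      then have "\<Union>F = \<Union>F1 \<union> \<Union>F2" by (simp only: Union_Un_distrib)
      then have "V \<subseteq> (V - \<Union>F) \<union> (\<Union>F1 \<union> \<Union>F2)" by auto
      then have "card V \<le> card ((V - \<Union>F) \<union> (\<Union>F1 \<union> \<Union>F2))"
        using V F12 finP by (intro card_mono) (auto simp: F1_def F2_def)
      also have "\<dots> \<le> card (V - \<Union>F) + (card (\<Union>F1) + card (\<Union>F2))"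
        by (intro order_trans[OF card_Un_le] add_left_mono card_Un_le)
      finally have "N \<le> real (card (V - \<Union>F)) + (card (\<Union>F1) + card (\<Union>F2))" by (simp add: N_def)
      \<comment> \<open>At most a third is left uncovered, so the two families share two thirds and
        one of them covers a third.\<close>
      then have "2 * N \<le> 3 * real (card (\<Union>F1) + card (\<Union>F2))" using F(4) by simp
      then have "2 * card V \<le> 3 * (card (\<Union>F1) + card (\<Union>F2))" unfolding N_def by linarith
      then have "card V \<le> 3 * card (\<Union>F1) \<or> card V \<le> 3 * card (\<Union>F2)" by arith
      then consider "card V \<le> 3 * card (\<Union>F1)" | "card V \<le> 3 * card (\<Union>F2)" by blast
      then obtain A where A: "cut_uniform V f p c A" "card V \<le> 6 * card A"
      proof cases
        case 1
        have "\<exists>A. cut_uniform V f p c A \<and> card V \<le> 6 * card A"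
          by (rule e1(2)[rule_format, OF V V0 f F12(1,3) _ 1 e(5,3) bb])
            (use F(3) in \<open>auto simp: F1_def G_def N_def\<close>)
        then show ?thesis using that by blast
      next
        case 2
        \<comment> \<open>The argument runs with the two kernels exchanged and \<open>1 - p\<close>
          for \<open>p\<close>; uniformity of \<open>A\<close> then passes back to
          \<open>f\<close>.\<close>
        have coco: "co_kernel (co_kernel f) = f" "1 - (1 - p) = p" by (auto intro!: ext)
        have bb': "book_bounded V (co_kernel (co_kernel f)) (1 - (1 - p)) k e" using bb(1) unfolding coco .
        have "\<exists>A. cut_uniform V (co_kernel f) (1 - p) c A \<and> card V \<le> 6 * card A"
          by (rule e2(2)[rule_format, OF V V0 kernel_co[OF f] F12(2,4) _ 2 e(5,4) bb(2) bb'])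
            (use F(3) regular_set_co[OF V] in \<open>auto simp: F2_def G_def N_def\<close>)
        then obtain A where "cut_uniform V (co_kernel f) (1 - p) c A" "card V \<le> 6 * card A" by blast
        then show ?thesis using that[of A] cut_uniform_co[of V "co_kernel f" "1 - p" c A] unfolding coco by blast
      qed
      show ?thesis
        using c(2)[OF V f A book_bounded_mono[OF bb(1) e(2)] book_bounded_mono[OF bb(2) e(2)]] XY by blast
    qed
  qed
qed

theorem theorem1p4:
  fixes p :: real
  assumes "1 / 2 \<le> p" and "p < 1"
  shows "\<exists>k0::nat. \<forall>k\<ge>k0. \<forall>\<theta>::real. \<theta> > 0 \<longrightarrow>
    (\<exists>\<gamma>::real. \<gamma> > 0 \<and> (\<exists>N0::nat. \<forall>N\<ge>N0. \<forall>c :: nat set \<Rightarrow> color.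
       \<not> quasirandom p \<theta> {..<N} c \<longrightarrow>
         real (card {Q \<in> mono_copies {..<N} c Red k.
            real (card (extensions {..<N} c Red Q)) \<ge> ((1 - p) ^ k + \<gamma>) * real N})
           \<ge> \<gamma> * real N ^ k
       \<or> real (card {Q \<in> mono_copies {..<N} c Blue k.
            real (card (extensions {..<N} c Blue Q)) \<ge> (p ^ k + \<gamma>) * real N})
           \<ge> \<gamma> * real N ^ k))"
proof -
  have p: "0 < p" "p < 1" "0 < 1 - p" "1 - p < 1" using assms by auto
  \<comment> \<open>Either color may be the rich one, so the exponent must be large for
    \<open>p\<close> and for \<open>1 - p\<close>.\<close>
  have "eventually (\<lambda>k. large_exponent p k \<and> large_exponent (1 - p) k) sequentially"
    using eventually_large_exponent p by (intro eventually_conj) auto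
  then obtain k0 where k0: "\<And>k. k \<ge> k0 \<Longrightarrow> large_exponent p k \<and> large_exponent (1 - p) k"
    by (auto simp: eventually_sequentially)
  show ?thesis
  proof (intro exI[of _ k0] allI impI)
    fix k :: nat and \<theta> :: real
    assume k: "k0 \<le> k" and \<theta>: "0 < \<theta>"
    obtain e :: real where e: "0 < e" "\<And>(V :: nat set) f X Y. finite V \<Longrightarrow> edge_kernel f \<Longrightarrow>
       book_bounded V f p k e \<Longrightarrow> book_bounded V (co_kernel f) (1 - p) k e \<Longrightarrow> X \<subseteq> V \<Longrightarrow> Y \<subseteq> V \<Longrightarrow>
       \<bar>\<Sum>x\<in>X. \<Sum>y\<in>Y. f x y - p\<bar> \<le> \<theta> * real (card V) ^ 2"
      by (rule book_bounded_imp_uniform_pairs[OF p(1,2) conjunct1[OF k0[OF k]] conjunct2[OF k0[OF k]] \<theta>]) (rule that)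
    define K where "K = real (k ^ k) + 1"
    define \<gamma> where "\<gamma> = e / 2 / K"
    have K: "0 < K" unfolding K_def by (rule add_nonneg_pos) auto
    then have "0 < \<gamma>" "\<gamma> * K \<le> e / 2" using e(1) by (auto simp: \<gamma>_def)
    then have \<gamma>: "0 < \<gamma>" "\<gamma> * (real (k ^ k) + 1) \<le> e / 2" by (simp_all only: K_def)
    \<comment> \<open>From \<open>N0\<close> on, the tuples with repetitions and the loops take up
      only half of the error \<open>e\<close>; the choice of \<open>\<gamma>\<close> accounts for
      the other half.\<close>
    obtain N0 :: nat where N0: "real (k\<^sup>2 + k) / (e / 2) \<le> real N0" using real_arch_simple by blast
    show "\<exists>\<gamma>::real. \<gamma> > 0 \<and> (\<exists>N0::nat. \<forall>N\<ge>N0. \<forall>c :: nat set \<Rightarrow> color.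
       \<not> quasirandom p \<theta> {..<N} c \<longrightarrow>
         real (card {Q \<in> mono_copies {..<N} c Red k.
            real (card (extensions {..<N} c Red Q)) \<ge> ((1 - p) ^ k + \<gamma>) * real N})
           \<ge> \<gamma> * real N ^ k
       \<or> real (card {Q \<in> mono_copies {..<N} c Blue k.
            real (card (extensions {..<N} c Blue Q)) \<ge> (p ^ k + \<gamma>) * real N})
           \<ge> \<gamma> * real N ^ k)"
    proof (intro exI[of _ \<gamma>] exI[of _ N0] conjI \<gamma>(1) allI impI)
      fix N :: nat and c :: "nat set \<Rightarrow> color"
      assume N: "N0 \<le> N" and nq: "\<not> quasirandom p \<theta> {..<N} c"
      have big: "real (k\<^sup>2 + k) \<le> e / 2 * card {..<N}"
      proof -
        have "real (k\<^sup>2 + k) / (e / 2) \<le> real N" using N0 N by linarith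
        then show ?thesis using e(1) by (simp add: pos_divide_le_eq mult.commute)
      qed
      show "real (card {Q \<in> mono_copies {..<N} c Red k.
            real (card (extensions {..<N} c Red Q)) \<ge> ((1 - p) ^ k + \<gamma>) * real N})
           \<ge> \<gamma> * real N ^ k
       \<or> real (card {Q \<in> mono_copies {..<N} c Blue k.
            real (card (extensions {..<N} c Blue Q)) \<ge> (p ^ k + \<gamma>) * real N})
           \<ge> \<gamma> * real N ^ k"
      proof (rule ccontr)
        assume contra: "\<not> ?thesis"
        have blue: "book_bounded {..<N} (color_kernel c Blue) p k e"
          using p \<gamma> big contra by (intro few_books_imp_book_bounded[where \<gamma> = \<gamma>]) (auto simp: not_le)
        have "book_bounded {..<N} (color_kernel c Red) (1 - p) k e"
          using p \<gamma> big contra by (intro few_books_imp_book_bounded[where \<gamma> = \<gamma>]) (auto simp: not_le)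
        then have red: "book_bounded {..<N} (co_kernel (color_kernel c Blue)) (1 - p) k e"
          unfolding color_kernel_Red .
        have "quasirandom p \<theta> {..<N} c"
          unfolding quasirandom_def
        proof (intro allI impI)
          fix X Y assume XY: "X \<subseteq> {..<N} \<and> Y \<subseteq> {..<N} \<and> X \<inter> Y = {}"
          then have fin: "finite X" "finite Y" using finite_subset by blast+
          have "{(x, y). x \<in> X \<and> y \<in> Y \<and> c {x, y} = Blue} = (SIGMA x:X. {y \<in> Y. c {x, y} = Blue})" by auto
          then have "real (blue_edges_between c X Y) = (\<Sum>x\<in>X. real (card {y \<in> Y. c {x, y} = Blue}))"
            unfolding blue_edges_between_def using fin by (simp add: card_SigmaI)
          also have "\<dots> = (\<Sum>x\<in>X. \<Sum>y\<in>Y. color_kernel c Blue x y)"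
            using fin by (simp add: color_kernel_def of_bool_def sum.If_cases Int_def)
          finally have "real (blue_edges_between c X Y) - p * real (card X) * real (card Y)
              = (\<Sum>x\<in>X. \<Sum>y\<in>Y. color_kernel c Blue x y - p)"
            by (simp add: sum_subtractf mult_ac)
          also have "\<bar>\<dots>\<bar> \<le> \<theta> * real (card {..<N}) ^ 2"
            using XY by (intro e(2)[OF _ color_kernel_edge_kernel blue red]) auto
          finally show "\<bar>real (blue_edges_between c X Y) - p * real (card X) * real (card Y)\<bar>
              \<le> \<theta> * real (card {..<N}) ^ 2" .
        qed
        with nq show False by simp
      qed
    qed
  qed
qed

end
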